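(* Let $a>4L_F$, where $a=\frac\alpha2-\left|\frac\alpha2-\frac{\delta K\lambda_1}{\alpha}\right|$ and $L_F=\frac{2c_2|\beta|}{\alpha}$. Then the rotation number of the random system $\dot u=v+z(\theta_t\omega)$, $\dot v=-KAu-\alpha v+f-\beta g(u)+(1-\alpha)z(\theta_t\omega)$ exists; that is, there is $\rho\in\mathbb{R}$ such that for $\mathbb{P}$-a.e. $\omega\in\Omega$ and each $Y_0\in E$ the limit $\lim_{t\to\infty}\frac{PY(t,\omega,Y_0)}{t}$ exists and equals $\rho\eta_0$.
   Context: Data. $N\ge2$, $d\ge1$ are integers, $\mathbb{Z}^d_N=\{j\in\mathbb{Z}^d:1\le j_1,\dots,j_d\le N\}$; $\alpha,K>0$, $\beta\in\mathbb{R}$, $\delta\in(0,1]$, and $f=(f_j)$, $(\epsilon_j)$ are constant vectors in $\mathbb{R}^{N^d}$ indexed by $\mathbb{Z}^d_N$. $A$ is an $N^d\times N^d$ nonnegative definite symmetric matrix with eigenvalues $0=\lambda_0<\lambda_1\le\dots\le\lambda_{N^d-1}$, with $\lambda_0=0$ algebraically simple and $(1,\dots,1)^\top$ an eigenvector for $\lambda_0$. $g\in C^1(\mathbb{R},\mathbb{R})$ satisfies $g(x+\kappa)=g(x)$, $|g(x)|\le c_1$, $|g'(x)|\le c_2$ for all $x$, where $c_1,c_2>0$ and $\kappa>0$ is the smallest positive period of $g$; $g(u)=(g(u_j))_j$ for $u\in\mathbb{R}^{N^d}$. Noise. $\Omega_0=\{\omega_0\in C(\mathbb{R},\mathbb{R}):\omega_0(0)=0\}$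 with the compact-open topology, Borel $\sigma$-algebra and (two-sided) Wiener measure; $(\Omega,\mathcal{F},\mathbb{P})$ is the product of copies of this space over $j\in\mathbb{Z}^d_N$; $\theta_t\omega(\cdot)=\omega(\cdot+t)-\omega(t)$. $W(t)=(\epsilon_jW_j(t))_j$ with $W_j(t)(\omega)=\omega_j(t)$. $z(\theta_t\omega)=(z_j(\theta_t\omega))_j$ is the unique stationary solution of $dz+z\,dt=dW(t)$ in $\mathbb{R}^{N^d}$ (explicitly $z_j(\omega)=-\epsilon_j\int_{-\infty}^0e^s\omega_j(s)\,ds$). $\Omega$ is replaced, without change of notation, by a $\theta_t$-invariant full-measure subset on which $t\mapsto z_j(\theta_t\omega)$ is (defined and) continuous for all $j$. System and spaces. $E=\mathbb{R}^{N^d}\times\mathbb{R}^{N^d}$; $Y(t,\omega,Y_0)$, $t\ge0$, is the solution $(u,v)^\top$ of the random system in the claim with $Y(0,\omega,Y_0)=Y_0\in E$. $\eta_0=(1,\dots,1,0,\dots,0)^\top$, $\eta_{-1}=(1,\dots,1,-\alpha,\dots,-\alpha)^\top\in E$ (first $N^d$ entries $1$); $E_1=\mathrm{span}\{\eta_0\}$, $E_{-1}=\mathrm{span}\{\eta_{-1}\}$, $E_{11}=E_1+E_{-1}$, $E_{22}=E_{11}^\perp$ (Euclidean orthogonal complement in $E$), $E_2=E_{-1}\oplus E_{22}$, so $E=E_1\oplus E_2$; $P$ is the projection of $E$ onto $E_1$ along $E_2$. *)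

theory Defs
  imports "HOL-Probability.Probability"
begin

text \<open>
  The lattice \<open>{1..N}^d\<close> is rendered by the index type \<^typ>\<open>'n ^ 'd\<close> with \<open>N = CARD('n)\<close>,
  \<open>d = CARD('d)\<close>; it has \<open>N^d\<close> elements. Where only the number of lattice sites
  matters, a finite type \<open>'i\<close> takes its place.
\<close>

section \<open>Wiener space\<close>

definition path_space :: "(real \<Rightarrow> real) set" where
  "path_space = {w. continuous_on UNIV w \<and> w 0 = 0}"

definition compact_open_topology :: "(real \<Rightarrow> real) topology" where
  "compact_open_topology =
     topology_generated_by {{w \<in> path_space. w ` C \<subseteq> U} | C U. compact C \<and> open U}"

definition path_borel :: "(real \<Rightarrow> real) measure" where
  "path_borel = sigma path_space {U. openin compact_open_topology U}"

text \<open>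
  Two-sided Wiener measure is the unique probability measure on the Borel sets of the path space
  under which the coordinate process has independent increments over successive intervals of the
  whole real line, the increment from \<open>s\<close> to \<open>t\<close> being centred Gaussian with variance \<open>t - s\<close>.
  The starting condition \<open>w 0 = 0\<close> is part of \<^const>\<open>path_space\<close>.
\<close>

definition two_sided_wiener :: "(real \<Rightarrow> real) measure \<Rightarrow> bool" where
  "two_sided_wiener M \<longleftrightarrow>
     prob_space M \<and> space M = path_space \<and> sets M = sets path_borel \<and>
     (\<forall>s t. s < t \<longrightarrow>
        distributed M lborel (\<lambda>w. w t - w s) (\<lambda>x. ennreal (normal_density 0 (sqrt (t - s)) x))) \<and>
     (\<forall>n (t :: nat \<Rightarrow> real). (\<forall>i<n. t i < t (Suc i)) \<longrightarrow>
        prob_space.indep_vars M (\<lambda>_. borel) (\<lambda>i w. w (t (Suc i)) - w (t i)) {..<n})"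

definition noise_space :: "(real \<Rightarrow> real) measure \<Rightarrow> ('i::finite \<Rightarrow> real \<Rightarrow> real) measure" where
  "noise_space M = PiM UNIV (\<lambda>_. M)"

definition shift :: "real \<Rightarrow> ('i \<Rightarrow> real \<Rightarrow> real) \<Rightarrow> 'i \<Rightarrow> real \<Rightarrow> real" where
  "shift t \<omega> = (\<lambda>j s. \<omega> j (s + t) - \<omega> j t)"

text \<open>
  The stationary solution of \<open>dz + z dt = dW\<close> with \<open>W = (\<epsilon>\<^sub>j W\<^sub>j)\<^sub>j\<close>, evaluated at \<open>\<omega>\<close>; along the flow
  it is \<open>t \<mapsto> ou_stationary \<epsilon> (shift t \<omega>)\<close>. The integral converges absolutely for almost every \<open>\<omega>\<close>.
\<close>

definition ou_stationary :: "real ^ 'i \<Rightarrow> ('i::finite \<Rightarrow> real \<Rightarrow> real) \<Rightarrow> real ^ 'i" where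
  "ou_stationary \<epsilon> \<omega> = (\<chi> j. - (\<epsilon> $ j) * (LINT s:{..0}|lborel. exp s * \<omega> j s))"

section \<open>The random system\<close>

definition rhs ::
  "real \<Rightarrow> real \<Rightarrow> real \<Rightarrow> real ^ 'i ^ 'i \<Rightarrow> real ^ 'i \<Rightarrow> (real \<Rightarrow> real) \<Rightarrow> real ^ 'i
     \<Rightarrow> (real ^ 'i::finite) \<times> (real ^ 'i) \<Rightarrow> (real ^ 'i) \<times> (real ^ 'i)" where
  "rhs \<alpha> \<beta> K A f g \<zeta> = (\<lambda>(u, v).
     (v + \<zeta>,
      - (K *\<^sub>R (A *v u)) - \<alpha> *\<^sub>R v + f - \<beta> *\<^sub>R (\<chi> j. g (u $ j)) + (1 - \<alpha>) *\<^sub>R \<zeta>))"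

definition is_solution ::
  "real \<Rightarrow> real \<Rightarrow> real \<Rightarrow> real ^ 'i ^ 'i \<Rightarrow> real ^ 'i \<Rightarrow> (real \<Rightarrow> real) \<Rightarrow> real ^ 'i
     \<Rightarrow> ('i::finite \<Rightarrow> real \<Rightarrow> real) \<Rightarrow> (real ^ 'i) \<times> (real ^ 'i)
     \<Rightarrow> (real \<Rightarrow> (real ^ 'i) \<times> (real ^ 'i)) \<Rightarrow> bool" where
  "is_solution \<alpha> \<beta> K A f g \<epsilon> \<omega> Y\<^sub>0 Y \<longleftrightarrow>
     Y 0 = Y\<^sub>0 \<and>
     (\<forall>t\<ge>0. (Y has_vector_derivative
               rhs \<alpha> \<beta> K A f g (ou_stationary \<epsilon> (shift t \<omega>)) (Y t)) (at t within {0..}))"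

text \<open>
  The description is applied to the value at time \<open>t \<ge> 0\<close>, because a solution is determined
  by its initial value on \<open>{0..}\<close> only.
\<close>

definition solution ::
  "real \<Rightarrow> real \<Rightarrow> real \<Rightarrow> real ^ 'i ^ 'i \<Rightarrow> real ^ 'i \<Rightarrow> (real \<Rightarrow> real) \<Rightarrow> real ^ 'i
     \<Rightarrow> real \<Rightarrow> ('i::finite \<Rightarrow> real \<Rightarrow> real) \<Rightarrow> (real ^ 'i) \<times> (real ^ 'i)
     \<Rightarrow> (real ^ 'i) \<times> (real ^ 'i)" where
  "solution \<alpha> \<beta> K A f g \<epsilon> t \<omega> Y\<^sub>0 =
     (THE y. \<exists>Y. is_solution \<alpha> \<beta> K A f g \<epsilon> \<omega> Y\<^sub>0 Y \<and> Y t = y)"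

section \<open>The splitting of the phase space\<close>

definition eta0 :: "(real ^ 'i::finite) \<times> (real ^ 'i)" where
  "eta0 = ((\<chi> j. 1), 0)"

definition eta_m1 :: "real \<Rightarrow> (real ^ 'i::finite) \<times> (real ^ 'i)" where
  "eta_m1 \<alpha> = ((\<chi> j. 1), (\<chi> j. - \<alpha>))"

definition E1 :: "((real ^ 'i::finite) \<times> (real ^ 'i)) set" where
  "E1 = span {eta0}"

definition E_m1 :: "real \<Rightarrow> ((real ^ 'i::finite) \<times> (real ^ 'i)) set" where
  "E_m1 \<alpha> = span {eta_m1 \<alpha>}"

definition E11 :: "real \<Rightarrow> ((real ^ 'i::finite) \<times> (real ^ 'i)) set" where
  "E11 \<alpha> = {x + y | x y. x \<in> E1 \<and> y \<in> E_m1 \<alpha>}"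

definition E22 :: "real \<Rightarrow> ((real ^ 'i::finite) \<times> (real ^ 'i)) set" where
  "E22 \<alpha> = orthogonal_comp (E11 \<alpha>)"

definition E2 :: "real \<Rightarrow> ((real ^ 'i::finite) \<times> (real ^ 'i)) set" where
  "E2 \<alpha> = {x + y | x y. x \<in> E_m1 \<alpha> \<and> y \<in> E22 \<alpha>}"

definition projE1 ::
  "real \<Rightarrow> (real ^ 'i::finite) \<times> (real ^ 'i) \<Rightarrow> (real ^ 'i) \<times> (real ^ 'i)" where
  "projE1 \<alpha> y = (THE x. x \<in> E1 \<and> y - x \<in> E2 \<alpha>)"

section \<open>Hypotheses on the coupling matrix and the nonlinearity\<close>

text \<open>
  \<open>lam 0, \<dots>, lam (n - 1)\<close> are the eigenvalues of the \<open>n \<times> n\<close> matrix \<open>A\<close>, listed with algebraic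
  multiplicity: the characteristic polynomial factors accordingly.
\<close>

definition eigenvalue_list :: "real ^ 'i ^ 'i::finite \<Rightarrow> (nat \<Rightarrow> real) \<Rightarrow> bool" where
  "eigenvalue_list A lam \<longleftrightarrow> (\<forall>x. det (mat x - A) = (\<Prod>k<CARD('i). x - lam k))"

definition smallest_period :: "(real \<Rightarrow> real) \<Rightarrow> real \<Rightarrow> bool" where
  "smallest_period g \<kappa> \<longleftrightarrow>
     \<kappa> > 0 \<and> (\<forall>x. g (x + \<kappa>) = g x) \<and>
     (\<forall>\<tau>. 0 < \<tau> \<and> (\<forall>x. g (x + \<tau>) = g x) \<longrightarrow> \<kappa> \<le> \<tau>)"

end

theory Submission
  imports Defs
begin

text \<open>
  Let \<open>e\<close> be the constant vector, \<open>w\<close> the driving noise \<open>(\<epsilon>\<^sub>j \<omega>\<^sub>j)\<^sub>j\<close> and \<open>z\<close> the stationary process.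
  The difference \<open>q = z - w\<close> is differentiable, with \<open>q' = - z\<close>, so that \<open>y = v + q\<close> turns the
  random system into the ordinary differential equation \<open>u' = y + w\<close>,
  \<open>y' = - K A u - \<alpha> (y + w) + f - \<beta> g(u)\<close>. Up to \<open>q\<close>, which grows sublinearly, the coordinate of the
  projection onto \<open>E\<^sub>1\<close> is \<open>\<Theta> = avg u + avg y / \<alpha>\<close>, whose derivative \<open>avg (f - \<beta> g(u)) / \<alpha>\<close> is
  bounded: both the linear part and the noise cancel. It has to be shown that \<open>\<Theta> t / t\<close> converges to
  a limit that depends neither on the initial value nor on the noise.

  The difference of two solutions with the same noise satisfies a linear system with a perturbation
  bounded by the Lipschitz constant of \<open>\<beta> g\<close>. The hypothesis \<open>a > 4 L\<^sub>F\<close> provides a quadratic form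
  \<open>V\<close> of the components transverse to \<open>(e, 0)\<close> such that \<open>V - c \<Theta>\<^sup>2\<close> decays exponentially along
  such differences, \<open>c\<close> being a positive constant (\<open>cone_contraction\<close>). Hence the sign of \<open>\<Theta>\<close> is
  preserved on the cone \<open>V < c \<Theta>\<^sup>2\<close>. Since solutions may be translated by multiples of \<open>\<kappa> e\<close>, the
  displacements of \<open>\<Theta>\<close> along two solutions with the same noise differ, at all times, by a bound that
  depends only on \<open>V\<close> of the initial difference (\<open>displacement_compare\<close>).

  Consequently the displacement from rest over the time \<open>n T\<close> is the sum of the displacements from
  rest over the \<open>n\<close> blocks of length \<open>T\<close>, up to an error of order \<open>n\<close> in quadratic mean, uniformly in
  \<open>T\<close> (\<open>defect_bound\<close>); here the transverse energy at the ends of the blocks is controlled by a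
  dissipation estimate. The block displacements are bounded by a multiple of \<open>T\<close>, uncorrelated and
  of equal mean \<open>\<mu> T\<close>, because they are limits of Euler schemes, that is, of functions of the
  Gaussian increments in their blocks. Therefore \<open>\<mu> T / T\<close> converges, and the displacement at time
  \<open>n T\<close>, divided by \<open>n T\<close>, differs from \<open>\<mu> T / T\<close> by at most a constant times \<open>1 / T + 1 / \<surd>n\<close> in
  quadratic mean. With \<open>T = j\<close> and \<open>n = j\<^sup>2\<close> the squares are summable, so that the convergence is
  almost sure along the times \<open>j\<^sup>3\<close>, and the Lipschitz continuity of \<open>\<Theta>\<close> fills the gaps
  (\<open>displacement_rate\<close>).
\<close>

section \<open>Ordinary differential equations with a globally Lipschitz right-hand side\<close>

text \<open>
  Solutions of \<open>x' = F t x\<close> on \<open>{0..}\<close>; the derivative at \<open>0\<close> is one-sided, and the values at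
  negative times are irrelevant.
\<close>

definition solves_ode :: "(real \<Rightarrow> 'a \<Rightarrow> 'a) \<Rightarrow> 'a \<Rightarrow> (real \<Rightarrow> 'a::real_normed_vector) \<Rightarrow> bool" where
  "solves_ode F x0 x \<longleftrightarrow>
     x 0 = x0 \<and> (\<forall>t\<ge>0. (x has_vector_derivative F t (x t)) (at t within {0..}))"

lemma has_vector_derivative_imp_continuous_on:
  assumes "\<And>t. t \<in> S \<Longrightarrow> (x has_vector_derivative x' t) (at t within S)"
  shows "continuous_on S x"
  unfolding continuous_on_eq_continuous_within
  using assms has_vector_derivative_continuous by blast

lemma solves_ode_continuous:
  assumes "solves_ode F x0 x"
  shows "continuous_on {0..} x"
  using assms unfolding solves_ode_def by (auto intro!: has_vector_derivative_imp_continuous_on)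

lemma nonincreasing_of_nonpos_deriv:
  fixes f :: "real \<Rightarrow> real"
  assumes d: "\<And>s. 0 \<le> s \<Longrightarrow> s \<le> t \<Longrightarrow> (f has_real_derivative f' s) (at s within {0..})"
    and le: "\<And>s. 0 \<le> s \<Longrightarrow> s \<le> t \<Longrightarrow> f' s \<le> 0" and t: "0 \<le> t"
  shows "f t \<le> f 0"
proof (cases "t = 0")
  case False
  have c: "continuous_on {0..t} f"
  proof (rule has_vector_derivative_imp_continuous_on)
    fix s assume "s \<in> {0..t}"
    then show "(f has_vector_derivative f' s) (at s within {0..t})"
      using d[of s] by (auto simp: has_real_derivative_iff_has_vector_derivative
          intro: has_vector_derivative_within_subset)
  qed
  have "(f has_real_derivative f' s) (at s)" if "0 < s" "s \<le> t" for s
    using d[of s] that at_within_interior[of s "{0..}"] by (auto simp: interior_Ici[of "-1"])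
  then show ?thesis
    by (smt (verit, best) DERIV_nonpos_imp_decreasing_open c le t)
qed simp

lemma exp_weight_nonincreasing:
  fixes f :: "real \<Rightarrow> real"
  assumes d: "\<And>s. 0 \<le> s \<Longrightarrow> s \<le> t \<Longrightarrow> (f has_real_derivative f' s) (at s within {0..})"
    and le: "\<And>s. 0 \<le> s \<Longrightarrow> s \<le> t \<Longrightarrow> f' s \<le> - \<mu> * f s" and t: "0 \<le> t"
  shows "f t \<le> f 0 * exp (- \<mu> * t)"
proof -
  have "f t * exp (\<mu> * t) \<le> f 0 * exp (\<mu> * 0)"
  proof (rule nonincreasing_of_nonpos_deriv[OF _ _ t, where f' = "\<lambda>s. f' s * exp (\<mu> * s) + f s * (\<mu> * exp (\<mu> * s))"])
    fix s :: real assume s: "0 \<le> s" "s \<le> t"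
    show "((\<lambda>s. f s * exp (\<mu> * s)) has_real_derivative f' s * exp (\<mu> * s) + f s * (\<mu> * exp (\<mu> * s))) (at s within {0..})"
      by (auto intro!: derivative_eq_intros d s)
    have "f' s * exp (\<mu> * s) + f s * (\<mu> * exp (\<mu> * s)) = (f' s + \<mu> * f s) * exp (\<mu> * s)"
      by (simp add: algebra_simps)
    then show "f' s * exp (\<mu> * s) + f s * (\<mu> * exp (\<mu> * s)) \<le> 0"
      using le[OF s] by (auto simp: mult_nonpos_nonneg)
  qed
  then show ?thesis
    by (simp add: exp_minus field_simps)
qed

lemma has_real_derivative_norm_sq:
  fixes x :: "real \<Rightarrow> 'a::real_inner"
  assumes "(x has_vector_derivative x') (at t within S)"
  shows "((\<lambda>t. (norm (x t))\<^sup>2) has_real_derivative 2 * (x t \<bullet> x')) (at t within S)"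
  using has_derivative_inner[OF assms[unfolded has_vector_derivative_def] assms[unfolded has_vector_derivative_def]]
  unfolding power2_norm_eq_inner has_field_derivative_def
  by (rule has_derivative_eq_rhs) (auto simp: fun_eq_iff inner_commute)

lemma solves_ode_unique:
  fixes x y :: "real \<Rightarrow> 'a::real_inner"
  assumes x: "solves_ode F x0 x" and y: "solves_ode F x0 y"
    and lip: "\<And>t a b. norm (F t a - F t b) \<le> L * norm (a - b)" and t: "0 \<le> t"
  shows "x t = y t"
proof -
  have "(norm (x t - y t))\<^sup>2 \<le> (norm (x 0 - y 0))\<^sup>2 * exp (- (- 2 * L) * t)"
  proof (rule exp_weight_nonincreasing[OF _ _ t])
    fix s :: real assume s: "0 \<le> s"
    show "((\<lambda>t. (norm (x t - y t))\<^sup>2) has_real_derivative 2 * ((x s - y s) \<bullet> (F s (x s) - F s (y s)))) (at s within {0..})"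
      by (intro has_real_derivative_norm_sq has_vector_derivative_diff)
         (use x y s in \<open>auto simp: solves_ode_def\<close>)
    have "(x s - y s) \<bullet> (F s (x s) - F s (y s)) \<le> norm (x s - y s) * norm (F s (x s) - F s (y s))"
      by (rule norm_cauchy_schwarz)
    also have "\<dots> \<le> norm (x s - y s) * (L * norm (x s - y s))"
      by (intro mult_left_mono lip) auto
    finally show "2 * ((x s - y s) \<bullet> (F s (x s) - F s (y s))) \<le> - (- 2 * L) * (norm (x s - y s))\<^sup>2"
      by (simp add: power2_eq_square algebra_simps)
  qed
  then show ?thesis
    using x y by (auto simp: solves_ode_def)
qed

lemma antiderivative_from_0:
  fixes c :: "real \<Rightarrow> 'a::banach"
  assumes c: "continuous_on UNIV c" and t: "0 \<le> t"
  shows "((\<lambda>t. integral {0..t} c) has_vector_derivative c t) (at t within {0..})"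
proof -
  have "((\<lambda>t. integral {0..t} c) has_vector_derivative c t) (at t within {0..t + 1})"
    using t by (intro integral_has_vector_derivative continuous_on_subset[OF c]) auto
  moreover have "at t within {0..t + 1} = at t within {0..}"
    using t by (intro at_within_nhd[of t "{..<t + 1}"]) auto
  ultimately show ?thesis by simp
qed

text \<open>
  Picard iteration is a contraction in the norm weighted by \<open>exp (- \<lambda> t) / m t\<close> with
  \<open>m t = 1 + \<integral>\<^sub>0\<^sup>t |F s 0| ds\<close>; the factor \<open>m\<close> makes the image of a bounded function bounded
  without any growth condition on \<open>F\<close>.
\<close>

lemma solves_ode_exists:
  fixes F :: "real \<Rightarrow> 'a::{banach, real_inner} \<Rightarrow> 'a"
  assumes lip: "\<And>t a b. norm (F t a - F t b) \<le> L * norm (a - b)" and L: "0 < L"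
    and cont: "\<And>\<phi>. continuous_on UNIV \<phi> \<Longrightarrow> continuous_on UNIV (\<lambda>t. F t (\<phi> t))"
  shows "\<exists>x. solves_ode F x0 x"
proof -
  define l where "l = 2 * L"
  have l: "l > 0" using L by (simp add: l_def)
  define c where "c = (\<lambda>t. norm (F t 0))"
  have cc: "continuous_on S c" for S
    unfolding c_def using cont[of "\<lambda>_. 0"] by (auto intro!: continuous_on_norm intro: continuous_on_subset)
  have ci: "c integrable_on {a..b}" for a b
    by (intro integrable_continuous_interval cc)
  define m where "m = (\<lambda>t. 1 + integral {0..t} c)"
  have c0: "c t \<ge> 0" for t by (simp add: c_def)
  have m1: "m t \<ge> 1" for t
    unfolding m_def using integral_nonneg[OF ci, of 0 t] c0 by auto
  have m0: "m t \<ge> 0" for t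
    using m1[of t] by simp
  have m_mono: "m s \<le> m t" if "s \<le> t" for s t
    unfolding m_def using that by (auto intro!: integral_subset_le ci simp: c0)
  have mc: "continuous_on {0..} m"
    unfolding m_def
    by (intro continuous_intros has_vector_derivative_imp_continuous_on[of _ _ c] antiderivative_from_0 cc) auto
  \<comment> \<open>Bounded continuous functions live on the whole line; negative times are folded onto \<open>0\<close>.\<close>
  define p where "p = (\<lambda>t::real. max 0 t)"
  have pc: "continuous_on UNIV p" unfolding p_def by (intro continuous_intros)
  have p0: "p t \<ge> 0" for t by (simp add: p_def)
  define w where "w = (\<lambda>t. exp (l * p t) * m (p t))"
  have w_pos: "w t > 0" for t
    unfolding w_def using m1[of "p t"] by simp
  have mpc: "continuous_on UNIV (\<lambda>t. m (p t))"
    by (rule continuous_on_compose2[OF mc pc]) (auto simp: p0)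
  have wc: "continuous_on UNIV w"
    unfolding w_def by (intro continuous_intros mpc pc)
  define h where "h = (\<lambda>(\<phi> :: real \<Rightarrow>\<^sub>C 'a) s. F s (w s *\<^sub>R \<phi> s))"
  have hc: "continuous_on S (h \<phi>)" for \<phi> S
    unfolding h_def
    by (rule continuous_on_subset[of UNIV]) (auto intro!: cont continuous_intros wc)
  have hi: "h \<phi> integrable_on {a..b}" for \<phi> a b
    by (intro integrable_continuous_interval hc)
  define G where "G = (\<lambda>(\<phi> :: real \<Rightarrow>\<^sub>C 'a) t. (x0 + integral {0..p t} (h \<phi>)) /\<^sub>R w t)"
  have wi: "(\<lambda>s. L * (exp (l * s) * m t * K)) integrable_on {0..t}" for t K
    by (intro integrable_continuous_interval continuous_intros)
  have exp_int: "integral {0..t} (\<lambda>s. L * (exp (l * s) * m t * K)) \<le> exp (l * t) * m t * K / 2"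
    if t: "t \<ge> 0" and K: "K \<ge> 0" for t K
  proof -
    have "((\<lambda>s. L * (exp (l * s) * m t * K)) has_integral exp (l * t) * m t * K / 2 - exp (l * 0) * m t * K / 2) {0..t}"
      using t by (intro fundamental_theorem_of_calculus)
        (auto intro!: derivative_eq_intros simp: has_real_derivative_iff_has_vector_derivative[symmetric] l_def)
    then have "integral {0..t} (\<lambda>s. L * (exp (l * s) * m t * K)) = exp (l * t) * m t * K / 2 - m t * K / 2"
      by (subst integral_unique) (simp_all only: mult_zero_right exp_zero mult_1)
    then show ?thesis using mult_nonneg_nonneg[OF m0[of t] K] by simp
  qed
  have w_le: "w s \<le> exp (l * s) * m t" if "s \<in> {0..t}" for s t
    using that m_mono[of s t] by (auto simp: w_def p_def max_def)
  have h_bound: "norm (integral {0..t} (h \<phi>)) \<le> m t + exp (l * t) * m t * norm \<phi> / 2" if t: "t \<ge> 0" for \<phi> t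
  proof -
    have "norm (integral {0..t} (h \<phi>)) \<le> integral {0..t} (\<lambda>s. c s + L * (exp (l * s) * m t * norm \<phi>))"
    proof (rule integral_norm_bound_integral[OF hi])
      fix s assume s: "s \<in> {0..t}"
      have "norm (h \<phi> s) \<le> norm (F s 0) + norm (F s (w s *\<^sub>R \<phi> s) - F s 0)"
        unfolding h_def using norm_triangle_sub by blast
      also have "\<dots> \<le> norm (F s 0) + L * (w s * norm (\<phi> s))"
        using lip[of s "w s *\<^sub>R \<phi> s" 0] w_pos[of s] by simp
      also have "\<dots> \<le> norm (F s 0) + L * (exp (l * s) * m t * norm \<phi>)"
        using L w_le[OF s] norm_bounded[of \<phi> s] w_pos[of s] m0[of t]
        by (intro add_left_mono mult_left_mono mult_mono) (auto simp: less_imp_le)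
      finally show "norm (h \<phi> s) \<le> c s + L * (exp (l * s) * m t * norm \<phi>)"
        by (simp add: c_def)
    qed (auto intro!: integrable_add ci wi)
    also have "\<dots> = integral {0..t} c + integral {0..t} (\<lambda>s. L * (exp (l * s) * m t * norm \<phi>))"
      by (intro integral_add ci wi)
    also have "\<dots> \<le> m t + exp (l * t) * m t * norm \<phi> / 2"
      using exp_int[OF t, of "norm \<phi>"] by (auto simp: m_def)
    finally show ?thesis .
  qed
  have G_in: "G \<phi> \<in> bcontfun" for \<phi>
  proof (rule bcontfun_normI)
    have "continuous_on {0..} (\<lambda>t. integral {0..t} (h \<phi>))"
      by (intro has_vector_derivative_imp_continuous_on[of _ _ "h \<phi>"] antiderivative_from_0 hc) auto
    then have "continuous_on UNIV (\<lambda>t. integral {0..p t} (h \<phi>))"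
      by (rule continuous_on_compose2[OF _ pc]) (auto simp: p0)
    then show "continuous_on UNIV (G \<phi>)"
      unfolding G_def by (intro continuous_intros wc) (use w_pos in \<open>auto simp: less_imp_neq[symmetric] intro: less_imp_neq\<close>)
    fix t
    have e1: "exp (l * p t) \<ge> 1" using l p0[of t] by simp
    have wm: "m (p t) \<le> w t" "1 \<le> w t"
      unfolding w_def using e1 m1[of "p t"] mult_mono[of 1 "exp (l * p t)" 1 "m (p t)"]
        mult_right_mono[of 1 "exp (l * p t)" "m (p t)"] by auto
    have "norm (G \<phi> t) = norm (x0 + integral {0..p t} (h \<phi>)) / w t"
      using w_pos[of t] by (simp add: G_def divide_inverse mult.commute)
    also have "\<dots> \<le> (norm x0 + (m (p t) + exp (l * p t) * m (p t) * norm \<phi> / 2)) / w t"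
      using h_bound[OF p0, of t \<phi>] w_pos[of t]
      by (intro divide_right_mono order_trans[OF norm_triangle_ineq] add_left_mono) auto
    also have "\<dots> \<le> (norm x0 * w t + (w t + w t * norm \<phi> / 2)) / w t"
      using w_pos[of t] wm mult_left_mono[OF wm(2), of "norm x0"]
      by (intro divide_right_mono add_mono) (auto simp: w_def)
    also have "\<dots> = norm x0 + 1 + norm \<phi> / 2"
      using w_pos[of t] by (simp add: field_simps)
    finally show "norm (G \<phi> t) \<le> norm x0 + 1 + norm \<phi> / 2" .
  qed
  have app: "apply_bcontfun (Bcontfun (G \<phi>)) = G \<phi>" for \<phi>
    using G_in by (rule Bcontfun_inverse)
  have "dist (Bcontfun (G \<phi>)) (Bcontfun (G \<psi>)) \<le> 1/2 * dist \<phi> \<psi>" for \<phi> \<psi>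
  proof (rule dist_bound)
    fix t
    have "norm (integral {0..p t} (h \<phi>) - integral {0..p t} (h \<psi>)) = norm (integral {0..p t} (\<lambda>s. h \<phi> s - h \<psi> s))"
      by (simp add: integral_diff hi)
    also have "\<dots> \<le> integral {0..p t} (\<lambda>s. L * (exp (l * s) * m (p t) * dist \<phi> \<psi>))"
    proof (rule integral_norm_bound_integral)
      fix s assume s: "s \<in> {0..p t}"
      have "norm (h \<phi> s - h \<psi> s) \<le> L * (w s * dist (\<phi> s) (\<psi> s))"
        using lip[of s "w s *\<^sub>R \<phi> s" "w s *\<^sub>R \<psi> s"] w_pos[of s]
        by (simp add: h_def dist_norm scaleR_diff_right[symmetric])
      also have "\<dots> \<le> L * (exp (l * s) * m (p t) * dist \<phi> \<psi>)"
        using L w_le[OF s] dist_bounded[of \<phi> s \<psi>] w_pos[of s] m0[of "p t"]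
        by (intro mult_left_mono mult_mono) (auto simp: less_imp_le)
      finally show "norm (h \<phi> s - h \<psi> s) \<le> L * (exp (l * s) * m (p t) * dist \<phi> \<psi>)" .
    qed (auto intro!: integrable_diff hi wi)
    also have "\<dots> \<le> w t * dist \<phi> \<psi> / 2"
      using exp_int[OF p0, of "dist \<phi> \<psi>" t] by (simp add: w_def)
    finally have "norm (integral {0..p t} (h \<phi>) - integral {0..p t} (h \<psi>)) / w t \<le> dist \<phi> \<psi> / 2"
      using w_pos[of t] by (simp add: field_simps)
    moreover have nw: "norm (v /\<^sub>R w t) = norm v / w t" for v :: 'a
      using w_pos[of t] by (simp add: divide_inverse mult.commute)
    have eq: "G \<phi> t - G \<psi> t = (integral {0..p t} (h \<phi>) - integral {0..p t} (h \<psi>)) /\<^sub>R w t"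
      by (simp add: G_def scaleR_diff_right[symmetric])
    ultimately show "dist (Bcontfun (G \<phi>) t) (Bcontfun (G \<psi>) t) \<le> 1/2 * dist \<phi> \<psi>"
      unfolding app dist_norm[of "G \<phi> t"] eq nw by linarith
  qed
  then obtain \<phi> where \<phi>: "Bcontfun (G \<phi>) = \<phi>"
    using banach_fix_type[of "1/2" "\<lambda>\<phi>. Bcontfun (G \<phi>)"] by auto
  define x where "x = (\<lambda>t. x0 + integral {0..t} (h \<phi>))"
  have x_eq: "w t *\<^sub>R \<phi> t = x t" if "t \<ge> 0" for t
  proof -
    have "\<phi> t = G \<phi> t" using app[of \<phi>] \<phi> by metis
    then show ?thesis using that w_pos[of t] by (simp add: G_def x_def p_def)
  qed
  have "(x has_vector_derivative F t (x t)) (at t within {0..})" if "t \<ge> 0" for t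
  proof -
    have "(x has_vector_derivative h \<phi> t) (at t within {0..})"
      unfolding x_def using antiderivative_from_0[OF hc that]
      by (auto intro!: derivative_eq_intros simp: has_vector_derivative_add)
    then show ?thesis using x_eq[OF that] by (simp add: h_def)
  qed
  then have "solves_ode F x0 x" by (simp add: solves_ode_def x_def)
  then show ?thesis by blast
qed

section \<open>The Euler scheme\<close>

text \<open>
  \<open>euler F h x0 i\<close> approximates the solution at the grid point \<open>i h\<close>.
\<close>

fun euler :: "(real \<Rightarrow> 'a \<Rightarrow> 'a) \<Rightarrow> real \<Rightarrow> 'a \<Rightarrow> nat \<Rightarrow> 'a::real_vector" where
  "euler F h x0 0 = x0"
| "euler F h x0 (Suc i) = euler F h x0 i + h *\<^sub>R F (real i * h) (euler F h x0 i)"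

lemma euler_converges:
  fixes F :: "real \<Rightarrow> 'a::real_inner \<Rightarrow> 'a"
  assumes x: "solves_ode F x0 x"
    and lip: "\<And>t a b. norm (F t a - F t b) \<le> L * norm (a - b)" and L: "0 \<le> L"
    and cont: "continuous_on {0..T} (\<lambda>t. F t (x t))" and T: "0 < T"
  shows "(\<lambda>m. euler F (T / real m) x0 m) \<longlonglongrightarrow> x T"
proof (rule LIMSEQ_I)
  fix e :: real assume e: "0 < e"
  define C where "C = T * exp (L * T)"
  have C: "C > 0" using T by (simp add: C_def)
  define \<eta> where "\<eta> = e / (2 * C)"
  have \<eta>: "\<eta> > 0" using e C by (simp add: \<eta>_def)
  have "uniformly_continuous_on {0..T} (\<lambda>t. F t (x t))"
    using cont by (intro compact_uniformly_continuous) auto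
  then obtain d where d: "d > 0"
    "\<And>s t. s \<in> {0..T} \<Longrightarrow> t \<in> {0..T} \<Longrightarrow> dist t s < d \<Longrightarrow> dist (F t (x t)) (F s (x s)) < \<eta>"
    using \<eta> unfolding uniformly_continuous_on_def by metis
  obtain m0 :: nat where m0: "real m0 > T / d" using reals_Archimedean2 by blast
  show "\<exists>no. \<forall>n\<ge>no. norm (euler F (T / real n) x0 n - x T) < e"
  proof (intro exI allI impI)
    fix m assume "m \<ge> Suc m0"
    then have m: "real m > T / d" "m > 0" using m0 by auto
    define h where "h = T / real m"
    have h: "0 < h" "h < d" "real m * h = T"
      using m d(1) T by (auto simp: h_def field_simps)
    define t where "t = (\<lambda>i. real i * h)"
    have ti: "t i \<in> {0..T}" if "i \<le> m" for i
      using that h by (auto simp: t_def h(3)[symmetric])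
    have step: "norm (x (t (Suc i)) - x (t i) - h *\<^sub>R F (t i) (x (t i))) \<le> h * \<eta>" if i: "i < m" for i
    proof -
      have ts: "t (Suc i) = t i + h" by (simp add: t_def algebra_simps)
      have sub: "{t i..t (Suc i)} \<subseteq> {0..T}"
        using ti[of i] ti[of "Suc i"] i by auto
      define y where "y = (\<lambda>s. x s - s *\<^sub>R F (t i) (x (t i)))"
      have "norm (y (t (Suc i)) - y (t i)) \<le> \<eta> * norm (t (Suc i) - t i)"
      proof (rule differentiable_bound[where S = "{t i..t (Suc i)}" and f' = "\<lambda>s r. r *\<^sub>R (F s (x s) - F (t i) (x (t i)))"])
        fix s assume s: "s \<in> {t i..t (Suc i)}"
        have "(x has_vector_derivative F s (x s)) (at s within {t i..t (Suc i)})"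
        proof (rule has_vector_derivative_within_subset)
          have "0 \<le> s" using s sub by auto
          then show "(x has_vector_derivative F s (x s)) (at s within {0..})"
            using x by (simp add: solves_ode_def)
          show "{t i..t (Suc i)} \<subseteq> {0..}" using sub by auto
        qed
        then have "(y has_vector_derivative F s (x s) - 1 *\<^sub>R F (t i) (x (t i))) (at s within {t i..t (Suc i)})"
          unfolding y_def
          by (intro has_vector_derivative_diff has_vector_derivative_scaleR[where g = "\<lambda>_. F (t i) (x (t i))" and g' = 0, simplified])
            (auto intro!: derivative_eq_intros)
        then show "(y has_derivative (\<lambda>r. r *\<^sub>R (F s (x s) - F (t i) (x (t i))))) (at s within {t i..t (Suc i)})"
          by (simp add: has_vector_derivative_def)
        have "dist (F s (x s)) (F (t i) (x (t i))) < \<eta>"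
          
        proof (rule d(2))
          show "s \<in> {0..T}" "t i \<in> {0..T}" using s sub ti[of i] i by auto
          show "dist s (t i) < d" using s h(2) ts by (simp add: dist_real_def)
        qed
        then have "norm (F s (x s) - F (t i) (x (t i))) \<le> \<eta>" by (simp add: dist_norm)
        then show "onorm (\<lambda>r. r *\<^sub>R (F s (x s) - F (t i) (x (t i)))) \<le> \<eta>"
          using \<eta> by (intro onorm_bound) (auto simp: mult.commute[of \<eta>] intro: mult_left_mono)
      qed (use h in \<open>auto simp: ts\<close>)
      then show ?thesis using h by (simp add: y_def ts algebra_simps)
    qed
    have err: "norm (euler F h x0 i - x (t i)) \<le> real i * h * \<eta> * (1 + L * h) ^ i" if "i \<le> m" for i
      using that
    proof (induction i)
      case 0
      then show ?case using x by (simp add: t_def solves_ode_def)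
    next
      case (Suc i)
      have tri: "norm (a + b - c) \<le> A + B + C" if "norm a \<le> A" "norm b \<le> B" "norm c \<le> C" for a b c :: 'a and A B C
        using that norm_triangle_ineq4[of "a + b" c] norm_triangle_ineq[of a b] by linarith
      define E where "E = norm (euler F h x0 i - x (t i))"
      have "euler F h x0 (Suc i) - x (t (Suc i)) =
        (euler F h x0 i - x (t i)) + h *\<^sub>R (F (t i) (euler F h x0 i) - F (t i) (x (t i)))
          - (x (t (Suc i)) - x (t i) - h *\<^sub>R F (t i) (x (t i)))"
        by (simp add: t_def algebra_simps)
      also have "norm \<dots> \<le> E + h * (L * E) + h * \<eta>"
        unfolding E_def
        using h lip[of "t i" "euler F h x0 i" "x (t i)"] step[of i] Suc.prems
        by (intro tri) simp_all
      also have "\<dots> = (1 + L * h) * E + h * \<eta>" by (simp add: algebra_simps)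
      also have "\<dots> \<le> (1 + L * h) * (real i * h * \<eta> * (1 + L * h) ^ i) + h * \<eta> * (1 + L * h) ^ Suc i"
        using Suc L h \<eta> mult_left_mono[OF one_le_power[of "1 + L * h" "Suc i"], of "h * \<eta>"] unfolding E_def
        by (intro add_mono mult_left_mono) auto
      also have "\<dots> = real (Suc i) * h * \<eta> * (1 + L * h) ^ Suc i"
        by (simp add: algebra_simps)
      finally show ?case .
    qed
    have "(1 + L * h) ^ m \<le> exp (L * h) ^ m"
      using L h exp_ge_add_one_self[of "L * h"] by (intro power_mono) auto
    also have "\<dots> = exp (L * T)"
      by (simp add: exp_of_nat_mult[symmetric] h(3)[symmetric] algebra_simps)
    finally have "(real m * h) * \<eta> * (1 + L * h) ^ m \<le> T * \<eta> * exp (L * T)"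
      unfolding h(3) using T \<eta> by (intro mult_left_mono) auto
    also have "\<dots> = e / 2" using T by (simp add: \<eta>_def C_def field_simps)
    finally show "norm (euler F (T / real m) x0 m - x T) < e"
      using err[of m] e by (simp add: t_def h(3) h_def[symmetric])
  qed
qed

section \<open>The damped second-order system\<close>

text \<open>
  The system \<open>u' = y + w\<close>, \<open>y' = - L u - \<alpha> (y + w) + N u\<close>, where \<open>L\<close> is symmetric with kernel
  direction \<open>e\<close> and spectral gap \<open>\<Lambda>\<close> on its complement, and \<open>N\<close> is bounded, Lipschitz and invariant
  under translation by \<open>\<kappa> e\<close>.
\<close>

locale damped_system =
  fixes L N :: "'a::euclidean_space \<Rightarrow> 'a" and e :: 'a and \<alpha> \<Lambda> M c \<kappa> :: real
  assumes lin: "linear L" and sym: "\<And>x y. x \<bullet> L y = L x \<bullet> y"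
    and e: "L e = 0" "e \<noteq> 0"
    and gap: "\<And>x. x \<bullet> e = 0 \<Longrightarrow> \<Lambda> * (norm x)\<^sup>2 \<le> x \<bullet> L x"
    and \<alpha>: "0 < \<alpha>" and \<Lambda>: "0 < \<Lambda>" "\<Lambda> \<le> \<alpha>\<^sup>2" and M: "0 \<le> M" "8 * M \<le> \<Lambda>"
    and N_lip: "\<And>x y. norm (N x - N y) \<le> M * norm (x - y)"
    and N_bound: "\<And>x. norm (N x) \<le> c"
    and N_period: "\<And>x. N (x + \<kappa> *\<^sub>R e) = N x" and \<kappa>: "0 < \<kappa>"
begin

text \<open>
  \<open>avg u\<close> is the coefficient of \<open>e\<close> in the orthogonal decomposition of \<open>u\<close>, and \<open>Q u\<close> is the
  remaining component.
\<close>

definition avg :: "'a \<Rightarrow> real" where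
  "avg u = (u \<bullet> e) / (e \<bullet> e)"

definition Q :: "'a \<Rightarrow> 'a" where
  "Q u = u - avg u *\<^sub>R e"

text \<open>
  With \<open>h = y + s Q u\<close> the unperturbed system reads \<open>Q u' = Q h - s Q u\<close>,
  \<open>h' = - B u - \<alpha> h + s Q h\<close>, and the coupling terms cancel in the derivative of
  \<open>V = u \<bullet> B u + |h|\<^sup>2\<close>. The choice of \<open>s\<close> leaves \<open>B \<ge> \<Lambda> / 2\<close> on the complement of \<open>e\<close>, so that
  \<open>V\<close> controls \<open>Q u\<close> and \<open>y\<close> but not \<open>avg u\<close>.
\<close>

definition s :: real where
  "s = \<Lambda> / (2 * \<alpha>)"

definition B :: "'a \<Rightarrow> 'a" where
  "B u = L u - (s * (\<alpha> - s)) *\<^sub>R Q u"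

definition V :: "'a \<times> 'a \<Rightarrow> real" where
  "V = (\<lambda>(u, y). u \<bullet> B u + (norm (y + s *\<^sub>R Q u))\<^sup>2)"

text \<open>
  The coordinate along \<open>(e, 0)\<close> of the projection whose kernel contains \<open>(e, - \<alpha> e)\<close>.
\<close>

definition \<Theta> :: "'a \<times> 'a \<Rightarrow> real" where
  "\<Theta> = (\<lambda>(u, y). avg u + avg y / \<alpha>)"

lemma ee: "e \<bullet> e > 0"
  using e by simp

lemma L_simps: "L (x + y) = L x + L y" "L (x - y) = L x - L y" "L (r *\<^sub>R x) = r *\<^sub>R L x" "L 0 = 0" "L (- x) = - L x"
  by (rule linear_add[OF lin] linear_diff[OF lin] linear_scale[OF lin] linear_0[OF lin] linear_neg[OF lin])+

lemma avg_simps: "avg (x + y) = avg x + avg y" "avg (x - y) = avg x - avg y" "avg (r *\<^sub>R x) = r * avg x"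
  "avg 0 = 0" "avg (- x) = - avg x" "avg e = 1"
  using ee by (auto simp: avg_def inner_simps add_divide_distrib diff_divide_distrib)

lemma Q_simps: "Q (x + y) = Q x + Q y" "Q (x - y) = Q x - Q y" "Q (r *\<^sub>R x) = r *\<^sub>R Q x" "Q 0 = 0" "Q (- x) = - Q x" "Q e = 0"
  by (auto simp: Q_def avg_simps algebra_simps)

lemma avg_L: "avg (L x) = 0"
  using sym[of x e] e by (simp add: avg_def)

lemma Q_e: "Q x \<bullet> e = 0"
  using ee by (simp add: Q_def avg_def inner_simps)

lemma Q_inner: "Q x \<bullet> Q y = x \<bullet> Q y" "Q x \<bullet> Q y = Q x \<bullet> y"
proof -
  have "(avg x *\<^sub>R e) \<bullet> Q y = 0" "Q x \<bullet> (avg y *\<^sub>R e) = 0"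
    using Q_e by (auto simp: inner_commute)
  then show "Q x \<bullet> Q y = x \<bullet> Q y" "Q x \<bullet> Q y = Q x \<bullet> y"
    by (auto simp: Q_def[of x] Q_def[of y] inner_diff_left inner_diff_right)
qed

lemma norm_decomp: "(norm x)\<^sup>2 = (norm (Q x))\<^sup>2 + (norm e * avg x)\<^sup>2"
proof -
  have "x = Q x + avg x *\<^sub>R e" by (simp add: Q_def)
  then have "(norm x)\<^sup>2 = (norm (Q x + avg x *\<^sub>R e))\<^sup>2" by simp
  also have "\<dots> = (norm (Q x))\<^sup>2 + (norm (avg x *\<^sub>R e))\<^sup>2"
    using Q_e by (intro norm_add_Pythagorean) (simp add: orthogonal_def)
  finally show ?thesis by (simp add: power_mult_distrib mult.commute)
qed

lemma Q_norm_le: "norm (Q x) \<le> norm x"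
  by (rule power2_le_imp_le) (use norm_decomp[of x] in auto)

lemma avg_norm_le: "norm e * \<bar>avg x\<bar> \<le> norm x"
  by (rule power2_le_imp_le) (use norm_decomp[of x] in \<open>auto simp: power_mult_distrib\<close>)

lemma L_Q: "L (Q x) = L x"
  by (simp add: Q_def L_simps e)

lemma s_pos: "0 < s" "2 * s \<le> \<alpha>"
  using \<Lambda> \<alpha> by (simp_all add: s_def pos_divide_le_eq power2_eq_square)

lemma B_simps: "B (x + y) = B x + B y" "B (x - y) = B x - B y" "B (r *\<^sub>R x) = r *\<^sub>R B x"
  by (auto simp: B_def L_simps Q_simps algebra_simps)

lemma B_sym: "x \<bullet> B y = B x \<bullet> y"
proof -
  have "x \<bullet> Q y = Q x \<bullet> y" using Q_inner[of x y] by metis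
  then show ?thesis by (simp add: B_def inner_simps sym)
qed

lemma B_Q: "B x \<bullet> Q y = B x \<bullet> y"
proof -
  have "B x \<bullet> e = 0" using sym[of x e] e Q_e by (simp add: B_def inner_simps)
  then show ?thesis by (simp add: Q_def inner_simps)
qed

lemma B_lower: "\<Lambda> / 2 * (norm (Q u))\<^sup>2 \<le> u \<bullet> B u"
proof -
  have "u \<bullet> L u = Q u \<bullet> L (Q u)"
    by (metis L_Q sym)
  then have "\<Lambda> * (norm (Q u))\<^sup>2 \<le> u \<bullet> L u" using gap[OF Q_e] by simp
  moreover have "s * (\<alpha> - s) \<le> \<Lambda> / 2"
    using \<alpha> zero_le_power2[of s] by (simp add: s_def algebra_simps power2_eq_square)
  then have "s * (\<alpha> - s) * (norm (Q u))\<^sup>2 \<le> \<Lambda> / 2 * (norm (Q u))\<^sup>2"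
    by (intro mult_right_mono) auto
  moreover have "u \<bullet> B u = u \<bullet> L u - s * (\<alpha> - s) * (norm (Q u))\<^sup>2"
    using Q_inner[of u u] by (simp add: B_def inner_simps power2_norm_eq_inner)
  ultimately show ?thesis by simp
qed

lemma B_nonneg: "0 \<le> u \<bullet> B u"
  by (rule order_trans[OF _ B_lower]) (use \<Lambda> in simp)

lemma V_nonneg: "0 \<le> V x"
  using B_nonneg by (auto simp: V_def split: prod.split)

lemma bounded_linear_B: "bounded_linear B"
  by (intro linear_conv_bounded_linear[THEN iffD1] linearI) (auto simp: B_simps)

lemma bounded_linear_Q: "bounded_linear Q"
  by (intro linear_conv_bounded_linear[THEN iffD1] linearI) (auto simp: Q_simps)

lemma bounded_linear_avg: "bounded_linear avg"
  by (intro linear_conv_bounded_linear[THEN iffD1] linearI) (auto simp: avg_simps)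

lemma V_deriv:
  assumes u: "(u has_vector_derivative y t + \<phi>) (at t within S)"
    and y: "(y has_vector_derivative - L (u t) - \<alpha> *\<^sub>R y t + \<psi>) (at t within S)"
  shows "\<exists>D. ((\<lambda>t. V (u t, y t)) has_real_derivative D) (at t within S) \<and>
     D \<le> - 2 * s * (u t \<bullet> B (u t)) - 2 * (\<alpha> - s) * (norm (y t + s *\<^sub>R Q (u t)))\<^sup>2
         + 2 * (B (u t) \<bullet> \<phi>) + 2 * ((y t + s *\<^sub>R Q (u t)) \<bullet> (\<psi> + s *\<^sub>R Q \<phi>))"
proof -
  define h where "h = y t + s *\<^sub>R Q (u t)"
  define h' where "h' = - L (u t) - \<alpha> *\<^sub>R y t + \<psi> + s *\<^sub>R Q (y t + \<phi>)"
  have Bu: "((\<lambda>t. B (u t)) has_vector_derivative B (y t + \<phi>)) (at t within S)"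
    by (rule bounded_linear.has_vector_derivative[OF bounded_linear_B u])
  have d1: "((\<lambda>t. u t \<bullet> B (u t)) has_real_derivative 2 * (B (u t) \<bullet> (y t + \<phi>))) (at t within S)"
    using has_derivative_inner[OF u[unfolded has_vector_derivative_def] Bu[unfolded has_vector_derivative_def]]
    unfolding has_field_derivative_def
    by (rule has_derivative_eq_rhs) (use B_sym[of "u t" "y t + \<phi>"] in \<open>simp add: fun_eq_iff inner_commute[of "y t + \<phi>"]\<close>)
  have "((\<lambda>t. y t + s *\<^sub>R Q (u t)) has_vector_derivative h') (at t within S)"
    unfolding h'_def
    by (intro has_vector_derivative_add y
        bounded_linear.has_vector_derivative[OF bounded_linear_scaleR_right]
        bounded_linear.has_vector_derivative[OF bounded_linear_Q] u)
  from has_real_derivative_norm_sq[OF this]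
  have d2: "((\<lambda>t. (norm (y t + s *\<^sub>R Q (u t)))\<^sup>2) has_real_derivative 2 * (h \<bullet> h')) (at t within S)"
    by (simp add: h_def)
  have yt: "y t = h - s *\<^sub>R Q (u t)" by (simp add: h_def)
  have QQ: "Q (Q x) = Q x" for x using Q_e by (simp add: Q_def[of "Q x"] avg_def)
  have "h' = - B (u t) - \<alpha> *\<^sub>R h + s *\<^sub>R Q h + (\<psi> + s *\<^sub>R Q \<phi>)"
    unfolding h'_def yt by (simp add: B_def Q_simps QQ algebra_simps)
  then have "h \<bullet> h' = - (B (u t) \<bullet> h) - \<alpha> * (norm h)\<^sup>2 + s * (norm (Q h))\<^sup>2 + h \<bullet> (\<psi> + s *\<^sub>R Q \<phi>)"
    using Q_inner(1)[of h h] by (simp add: inner_simps power2_norm_eq_inner inner_commute)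
  moreover have "B (u t) \<bullet> (y t + \<phi>) = B (u t) \<bullet> h - s * (u t \<bullet> B (u t)) + B (u t) \<bullet> \<phi>"
    unfolding yt using B_Q[of "u t" "u t"] by (simp add: inner_simps inner_commute[of "u t"])
  moreover have "s * (norm (Q h))\<^sup>2 \<le> s * (norm h)\<^sup>2"
    using s_pos Q_norm_le[of h] by (intro mult_left_mono power_mono) auto
  ultimately have "2 * (B (u t) \<bullet> (y t + \<phi>)) + 2 * (h \<bullet> h') \<le>
      - 2 * s * (u t \<bullet> B (u t)) - 2 * (\<alpha> - s) * (norm h)\<^sup>2 + 2 * (B (u t) \<bullet> \<phi>) + 2 * (h \<bullet> (\<psi> + s *\<^sub>R Q \<phi>))"
    by (simp add: algebra_simps)
  moreover have "((\<lambda>t. V (u t, y t)) has_real_derivative 2 * (B (u t) \<bullet> (y t + \<phi>)) + 2 * (h \<bullet> h')) (at t within S)"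
    unfolding V_def prod.case by (intro DERIV_add d1 d2)
  ultimately show ?thesis unfolding h_def by blast
qed

text \<open>
  \<open>\<Theta>\<close> changes only through the nonlinearity: \<open>avg (L u) = 0\<close>, and the damping cancels the velocity
  and the driving path.
\<close>

lemma \<Theta>_deriv:
  assumes u: "(u has_vector_derivative y t + \<phi>) (at t within S)"
    and y: "(y has_vector_derivative - L (u t) - \<alpha> *\<^sub>R (y t + \<phi>) + \<psi>) (at t within S)"
  shows "((\<lambda>t. \<Theta> (u t, y t)) has_real_derivative avg \<psi> / \<alpha>) (at t within S)"
proof -
  have "((\<lambda>t. \<Theta> (u t, y t)) has_vector_derivative avg (y t + \<phi>) + avg (- L (u t) - \<alpha> *\<^sub>R (y t + \<phi>) + \<psi>) / \<alpha>) (at t within S)"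
    unfolding \<Theta>_def prod.case
    by (intro has_vector_derivative_add has_vector_derivative_divide
        bounded_linear.has_vector_derivative[OF bounded_linear_avg] u y)
  moreover have "avg (y t + \<phi>) + avg (- L (u t) - \<alpha> *\<^sub>R (y t + \<phi>) + \<psi>) / \<alpha> = avg \<psi> / \<alpha>"
    using \<alpha> by (simp add: avg_simps avg_L field_simps)
  ultimately show ?thesis by (simp add: has_real_derivative_iff_has_vector_derivative)
qed

text \<open>
  The inequality behind the invariance of the cone, with \<open>r = \<Lambda> / \<alpha>\<^sup>2\<close>, \<open>b = u \<bullet> B u\<close>, \<open>H = |h|\<close>,
  \<open>t = |e| \<Theta>\<close>, \<open>\<nu> = |u|\<close> and \<open>p\<close> the size of the perturbation.
\<close>

lemma cone_arith:
  fixes r b H p \<nu> t :: real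
  assumes r: "0 < r" "r \<le> 1" and b: "0 \<le> b" and H: "0 \<le> H" and p: "p \<le> r * \<alpha>\<^sup>2 / 8 * \<nu>"
    and \<nu>: "0 \<le> \<nu>" "\<nu>\<^sup>2 \<le> 2 * b / (r * \<alpha>\<^sup>2) + 2 * t\<^sup>2 + 2 * H\<^sup>2 / \<alpha>\<^sup>2"
  shows "2 * p * (H + r * \<alpha> * \<bar>t\<bar>) \<le> r * \<alpha> / 2 * b + r * \<alpha> / 2 * (r * \<alpha>\<^sup>2) * t\<^sup>2 + (2 * \<alpha> - 3 * (r * \<alpha> / 2)) * H\<^sup>2"
proof -
  define X where "X = H + r * \<alpha> * \<bar>t\<bar>"
  have X: "0 \<le> X" using H r \<alpha> by (auto simp: X_def)
  have X2: "X\<^sup>2 \<le> 2 * H\<^sup>2 + 2 * (r * \<alpha>)\<^sup>2 * t\<^sup>2"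
    using sum_squares_bound[of H "r * \<alpha> * \<bar>t\<bar>"] by (simp add: X_def power2_sum power_mult_distrib algebra_simps)
  have "2 * p * X \<le> 2 * (r * \<alpha>\<^sup>2 / 8 * \<nu>) * X"
    using p X by (intro mult_right_mono mult_left_mono) auto
  also have "\<dots> = \<alpha> / 8 * (2 * (r * \<alpha> * \<nu>) * X)" by (simp add: power2_eq_square)
  also have "\<dots> \<le> \<alpha> / 8 * ((r * \<alpha> * \<nu>)\<^sup>2 + X\<^sup>2)"
    using \<alpha> sum_squares_bound[of "r * \<alpha> * \<nu>" X] by (intro mult_left_mono) auto
  also have "\<dots> \<le> \<alpha> / 8 * ((r * \<alpha>)\<^sup>2 * (2 * b / (r * \<alpha>\<^sup>2) + 2 * t\<^sup>2 + 2 * H\<^sup>2 / \<alpha>\<^sup>2) + (2 * H\<^sup>2 + 2 * (r * \<alpha>)\<^sup>2 * t\<^sup>2))"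
    unfolding power_mult_distrib[of "r * \<alpha>" \<nu>] using \<alpha> \<nu>(2) X2
    by (intro mult_left_mono add_mono) auto
  also have "\<dots> = r * \<alpha> / 4 * b + r * \<alpha> / 2 * (r * \<alpha>\<^sup>2) * t\<^sup>2 + \<alpha> * (r\<^sup>2 / 4 + 1 / 4) * H\<^sup>2"
    using \<alpha> r by (simp add: field_simps power2_eq_square)
  also have "\<dots> \<le> r * \<alpha> / 2 * b + r * \<alpha> / 2 * (r * \<alpha>\<^sup>2) * t\<^sup>2 + (2 * \<alpha> - 3 * (r * \<alpha> / 2)) * H\<^sup>2"
  proof (intro add_mono order_refl mult_right_mono)
    have "0 \<le> (1 - r) * (7 + r)" using r by auto
    then have "r\<^sup>2 / 4 + 1 / 4 \<le> 2 - 3 * r / 2" by (simp add: algebra_simps power2_eq_square)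
    then have "\<alpha> * (r\<^sup>2 / 4 + 1 / 4) \<le> \<alpha> * (2 - 3 * r / 2)" using \<alpha> by (intro mult_left_mono) auto
    then show "\<alpha> * (r\<^sup>2 / 4 + 1 / 4) \<le> 2 * \<alpha> - 3 * (r * \<alpha> / 2)" by (simp add: algebra_simps)
  qed (use r \<alpha> b in auto)
  finally show ?thesis by (simp add: X_def)
qed

text \<open>
  Differences of solutions with the same driving path have this form. The conclusion makes
  \<open>{V < \<Lambda> |e|\<^sup>2 \<Theta>\<^sup>2}\<close> forward invariant.
\<close>

lemma cone_contraction:
  assumes u: "\<And>t. 0 \<le> t \<Longrightarrow> (u has_vector_derivative y t) (at t within {0..})"
    and y: "\<And>t. 0 \<le> t \<Longrightarrow> (y has_vector_derivative - L (u t) - \<alpha> *\<^sub>R y t + \<psi> t) (at t within {0..})"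
    and \<psi>: "\<And>t. 0 \<le> t \<Longrightarrow> norm (\<psi> t) \<le> M * norm (u t)"
    and t: "0 \<le> t"
  shows "V (u t, y t) - \<Lambda> * (norm e * \<Theta> (u t, y t))\<^sup>2
     \<le> (V (u 0, y 0) - \<Lambda> * (norm e * \<Theta> (u 0, y 0))\<^sup>2) * exp (- s * t)"
proof -
  define J where "J = (\<lambda>t. V (u t, y t) - \<Lambda> * (norm e * \<Theta> (u t, y t))\<^sup>2)"
  have "\<exists>D. (J has_real_derivative D) (at t within {0..}) \<and> D \<le> - s * J t" if t: "0 \<le> t" for t
  proof -
    define b where "b = u t \<bullet> B (u t)"
    define h where "h = y t + s *\<^sub>R Q (u t)"
    define \<theta> where "\<theta> = norm e * \<Theta> (u t, y t)"
    define r where "r = \<Lambda> / \<alpha>\<^sup>2"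
    have r: "0 < r" "r \<le> 1" and \<Lambda>r: "\<Lambda> = r * \<alpha>\<^sup>2" and sr: "s = r * \<alpha> / 2"
      using \<Lambda> \<alpha> by (auto simp: r_def s_def field_simps power2_eq_square)
    have b0: "0 \<le> b" by (simp add: b_def B_nonneg)
    obtain D where D: "((\<lambda>t. V (u t, y t)) has_real_derivative D) (at t within {0..})"
      "D \<le> - 2 * s * b - 2 * (\<alpha> - s) * (norm h)\<^sup>2 + 2 * (h \<bullet> \<psi> t)"
      using V_deriv[of u y t 0 "{0..}" "\<psi> t"] u[OF t] y[OF t] by (auto simp: Q_simps b_def h_def)
    have T: "((\<lambda>t. \<Theta> (u t, y t)) has_real_derivative avg (\<psi> t) / \<alpha>) (at t within {0..})"
      using \<Theta>_deriv[of u y t 0 "{0..}" "\<psi> t"] u[OF t] y[OF t] by simp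
    have J: "(J has_real_derivative D - \<Lambda> * (2 * \<theta> * (norm e * (avg (\<psi> t) / \<alpha>)))) (at t within {0..})"
      unfolding J_def by (rule derivative_eq_intros D T refl)+ (simp add: \<theta>_def)
    have hp: "h \<bullet> \<psi> t \<le> norm h * norm (\<psi> t)" by (rule norm_cauchy_schwarz)
    have "- (\<Lambda> * (2 * \<theta> * (norm e * (avg (\<psi> t) / \<alpha>)))) \<le> \<bar>\<Lambda> * (2 * \<theta> * (norm e * (avg (\<psi> t) / \<alpha>)))\<bar>"
      by (rule abs_ge_minus_self)
    also have "\<dots> = 2 * (r * \<alpha> * \<bar>\<theta>\<bar>) * (norm e * \<bar>avg (\<psi> t)\<bar>)"
      using r \<alpha> by (simp add: \<Lambda>r abs_mult power2_eq_square)
    also have "\<dots> \<le> 2 * (r * \<alpha> * \<bar>\<theta>\<bar>) * norm (\<psi> t)"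
      using r \<alpha> by (intro mult_left_mono avg_norm_le) auto
    finally have tp: "- (\<Lambda> * (2 * \<theta> * (norm e * (avg (\<psi> t) / \<alpha>)))) \<le> 2 * (r * \<alpha> * \<bar>\<theta>\<bar>) * norm (\<psi> t)" .
    have "(norm e * avg (u t))\<^sup>2 \<le> 2 * \<theta>\<^sup>2 + 2 * (norm h)\<^sup>2 / \<alpha>\<^sup>2"
    proof -
      have ah: "avg (y t) = avg h" using Q_e by (simp add: h_def avg_simps avg_def[of "Q _"])
      have "norm e * avg (u t) = \<theta> - norm e * avg h / \<alpha>"
        using \<alpha> by (simp add: \<theta>_def \<Theta>_def ah[symmetric] algebra_simps)
      also have "\<dots>\<^sup>2 \<le> 2 * \<theta>\<^sup>2 + 2 * (norm e * avg h / \<alpha>)\<^sup>2"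
        using sum_squares_bound[of \<theta> "- (norm e * avg h / \<alpha>)"] by (simp add: power2_diff)
      also have "(norm e * avg h / \<alpha>)\<^sup>2 \<le> (norm h)\<^sup>2 / \<alpha>\<^sup>2"
        unfolding power_divide using norm_decomp[of h] by (intro divide_right_mono) auto
      finally show ?thesis by simp
    qed
    moreover have "(norm (Q (u t)))\<^sup>2 \<le> 2 * b / (r * \<alpha>\<^sup>2)"
      using B_lower[of "u t"] \<Lambda> unfolding \<Lambda>r[symmetric] b_def by (simp add: field_simps)
    ultimately have "(norm (u t))\<^sup>2 \<le> 2 * b / (r * \<alpha>\<^sup>2) + 2 * \<theta>\<^sup>2 + 2 * (norm h)\<^sup>2 / \<alpha>\<^sup>2"
      using norm_decomp[of "u t"] by simp
    moreover have "norm (\<psi> t) \<le> r * \<alpha>\<^sup>2 / 8 * norm (u t)"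
      using \<psi>[OF t] M mult_right_mono[of M "\<Lambda> / 8" "norm (u t)"] by (simp add: \<Lambda>r)
    ultimately have ca: "2 * norm (\<psi> t) * (norm h + r * \<alpha> * \<bar>\<theta>\<bar>)
        \<le> r * \<alpha> / 2 * b + r * \<alpha> / 2 * (r * \<alpha>\<^sup>2) * \<theta>\<^sup>2 + (2 * \<alpha> - 3 * (r * \<alpha> / 2)) * (norm h)\<^sup>2"
      using cone_arith[OF r b0, of "norm h" "norm (\<psi> t)" "norm (u t)" \<theta>] by auto
    have Jt: "J t = b + (norm h)\<^sup>2 - r * \<alpha>\<^sup>2 * \<theta>\<^sup>2"
      unfolding \<Lambda>r[symmetric] by (simp add: J_def V_def b_def h_def \<theta>_def)
    have "D - \<Lambda> * (2 * \<theta> * (norm e * (avg (\<psi> t) / \<alpha>))) \<le> - s * J t"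
      using D(2) hp tp ca unfolding sr Jt by (simp add: algebra_simps)
    with J show ?thesis by blast
  qed
  then obtain J' where "\<And>t. 0 \<le> t \<Longrightarrow> (J has_real_derivative J' t) (at t within {0..})" "\<And>t. 0 \<le> t \<Longrightarrow> J' t \<le> - s * J t"
    by metis
  from exp_weight_nonincreasing[of t J J' s, OF this(1) this(2) t] show ?thesis by (simp add: J_def)
qed


text \<open>The vector field in the variables \<open>u\<close> and \<open>y\<close>; \<open>y + w\<close> is the velocity.\<close>

definition vf :: "(real \<Rightarrow> 'a) \<Rightarrow> real \<Rightarrow> 'a \<times> 'a \<Rightarrow> 'a \<times> 'a" where
  "vf w t x = (snd x + w t, - L (fst x) - \<alpha> *\<^sub>R (snd x + w t) + N (fst x))"

lemma N_continuous: "continuous_on S N"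
proof (rule lipschitz_on_continuous_on)
  show "M-lipschitz_on S N"
    by (rule lipschitz_onI) (use N_lip M in \<open>auto simp: dist_norm\<close>)
qed

lemma bounded_linear_L: "bounded_linear L"
  using lin linear_conv_bounded_linear by blast

lemma vf_lipschitz: "\<exists>C>0. \<forall>w t a b. norm (vf w t a - vf w t b) \<le> C * norm (a - b)"
proof -
  obtain K where K: "K > 0" "\<And>x. norm (L x) \<le> norm x * K"
    using bounded_linear.pos_bounded[OF bounded_linear_L] by blast
  have "norm (vf w t a - vf w t b) \<le> (1 + K + \<alpha> + M) * norm (a - b)" for w t a b
  proof -
    define d1 d2 where "d1 = fst a - fst b" and "d2 = snd a - snd b"
    have le: "norm d1 \<le> norm (a - b)" "norm d2 \<le> norm (a - b)"
      by (cases a, cases b, use norm_fst_le norm_snd_le in \<open>auto simp: d1_def d2_def\<close>)+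
    have eq: "vf w t a - vf w t b = (d2, (N (fst a) - N (fst b)) - L d1 - \<alpha> *\<^sub>R d2)"
      by (simp add: vf_def d1_def d2_def L_simps algebra_simps)
    have "norm (vf w t a - vf w t b) \<le> norm d2 + norm ((N (fst a) - N (fst b)) - L d1 - \<alpha> *\<^sub>R d2)"
      unfolding eq by (rule norm_Pair_le)
    also have "\<dots> \<le> norm d2 + (M * norm d1 + norm d1 * K + \<alpha> * norm d2)"
      using N_lip[of "fst a" "fst b"] K(2)[of d1] \<alpha>
        norm_triangle_ineq4[of "(N (fst a) - N (fst b)) - L d1" "\<alpha> *\<^sub>R d2"]
        norm_triangle_ineq4[of "N (fst a) - N (fst b)" "L d1"]
      unfolding d1_def[symmetric] by simp
    also have "\<dots> \<le> norm (a - b) + (M * norm (a - b) + norm (a - b) * K + \<alpha> * norm (a - b))"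
      using le M K \<alpha> by (intro add_mono mult_left_mono mult_right_mono) auto
    finally show ?thesis by (simp add: algebra_simps)
  qed
  moreover have "1 + K + \<alpha> + M > 0" using K \<alpha> M by simp
  ultimately show ?thesis by blast
qed

lemma vf_continuous:
  assumes "continuous_on S w" "continuous_on S x"
  shows "continuous_on S (\<lambda>t. vf w t (x t))"
  unfolding vf_def
  by (intro continuous_intros assms continuous_on_compose2[OF N_continuous[of UNIV]]
      continuous_on_compose2[OF linear_continuous_on[OF bounded_linear_L, of UNIV]]) auto

definition sol :: "(real \<Rightarrow> 'a) \<Rightarrow> 'a \<times> 'a \<Rightarrow> real \<Rightarrow> 'a \<times> 'a" where
  "sol w x0 = (SOME x. solves_ode (vf w) x0 x)"

lemma sol_solves:
  assumes w: "continuous_on UNIV w"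
  shows "solves_ode (vf w) x0 (sol w x0)"
proof -
  obtain C where "C > 0" "\<And>t a b. norm (vf w t a - vf w t b) \<le> C * norm (a - b)"
    using vf_lipschitz by blast
  then have "\<exists>x. solves_ode (vf w) x0 x"
    by (intro solves_ode_exists[where L = C]) (auto intro!: vf_continuous w)
  then show ?thesis unfolding sol_def by (rule someI_ex)
qed

lemma vf_unique:
  assumes "solves_ode (vf w) x0 x" "solves_ode (vf w) x0 y" "0 \<le> t"
  shows "x t = y t"
proof -
  obtain C where "C > 0" "\<And>t a b. norm (vf w t a - vf w t b) \<le> C * norm (a - b)"
    using vf_lipschitz by blast
  then show ?thesis by (intro solves_ode_unique[OF assms(1,2) _ assms(3)])
qed

lemma solves_vf_components:
  assumes "solves_ode (vf w) x0 x" "0 \<le> t"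
  shows "((\<lambda>t. fst (x t)) has_vector_derivative snd (x t) + w t) (at t within {0..})"
    and "((\<lambda>t. snd (x t)) has_vector_derivative - L (fst (x t)) - \<alpha> *\<^sub>R (snd (x t) + w t) + N (fst (x t))) (at t within {0..})"
proof -
  have x: "(x has_vector_derivative vf w t (x t)) (at t within {0..})"
    using assms by (simp add: solves_ode_def)
  show "((\<lambda>t. fst (x t)) has_vector_derivative snd (x t) + w t) (at t within {0..})"
    using bounded_linear.has_vector_derivative[OF bounded_linear_fst x] by (simp add: vf_def)
  show "((\<lambda>t. snd (x t)) has_vector_derivative - L (fst (x t)) - \<alpha> *\<^sub>R (snd (x t) + w t) + N (fst (x t))) (at t within {0..})"
    using bounded_linear.has_vector_derivative[OF bounded_linear_snd x] by (simp add: vf_def)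
qed

text \<open>
  Restarting at time \<open>\<tau>\<close> resets the driving path to \<open>0\<close>, so that \<open>w \<tau>\<close> is absorbed into the second
  variable.
\<close>

lemma solves_vf_restart:
  assumes x: "solves_ode (vf w) x0 x" and \<tau>: "0 \<le> \<tau>"
  shows "solves_ode (vf (\<lambda>t. w (\<tau> + t) - w \<tau>)) (fst (x \<tau>), snd (x \<tau>) + w \<tau>)
     (\<lambda>t. (fst (x (\<tau> + t)), snd (x (\<tau> + t)) + w \<tau>))"
  unfolding solves_ode_def
proof (intro conjI allI impI)
  fix t :: real assume t: "0 \<le> t"
  have sh: "((\<lambda>t. f (\<tau> + t)) has_vector_derivative f') (at t within {0..})"
    if "(f has_vector_derivative f') (at (\<tau> + t) within {0..})" for f :: "real \<Rightarrow> 'a" and f'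
  proof -
    have g: "((\<lambda>t. \<tau> + t) has_vector_derivative 1) (at t within {0..})"
      by (auto intro!: derivative_eq_intros)
    have "(f has_vector_derivative f') (at (\<tau> + t) within (\<lambda>t. \<tau> + t) ` {0..})"
      using \<tau> by (intro has_vector_derivative_within_subset[OF that]) auto
    from vector_diff_chain_within[OF g this] show ?thesis by (simp add: o_def)
  qed
  have "((\<lambda>t. (fst (x (\<tau> + t)), snd (x (\<tau> + t)) + w \<tau>)) has_vector_derivative
    (snd (x (\<tau> + t)) + w (\<tau> + t), - L (fst (x (\<tau> + t))) - \<alpha> *\<^sub>R (snd (x (\<tau> + t)) + w (\<tau> + t)) + N (fst (x (\<tau> + t))) + 0)) (at t within {0..})"
    using \<tau> t by (intro has_vector_derivative_Pair has_vector_derivative_add has_vector_derivative_const sh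
        solves_vf_components[OF x]) auto
  then show "((\<lambda>t. (fst (x (\<tau> + t)), snd (x (\<tau> + t)) + w \<tau>)) has_vector_derivative
      vf (\<lambda>t. w (\<tau> + t) - w \<tau>) t (fst (x (\<tau> + t)), snd (x (\<tau> + t)) + w \<tau>)) (at t within {0..})"
    by (simp add: vf_def)
qed simp

lemma c_nonneg: "0 \<le> c"
  using N_bound[of 0] norm_ge_zero order_trans by blast

lemma \<Theta>_lipschitz:
  assumes x: "solves_ode (vf w) x0 x" and t: "0 \<le> r" "r \<le> t"
  shows "\<bar>\<Theta> (x t) - \<Theta> (x r)\<bar> \<le> c / (norm e * \<alpha>) * (t - r)"
proof -
  have "norm (\<Theta> (x t) - \<Theta> (x r)) \<le> c / (norm e * \<alpha>) * norm (t - r)"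
  proof (rule field_differentiable_bound[of "{r..t}" _ "\<lambda>q. avg (N (fst (x q))) / \<alpha>"])
    fix q assume q: "q \<in> {r..t}"
    have "((\<lambda>t. \<Theta> (fst (x t), snd (x t))) has_real_derivative avg (N (fst (x q))) / \<alpha>) (at q within {0..})"
      using solves_vf_components[OF x, of q] q t by (intro \<Theta>_deriv) auto
    then show "((\<lambda>t. \<Theta> (x t)) has_real_derivative avg (N (fst (x q))) / \<alpha>) (at q within {r..t})"
      using t by (auto intro: DERIV_subset)
    have "norm e * \<bar>avg (N (fst (x q)))\<bar> \<le> c"
      using avg_norm_le N_bound order_trans by blast
    then show "norm (avg (N (fst (x q))) / \<alpha>) \<le> c / (norm e * \<alpha>)"
      using \<alpha> e by (simp add: field_simps)
  qed (use t in auto)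
  then show ?thesis using t by simp
qed

lemma \<Theta>_simps: "\<Theta> (x + y) = \<Theta> x + \<Theta> y" "\<Theta> (x - y) = \<Theta> x - \<Theta> y" "\<Theta> 0 = 0" "\<Theta> (r *\<^sub>R e, 0) = r"
  by (auto simp: \<Theta>_def avg_simps add_divide_distrib diff_divide_distrib zero_prod_def split: prod.split)

lemma V_shift: "V (u + r *\<^sub>R e, y) = V (u, y)"
proof -
  have Be: "B (r *\<^sub>R e) = 0" by (simp add: B_def L_simps Q_simps e)
  have "(r *\<^sub>R e) \<bullet> B u = 0" using B_sym[of "r *\<^sub>R e" u] Be by simp
  then show ?thesis using Be by (simp add: V_def B_simps(1) Q_simps inner_simps)
qed

text \<open>
  Two solutions whose difference, after a translation by \<open>k\<close> periods, lies in the cone remain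
  ordered with respect to \<open>\<Theta>\<close>.
\<close>

lemma \<Theta>_ordered:
  assumes x: "solves_ode (vf w) x0 x" and y: "solves_ode (vf w) y0 y"
    and k: "V (x0 - y0) < \<Lambda> * (norm e * (\<Theta> (x0 - y0) + real_of_int k * \<kappa>))\<^sup>2"
    and pos: "0 < \<Theta> (x0 - y0) + real_of_int k * \<kappa>" and t: "0 \<le> t"
  shows "0 < \<Theta> (x t - y t) + real_of_int k * \<kappa>"
proof (rule ccontr)
  define m where "m = real_of_int k * \<kappa>"
  define u where "u = (\<lambda>t. fst (x t) - fst (y t) + m *\<^sub>R e)"
  define v where "v = (\<lambda>t. snd (x t) - snd (y t))"
  define \<psi> where "\<psi> = (\<lambda>t. N (fst (x t)) - N (fst (y t)))"
  have Nk: "N (a + (real j * \<kappa>) *\<^sub>R e) = N a" for a j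
  proof (induction j)
    case (Suc j)
    have "N (a + (real (Suc j) * \<kappa>) *\<^sub>R e) = N (a + (real j * \<kappa>) *\<^sub>R e + \<kappa> *\<^sub>R e)"
      by (simp add: algebra_simps)
    then show ?case using Suc N_period by simp
  qed simp
  have Nm: "N (a + m *\<^sub>R e) = N a" for a
  proof (cases "0 \<le> k")
    case True
    then show ?thesis using Nk[of a "nat k"] by (simp add: m_def)
  next
    case False
    then show ?thesis using Nk[of "a + m *\<^sub>R e" "nat (- k)"] by (simp add: m_def)
  qed
  have du: "(u has_vector_derivative v t) (at t within {0..})" if "0 \<le> t" for t
    using has_vector_derivative_add[OF has_vector_derivative_diff[OF solves_vf_components(1)[OF x that] solves_vf_components(1)[OF y that]]
      has_vector_derivative_const[of "m *\<^sub>R e"]]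
    by (simp add: u_def v_def)
  have dv: "(v has_vector_derivative - L (u t) - \<alpha> *\<^sub>R v t + \<psi> t) (at t within {0..})" if "0 \<le> t" for t
    using has_vector_derivative_diff[OF solves_vf_components(2)[OF x that] solves_vf_components(2)[OF y that]]
    by (simp add: u_def v_def \<psi>_def L_simps e algebra_simps)
  have \<psi>_le: "norm (\<psi> t) \<le> M * norm (u t)" for t
    using N_lip[of "fst (x t) + m *\<^sub>R e" "fst (y t)"] by (simp add: \<psi>_def u_def Nm algebra_simps)
  have uv: "(u t, v t) = x t - y t + (m *\<^sub>R e, 0)" for t
    by (simp add: u_def v_def prod_eq_iff)
  have Vuv: "V (u t, v t) = V (x t - y t)" for t
    using V_shift[of "fst (x t) - fst (y t)" m "snd (x t) - snd (y t)"] by (simp add: u_def v_def minus_prod_def)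
  have \<Theta>uv: "\<Theta> (u t, v t) = \<Theta> (x t - y t) + m" for t
    unfolding uv \<Theta>_simps ..
  have x0: "x 0 = x0" "y 0 = y0" using x y by (auto simp: solves_ode_def)
  have pos_q: "\<Theta> (u q, v q) \<noteq> 0" if q: "0 \<le> q" for q
  proof
    assume "\<Theta> (u q, v q) = 0"
    then have "V (u q, v q) \<le> (V (u 0, v 0) - \<Lambda> * (norm e * \<Theta> (u 0, v 0))\<^sup>2) * exp (- s * q)"
      using cone_contraction[OF du dv \<psi>_le q] by simp
    also have "\<dots> < 0"
      using k by (intro mult_neg_pos) (auto simp: Vuv \<Theta>uv x0 m_def)
    finally show False using V_nonneg[of "(u q, v q)"] by simp
  qed
  assume "\<not> 0 < \<Theta> (x t - y t) + real_of_int k * \<kappa>"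
  then have neg: "\<Theta> (u t, v t) \<le> 0" unfolding \<Theta>uv m_def by simp
  have "continuous_on {0..} (\<lambda>q. \<Theta> (u q, v q))"
  proof (rule has_vector_derivative_imp_continuous_on)
    fix q :: real assume "q \<in> {0..}"
    then show "((\<lambda>q. \<Theta> (u q, v q)) has_vector_derivative avg (\<psi> q) / \<alpha>) (at q within {0..})"
      using \<Theta>_deriv[of u v q 0 "{0..}" "\<psi> q"] du[of q] dv[of q]
      by (simp add: has_real_derivative_iff_has_vector_derivative)
  qed
  then have "continuous_on {0..t} (\<lambda>q. \<Theta> (u q, v q))" by (rule continuous_on_subset) auto
  then obtain q where "0 \<le> q" "\<Theta> (u q, v q) = 0"
    using IVT2'[of "\<lambda>q. \<Theta> (u q, v q)" t 0 0] neg pos t unfolding \<Theta>uv x0 m_def by auto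
  with pos_q show False by blast
qed

text \<open>
  Two solutions driven by the same path undergo the same displacement, up to a bound that depends
  only on the transverse energy of the initial difference and not on time.
\<close>

lemma displacement_lower:
  assumes x: "solves_ode (vf w) x0 x" and y: "solves_ode (vf w) y0 y" and t: "0 \<le> t"
  shows "\<Theta> (y t) - \<Theta> y0 - (\<Theta> (x t) - \<Theta> x0) \<le> sqrt (V (x0 - y0) / (\<Lambda> * (e \<bullet> e))) + 2 * \<kappa>"
proof -
  define R where "R = sqrt (V (x0 - y0) / (\<Lambda> * (e \<bullet> e)))"
  define d where "d = \<Theta> (x0 - y0)"
  \<comment> \<open>The least number of periods that moves the difference into the cone with a positive sign.\<close>
  define k where "k = \<lfloor>(R - d) / \<kappa>\<rfloor> + 1"
  have R0: "0 \<le> R" using V_nonneg[of "x0 - y0"] \<Lambda> ee by (auto simp: R_def)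
  have "(R - d) / \<kappa> < real_of_int k" "real_of_int k \<le> (R - d) / \<kappa> + 1"
    unfolding k_def by linarith+
  then have k: "R < d + k * \<kappa>" "d + k * \<kappa> \<le> R + \<kappa>"
    using \<kappa> by (auto simp: field_simps)
  have "V (x0 - y0) = \<Lambda> * (e \<bullet> e) * R\<^sup>2"
    using V_nonneg[of "x0 - y0"] \<Lambda> ee by (simp add: R_def field_simps)
  also have "\<dots> < \<Lambda> * (e \<bullet> e) * (d + k * \<kappa>)\<^sup>2"
    using k R0 \<Lambda> ee by (intro mult_strict_left_mono power_strict_mono) auto
  finally have "V (x0 - y0) < \<Lambda> * (norm e * (d + real_of_int k * \<kappa>))\<^sup>2"
    by (simp add: power_mult_distrib power2_norm_eq_inner)
  moreover have "0 < d + real_of_int k * \<kappa>" using k R0 by simp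
  ultimately have "0 < \<Theta> (x t - y t) + real_of_int k * \<kappa>"
    using \<Theta>_ordered[OF x y _ _ t] by (simp add: d_def)
  then have "\<Theta> (y t) - \<Theta> (x t) < real_of_int k * \<kappa>" by (simp add: \<Theta>_simps)
  then have "\<Theta> (y t) - \<Theta> y0 - (\<Theta> (x t) - \<Theta> x0) < d + real_of_int k * \<kappa>"
    unfolding d_def \<Theta>_simps by linarith
  then show ?thesis unfolding R_def[symmetric] using k \<kappa> by linarith
qed

lemma V_minus: "V (- x) = V x"
proof -
  have "norm (- a - s *\<^sub>R b) = norm (a + s *\<^sub>R b)" for a b :: 'a
    using norm_minus_cancel[of "a + s *\<^sub>R b"] by simp
  moreover have "B (- a) = - B a" for a using B_simps(3)[of "- 1" a] by simp
  ultimately show ?thesis by (auto simp: V_def Q_simps split: prod.split)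
qed

lemma displacement_compare:
  assumes x: "solves_ode (vf w) x0 x" and y: "solves_ode (vf w) y0 y" and t: "0 \<le> t"
  shows "\<bar>(\<Theta> (x t) - \<Theta> x0) - (\<Theta> (y t) - \<Theta> y0)\<bar> \<le> sqrt (V (x0 - y0) / (\<Lambda> * (e \<bullet> e))) + 2 * \<kappa>"
  using displacement_lower[OF x y t] displacement_lower[OF y x t] V_minus[of "x0 - y0"] by simp


lemma B_bound: "\<exists>K\<ge>0. \<forall>u. norm (B u) \<le> K * norm (Q u)"
proof -
  obtain K where K: "K > 0" "\<And>x. norm (B x) \<le> norm x * K"
    using bounded_linear.pos_bounded[OF bounded_linear_B] by blast
  have "B (Q u) = B u" for u
  proof -
    have "B e = 0" by (simp add: B_def Q_simps e)
    then show ?thesis by (simp add: Q_def B_simps)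
  qed
  then have "norm (B u) \<le> K * norm (Q u)" for u
    using K(2)[of "Q u"] by (simp add: mult.commute)
  then show ?thesis using K(1) less_imp_le by blast
qed

lemma young: "2 * (a * b) \<le> r * a\<^sup>2 + b\<^sup>2 / r" if "0 < r" for a b r :: real
proof -
  have "0 \<le> (r * a - b)\<^sup>2 / r" using that by simp
  also have "\<dots> = r * a\<^sup>2 + b\<^sup>2 / r - 2 * (a * b)" using that by (simp add: power2_eq_square field_simps)
  finally show ?thesis by simp
qed

text \<open>
  Over one unit of time the energy transverse to \<open>(e, 0)\<close>, taken with the velocity in place of \<open>y\<close>,
  contracts by a fixed factor, up to an error that is quadratic in a bound \<open>S\<close> on the driving path.
\<close>

lemma dissipation:
  "\<exists>\<gamma> C. 0 \<le> \<gamma> \<and> \<gamma> < 1 \<and> 0 < C \<and>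
     (\<forall>w x0 x S. solves_ode (vf w) x0 x \<longrightarrow> (\<forall>t\<in>{0..1}. norm (w t) \<le> S) \<longrightarrow>
        V (fst (x 1), snd (x 1) + w 1) \<le> \<gamma> * V x0 + C * (1 + S\<^sup>2))"
proof -
  obtain K where K: "K \<ge> 0" "\<And>u. norm (B u) \<le> K * norm (Q u)" using B_bound by blast
  define C1 where "C1 = 2 * K\<^sup>2 / (s * \<Lambda>) + (2 * c\<^sup>2 + 2 * (\<alpha> + s)\<^sup>2) / s"
  have C1: "0 \<le> C1" using s_pos \<Lambda> by (simp add: C1_def)
  \<comment> \<open>The price \<open>1 + \<eta>\<close> for passing from \<open>y\<close> to \<open>y + w\<close> must stay below the gain \<open>exp s\<close>.\<close>
  define \<eta> where "\<eta> = (exp s - 1) / 2"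
  have \<eta>: "\<eta> > 0" using s_pos by (simp add: \<eta>_def)
  define \<gamma> where "\<gamma> = (1 + \<eta>) * exp (- s)"
  have \<gamma>: "0 \<le> \<gamma>" "\<gamma> < 1"
    using \<eta> s_pos by (auto simp: \<gamma>_def \<eta>_def exp_minus field_simps)
  define C where "C = (1 + \<eta>) * (C1 / s) + (1 + 1 / \<eta>)"
  have C: "0 < C" using C1 s_pos \<eta> by (simp add: C_def add_nonneg_pos)
  have "V (fst (x 1), snd (x 1) + w 1) \<le> \<gamma> * V x0 + C * (1 + S\<^sup>2)"
    if x: "solves_ode (vf w) x0 x" and w: "\<forall>t\<in>{0..1}. norm (w t) \<le> S" for w x0 x S
  proof -
    have S0: "0 \<le> S" using w norm_ge_zero[of "w 0"] by (meson atLeastAtMost_iff order_trans zero_le_one order_refl)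
    have "\<exists>D. ((\<lambda>t. V (x t)) has_real_derivative D) (at t within {0..}) \<and> D \<le> - s * (V (x t) - C1 * (1 + S\<^sup>2) / s)"
      if t: "0 \<le> t" "t \<le> 1" for t
    proof -
      define u where "u = fst (x t)"
      define h where "h = snd (x t) + s *\<^sub>R Q u"
      define b where "b = u \<bullet> B u"
      define F where "F = N u - \<alpha> *\<^sub>R w t + s *\<^sub>R Q (w t)"
      have wS: "norm (w t) \<le> S" using w t by auto
      have "((\<lambda>t. snd (x t)) has_vector_derivative - L (fst (x t)) - \<alpha> *\<^sub>R snd (x t) + (N u - \<alpha> *\<^sub>R w t)) (at t within {0..})"
        using solves_vf_components(2)[OF x t(1)] by (simp add: u_def algebra_simps)
      from V_deriv[OF solves_vf_components(1)[OF x t(1)] this]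
      obtain D where D: "((\<lambda>t. V (x t)) has_real_derivative D) (at t within {0..})"
        "D \<le> - 2 * s * b - 2 * (\<alpha> - s) * (norm h)\<^sup>2 + 2 * (B u \<bullet> w t) + 2 * (h \<bullet> F)"
        by (auto simp: u_def h_def b_def F_def algebra_simps)
      have "norm F \<le> norm (N u) + norm (\<alpha> *\<^sub>R w t) + norm (s *\<^sub>R Q (w t))"
        unfolding F_def using norm_triangle_ineq[of "N u - \<alpha> *\<^sub>R w t" "s *\<^sub>R Q (w t)"] norm_triangle_ineq4[of "N u" "\<alpha> *\<^sub>R w t"] by simp
      also have "\<dots> \<le> c + \<alpha> * S + s * S"
        using N_bound wS \<alpha> s_pos Q_norm_le[of "w t"] by (auto intro!: add_mono)
      finally have "(norm F)\<^sup>2 \<le> (c + (\<alpha> + s) * S)\<^sup>2"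
        by (intro power_mono) (auto simp: algebra_simps)
      also have "\<dots> \<le> 2 * c\<^sup>2 + 2 * (\<alpha> + s)\<^sup>2 * S\<^sup>2"
        using sum_squares_bound[of c "(\<alpha> + s) * S"] power2_sum[of c "(\<alpha> + s) * S"]
          power_mult_distrib[of "\<alpha> + s" S 2] by linarith
      finally have F2: "(norm F)\<^sup>2 \<le> 2 * c\<^sup>2 + 2 * (\<alpha> + s)\<^sup>2 * S\<^sup>2" .
      have "2 * (h \<bullet> F) \<le> 2 * (norm h * norm F)" using norm_cauchy_schwarz[of h F] by simp
      also have "\<dots> \<le> s * (norm h)\<^sup>2 + (norm F)\<^sup>2 / s" by (rule young[OF s_pos(1)])
      also have "(norm F)\<^sup>2 / s \<le> (2 * c\<^sup>2 + 2 * (\<alpha> + s)\<^sup>2 * S\<^sup>2) / s" using F2 s_pos by (intro divide_right_mono) auto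
      finally have hF: "2 * (h \<bullet> F) \<le> s * (norm h)\<^sup>2 + (2 * c\<^sup>2 + 2 * (\<alpha> + s)\<^sup>2 * S\<^sup>2) / s" by simp
      have "B u \<bullet> w t \<le> norm (B u) * norm (w t)" by (rule norm_cauchy_schwarz)
      also have "\<dots> \<le> (K * norm (Q u)) * S" using K wS by (intro mult_mono) auto
      finally have "2 * (B u \<bullet> w t) \<le> 2 * (norm (Q u) * (K * S))" by (simp add: algebra_simps)
      also have "\<dots> \<le> s * \<Lambda> / 2 * (norm (Q u))\<^sup>2 + (K * S)\<^sup>2 / (s * \<Lambda> / 2)"
        using s_pos \<Lambda> by (intro young) simp
      also have "s * \<Lambda> / 2 * (norm (Q u))\<^sup>2 \<le> s * b"
        using mult_left_mono[OF B_lower[of u], of s] s_pos by (simp add: b_def)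
      finally have Bw: "2 * (B u \<bullet> w t) \<le> s * b + 2 * K\<^sup>2 / (s * \<Lambda>) * S\<^sup>2"
        by (simp add: power_mult_distrib algebra_simps)
      have "2 * K\<^sup>2 / (s * \<Lambda>) * S\<^sup>2 + (2 * c\<^sup>2 + 2 * (\<alpha> + s)\<^sup>2 * S\<^sup>2) / s \<le> C1 * (1 + S\<^sup>2)"
      proof -
        have "0 \<le> 2 * K\<^sup>2 / (s * \<Lambda>)" "0 \<le> 2 * c\<^sup>2 * S\<^sup>2 / s" "0 \<le> 2 * (\<alpha> + s)\<^sup>2 / s"
          using s_pos \<Lambda> by auto
        then show ?thesis by (simp add: C1_def algebra_simps add_divide_distrib)
      qed
      moreover have "s * (norm h)\<^sup>2 * 2 \<le> \<alpha> * (norm h)\<^sup>2"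
        using mult_right_mono[OF s_pos(2), of "(norm h)\<^sup>2"] by simp
      moreover have "V (x t) = b + (norm h)\<^sup>2"
        by (simp add: V_def b_def h_def u_def split: prod.split)
      moreover have "- s * (V (x t) - C1 * (1 + S\<^sup>2) / s) = - s * V (x t) + C1 * (1 + S\<^sup>2)"
        using s_pos by (simp add: right_diff_distrib)
      ultimately have "D \<le> - s * (V (x t) - C1 * (1 + S\<^sup>2) / s)"
        using D(2) hF Bw s_pos by (simp add: algebra_simps)
      with D show ?thesis by blast
    qed
    then obtain D where D: "\<And>t. 0 \<le> t \<Longrightarrow> t \<le> 1 \<Longrightarrow> ((\<lambda>t. V (x t)) has_real_derivative D t) (at t within {0..})"
      "\<And>t. 0 \<le> t \<Longrightarrow> t \<le> 1 \<Longrightarrow> D t \<le> - s * (V (x t) - C1 * (1 + S\<^sup>2) / s)"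
      by metis
    have D': "((\<lambda>t. V (x t) - C1 * (1 + S\<^sup>2) / s) has_real_derivative D t) (at t within {0..})" if "0 \<le> t" "t \<le> 1" for t
      using DERIV_diff[OF D(1)[OF that] DERIV_const] by simp
    have "V (x 1) - C1 * (1 + S\<^sup>2) / s \<le> (V (x 0) - C1 * (1 + S\<^sup>2) / s) * exp (- s * 1)"
      by (rule exp_weight_nonincreasing[OF D' D(2)]) auto
    moreover have "0 \<le> C1 * (1 + S\<^sup>2) / s * exp (- s)" using C1 s_pos by auto
    ultimately have V1: "V (x 1) \<le> exp (- s) * V x0 + C1 / s * (1 + S\<^sup>2)"
      using x by (simp add: solves_ode_def algebra_simps add_divide_distrib)
    define h where "h = snd (x 1) + s *\<^sub>R Q (fst (x 1))"
    have "(norm (h + w 1))\<^sup>2 \<le> (norm h + norm (w 1))\<^sup>2"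
      by (intro power_mono norm_triangle_ineq) auto
    also have "\<dots> \<le> (1 + \<eta>) * (norm h)\<^sup>2 + (1 + 1 / \<eta>) * (norm (w 1))\<^sup>2"
      using young[OF \<eta>, of "norm h" "norm (w 1)"] by (simp add: power2_sum algebra_simps)
    also have "\<dots> \<le> (1 + \<eta>) * (norm h)\<^sup>2 + (1 + 1 / \<eta>) * (1 + S\<^sup>2)"
    proof -
      have "(norm (w 1))\<^sup>2 \<le> S\<^sup>2" using w by (intro power_mono) auto
      then show ?thesis using \<eta> by (intro add_left_mono mult_left_mono) auto
    qed
    finally have "(norm (h + w 1))\<^sup>2 \<le> (1 + \<eta>) * (norm h)\<^sup>2 + (1 + 1 / \<eta>) * (1 + S\<^sup>2)" .
    moreover have "fst (x 1) \<bullet> B (fst (x 1)) \<le> (1 + \<eta>) * (fst (x 1) \<bullet> B (fst (x 1)))"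
      using B_nonneg[of "fst (x 1)"] \<eta> by (simp add: algebra_simps)
    moreover have "V (x 1) = fst (x 1) \<bullet> B (fst (x 1)) + (norm h)\<^sup>2"
      by (simp add: V_def h_def split: prod.split)
    moreover have "V (fst (x 1), snd (x 1) + w 1) = fst (x 1) \<bullet> B (fst (x 1)) + (norm (h + w 1))\<^sup>2"
      by (simp add: V_def h_def algebra_simps)
    ultimately have "V (fst (x 1), snd (x 1) + w 1) \<le> (1 + \<eta>) * V (x 1) + (1 + 1 / \<eta>) * (1 + S\<^sup>2)"
      by (simp add: distrib_left)
    also have "\<dots> \<le> (1 + \<eta>) * (exp (- s) * V x0 + C1 / s * (1 + S\<^sup>2)) + (1 + 1 / \<eta>) * (1 + S\<^sup>2)"
      using V1 \<eta> by (intro add_right_mono mult_left_mono) auto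
    also have "\<dots> = \<gamma> * V x0 + C * (1 + S\<^sup>2)"
      by (simp add: \<gamma>_def C_def algebra_simps add_divide_distrib)
    finally show ?thesis .
  qed
  with \<gamma> C show ?thesis by blast
qed

section \<open>The displacement from rest\<close>

text \<open>
  For the solution that starts at \<open>(0, 0)\<close>, \<open>disp w t\<close> is the displacement of \<open>\<Theta>\<close> at time \<open>t\<close>, and
  \<open>phys w t\<close> is the state at time \<open>t\<close> with the velocity as second component. \<open>incr \<tau> w\<close> is the driving
  path seen from time \<open>\<tau>\<close>.
\<close>

definition disp :: "(real \<Rightarrow> 'a) \<Rightarrow> real \<Rightarrow> real" where
  "disp w t = \<Theta> (sol w 0 t)"

definition phys :: "(real \<Rightarrow> 'a) \<Rightarrow> real \<Rightarrow> 'a \<times> 'a" where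
  "phys w t = (fst (sol w 0 t), snd (sol w 0 t) + w t)"

definition incr :: "real \<Rightarrow> (real \<Rightarrow> 'a) \<Rightarrow> real \<Rightarrow> 'a" where
  "incr \<tau> w t = w (\<tau> + t) - w \<tau>"

lemma incr_continuous: "continuous_on UNIV w \<Longrightarrow> continuous_on UNIV (incr \<tau> w)"
  unfolding incr_def
  by (rule continuous_on_diff[OF continuous_on_compose2[of UNIV w UNIV "\<lambda>t. \<tau> + t"]]) (auto intro!: continuous_intros)

lemma sol_0: "continuous_on UNIV w \<Longrightarrow> sol w x0 0 = x0"
  using sol_solves by (auto simp: solves_ode_def)

lemma disp_0: "continuous_on UNIV w \<Longrightarrow> disp w 0 = 0"
  by (simp add: disp_def sol_0 \<Theta>_simps)

lemma disp_lipschitz: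
  assumes "continuous_on UNIV w" "0 \<le> r" "r \<le> t"
  shows "\<bar>disp w t - disp w r\<bar> \<le> c / (norm e * \<alpha>) * (t - r)"
  unfolding disp_def by (rule \<Theta>_lipschitz[OF sol_solves[OF assms(1)] assms(2,3)])

lemma disp_compare:
  assumes "continuous_on UNIV w" "solves_ode (vf w) x0 x" "0 \<le> t"
  shows "\<bar>\<Theta> (x t) - \<Theta> x0 - disp w t\<bar> \<le> sqrt (V x0 / (\<Lambda> * (e \<bullet> e))) + 2 * \<kappa>"
  using displacement_compare[OF assms(2) sol_solves[OF assms(1), of 0] assms(3)]
  by (simp add: disp_def \<Theta>_simps)

lemma sol_restart:
  assumes w: "continuous_on UNIV w" and \<tau>: "0 \<le> \<tau>"
  shows "solves_ode (vf (incr \<tau> w)) (phys w \<tau>) (\<lambda>t. (fst (sol w 0 (\<tau> + t)), snd (sol w 0 (\<tau> + t)) + w \<tau>))"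
  unfolding incr_def phys_def by (rule solves_vf_restart[OF sol_solves[OF w] \<tau>])

lemma disp_step:
  assumes w: "continuous_on UNIV w" and \<tau>: "0 \<le> \<tau>" "0 \<le> t"
  shows "\<bar>disp w (\<tau> + t) - disp w \<tau> - disp (incr \<tau> w) t\<bar> \<le> sqrt (V (phys w \<tau>) / (\<Lambda> * (e \<bullet> e))) + 2 * \<kappa>"
proof -
  have "\<Theta> (a, b + r) = \<Theta> (a, b) + \<Theta> (0, r)" for a b r
    using \<Theta>_simps(1)[of "(a, b)" "(0, r)"] by simp
  then have "\<Theta> (fst (sol w 0 q), snd (sol w 0 q) + w \<tau>) = disp w q + \<Theta> (0, w \<tau>)" for q
    by (simp add: disp_def)
  then show ?thesis
    using disp_compare[OF incr_continuous[OF w] sol_restart[OF w \<tau>(1)] \<tau>(2)] by (simp add: phys_def)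
qed

text \<open>
  The displacement is almost additive over blocks of length \<open>T\<close>: at the beginning of each block the
  actual state is exchanged for rest, at the cost of its transverse energy.
\<close>

lemma disp_blocks:
  assumes w: "continuous_on UNIV w" and T: "0 \<le> T"
  shows "\<bar>disp w (real n * T) - (\<Sum>k<n. disp (incr (real k * T) w) T)\<bar>
    \<le> (\<Sum>k<n. sqrt (V (phys w (real k * T)) / (\<Lambda> * (e \<bullet> e))) + 2 * \<kappa>)"
proof (induction n)
  case 0
  then show ?case by (simp add: disp_0[OF w])
next
  case (Suc n)
  have "real (Suc n) * T = real n * T + T" by (simp add: algebra_simps)
  then show ?case using Suc disp_step[OF w, of "real n * T" T] T by simp
qed

lemma phys_0: "continuous_on UNIV w \<Longrightarrow> w 0 = 0 \<Longrightarrow> phys w 0 = 0"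
  by (simp add: phys_def sol_0 zero_prod_def)

lemma V_0: "V 0 = 0"
  by (simp add: V_def zero_prod_def Q_simps)

lemma phys_dissipation:
  "\<exists>\<gamma> C. 0 \<le> \<gamma> \<and> \<gamma> < 1 \<and> 0 < C \<and>
     (\<forall>w \<tau> S. continuous_on UNIV w \<longrightarrow> 0 \<le> \<tau> \<longrightarrow> (\<forall>t\<in>{0..1}. norm (w (\<tau> + t) - w \<tau>) \<le> S) \<longrightarrow>
        V (phys w (\<tau> + 1)) \<le> \<gamma> * V (phys w \<tau>) + C * (1 + S\<^sup>2))"
proof -
  obtain \<gamma> C where *: "0 \<le> \<gamma>" "\<gamma> < 1" "0 < C"
    "\<And>w x0 x S. solves_ode (vf w) x0 x \<Longrightarrow> (\<forall>t\<in>{0..1}. norm (w t) \<le> S) \<Longrightarrow>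
        V (fst (x 1), snd (x 1) + w 1) \<le> \<gamma> * V x0 + C * (1 + S\<^sup>2)"
    using dissipation by metis
  have "V (phys w (\<tau> + 1)) \<le> \<gamma> * V (phys w \<tau>) + C * (1 + S\<^sup>2)"
    if "continuous_on UNIV w" "0 \<le> \<tau>" "\<forall>t\<in>{0..1}. norm (w (\<tau> + t) - w \<tau>) \<le> S" for w \<tau> S
    using *(4)[OF sol_restart[OF that(1,2)], of S] that(3) by (simp add: incr_def phys_def)
  with *(1-3) show ?thesis by blast
qed

lemma disp_euler:
  assumes w: "continuous_on UNIV w" and T: "0 < T"
  shows "(\<lambda>m. \<Theta> (euler (vf w) (T / real m) 0 m)) \<longlonglongrightarrow> disp w T"
proof -
  obtain C where C: "C > 0" "\<And>t a b. norm (vf w t a - vf w t b) \<le> C * norm (a - b)"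
    using vf_lipschitz by blast
  have x: "solves_ode (vf w) 0 (sol w 0)" by (rule sol_solves[OF w])
  have "(\<lambda>m. euler (vf w) (T / real m) 0 m) \<longlonglongrightarrow> sol w 0 T"
    using C by (intro euler_converges[OF x _ _ _ T, of C] vf_continuous)
      (auto intro: continuous_on_subset[OF w] continuous_on_subset[OF solves_ode_continuous[OF x]])
  then have "(\<lambda>m. avg (fst (euler (vf w) (T / real m) 0 m)) + avg (snd (euler (vf w) (T / real m) 0 m)) / \<alpha>)
      \<longlonglongrightarrow> avg (fst (sol w 0 T)) + avg (snd (sol w 0 T)) / \<alpha>"
    using \<alpha> by (intro tendsto_intros bounded_linear.tendsto[OF bounded_linear_avg]) auto
  then show ?thesis by (simp add: disp_def \<Theta>_def split_beta)
qed

end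

section \<open>The spectral gap\<close>

lemma det_eq_0_of_kernel:
  fixes M :: "real ^ 'i ^ 'i::finite"
  assumes "M *v x = 0" "x \<noteq> 0"
  shows "det M = 0"
proof (rule ccontr)
  assume "det M \<noteq> 0"
  then obtain B where "B ** M = mat 1" using invertible_det_nz invertible_def by metis
  then have "x = B *v (M *v x)" by (simp add: matrix_vector_mul_assoc)
  with assms show False by simp
qed

text \<open>
  The Rayleigh quotient attains its minimum over the complement of a kernel vector \<open>e\<close> at an
  eigenvector.
\<close>

lemma rayleigh_minimizer:
  fixes A :: "real ^ 'i ^ 'i::finite"
  assumes sym: "\<And>x y. x \<bullet> (A *v y) = (A *v x) \<bullet> y" and one: "A *v e = 0"
    and ne: "\<exists>x. x \<noteq> 0 \<and> x \<bullet> e = 0"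
  obtains m x0 where "x0 \<noteq> 0" "x0 \<bullet> e = 0" "A *v x0 = m *\<^sub>R x0"
    "\<And>x. x \<bullet> e = 0 \<Longrightarrow> m * (norm x)\<^sup>2 \<le> x \<bullet> (A *v x)"
proof -
  define S where "S = sphere 0 1 \<inter> {x. x \<bullet> e = 0}"
  have cS: "compact S"
    unfolding S_def by (intro compact_Int_closed compact_sphere closed_Collect_eq continuous_intros)
  obtain x where x: "x \<noteq> 0" "x \<bullet> e = 0" using ne by blast
  then have "x /\<^sub>R norm x \<in> S" by (simp add: S_def)
  then have "S \<noteq> {}" by blast
  moreover have "continuous_on S (\<lambda>x. x \<bullet> (A *v x))"
    by (intro continuous_intros linear_continuous_on matrix_vector_mul_bounded_linear)
  ultimately obtain x0 where x0: "x0 \<in> S" "\<And>x. x \<in> S \<Longrightarrow> x0 \<bullet> (A *v x0) \<le> x \<bullet> (A *v x)"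
    using continuous_attains_inf[OF cS] by blast
  define m where "m = x0 \<bullet> (A *v x0)"
  have x0': "norm x0 = 1" "x0 \<bullet> e = 0" using x0(1) by (auto simp: S_def)
  have low: "m * (norm x)\<^sup>2 \<le> x \<bullet> (A *v x)" if "x \<bullet> e = 0" for x
  proof (cases "x = 0")
    case False
    then have "x /\<^sub>R norm x \<in> S" using that by (simp add: S_def)
    from x0(2)[OF this] have "m \<le> (x \<bullet> (A *v x)) / (norm x)\<^sup>2"
      by (simp add: m_def matrix_vector_mult_scaleR power2_eq_square divide_inverse mult_ac)
    then show ?thesis using False by (simp add: field_simps)
  qed simp
  define z where "z = A *v x0 - m *\<^sub>R x0"
  have ze: "z \<bullet> e = 0"
    using sym[of e x0] one x0' by (simp add: z_def inner_simps inner_commute)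
  have "z \<bullet> z = 0"
  proof (rule ccontr)
    assume nz: "z \<bullet> z \<noteq> 0"
    then have zz: "z \<bullet> z > 0" by simp
    define q where "q = z \<bullet> (A *v z) - m * (z \<bullet> z)"
    have lin: "A *v (x0 + t *\<^sub>R z) = A *v x0 + t *\<^sub>R (A *v z)" for t
      by (simp add: matrix_vector_right_distrib matrix_vector_mult_scaleR)
    have zx: "z \<bullet> (A *v x0) - m * (z \<bullet> x0) = z \<bullet> z"
      by (simp add: z_def inner_simps)
    have pos: "0 \<le> 2 * t * (z \<bullet> z) + t\<^sup>2 * q" for t
    proof -
      have "0 \<le> (x0 + t *\<^sub>R z) \<bullet> (A *v (x0 + t *\<^sub>R z)) - m * (norm (x0 + t *\<^sub>R z))\<^sup>2"
        using low[of "x0 + t *\<^sub>R z"] x0' ze by (simp add: inner_simps)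
      also have "\<dots> = (x0 \<bullet> (A *v x0) - m * (x0 \<bullet> x0)) + 2 * t * (z \<bullet> (A *v x0) - m * (z \<bullet> x0)) + t\<^sup>2 * q"
        using sym[of x0 z] unfolding lin power2_norm_eq_inner
        by (simp add: inner_simps q_def algebra_simps power2_eq_square inner_commute)
      also have "x0 \<bullet> (A *v x0) - m * (x0 \<bullet> x0) = 0"
        using x0' by (simp add: m_def flip: power2_norm_eq_inner)
      finally show ?thesis unfolding zx by simp
    qed
    \<comment> \<open>A small step against the residual \<open>z\<close> would lower the Rayleigh quotient.\<close>
    define Z where "Z = z \<bullet> z"
    define d where "d = \<bar>q\<bar> + 1"
    have Z: "0 < Z" and d: "0 < d" "q \<le> d" using zz by (auto simp: Z_def d_def)
    have "0 \<le> 2 * (- Z / d) * Z + (- Z / d)\<^sup>2 * q"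
      using pos[of "- Z / d"] by (simp add: Z_def)
    also have "\<dots> \<le> 2 * (- Z / d) * Z + (- Z / d)\<^sup>2 * d"
      using d by (intro add_left_mono mult_left_mono) auto
    also have "\<dots> = - (Z\<^sup>2 / d)" using d by (simp add: field_simps power2_eq_square)
    also have "\<dots> < 0" using Z d by simp
    finally show False by simp
  qed
  then have "A *v x0 = m *\<^sub>R x0" by (simp add: z_def)
  then show ?thesis using that[of x0 m] x0' low by force
qed

lemma mat_mult_vec: "mat x *v u = (x :: real) *\<^sub>R (u :: real ^ 'i::finite)"
  by (simp add: vec_eq_iff mat_def matrix_vector_mult_def if_distrib[of "\<lambda>x. x * _"] cong: if_cong)

lemma det_mat_minus_column:
  "det (mat 1 - r *\<^sub>R (\<chi> i j. if j = k then 1 else 0) :: real ^ 'i ^ 'i::finite) = 1 - r"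
proof -
  define X :: "real ^ 'i" where "X = (\<chi> i. (if i = k then 1 else 0) - r)"
  have "det ((\<chi> i j. if j = k then X $ i else (mat 1 :: real ^ 'i ^ 'i) $ i $ j) :: real ^ 'i ^ 'i) = 1 - r"
    using cramer_lemma[of k "mat 1 :: real ^ 'i ^ 'i" X] unfolding matrix_vector_mul_lid by (simp add: X_def)
  also have "((\<chi> i j. if j = k then X $ i else (mat 1 :: real ^ 'i ^ 'i) $ i $ j) :: real ^ 'i ^ 'i)
      = mat 1 - r *\<^sub>R (\<chi> i j. if j = k then 1 else 0)"
    by (auto simp: vec_eq_iff mat_def X_def)
  finally show ?thesis .
qed

text \<open>
  A simple zero of the characteristic polynomial leaves no room for a kernel vector orthogonal to the
  constant vector \<open>1\<close>. Let \<open>E\<close> be the matrix with a single nonzero column, equal to \<open>1\<close>. As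
  \<open>A E = 0\<close>, \<open>x - A - E = (x - A) (1 - E / x)\<close>, whence \<open>det (x - A - E) = (x - 1) p x\<close> and, by
  continuity, \<open>det (- A - E) = - p 0 \<noteq> 0\<close>. But a two-dimensional kernel of \<open>A\<close> contains a nonzero
  vector with vanishing \<open>k\<close>-th component, which \<open>A + E\<close> annihilates.
\<close>

lemma kernel_of_simple_zero:
  fixes A :: "real ^ 'i ^ 'i::finite"
  assumes eig: "\<And>x. det (mat x - A) = x * p x" and p: "continuous_on UNIV p" "p 0 \<noteq> 0"
    and one: "A *v (\<chi> j. 1) = 0" and x0: "A *v x0 = 0" "x0 \<bullet> (\<chi> j. 1) = 0"
  shows "x0 = 0"
proof (rule ccontr)
  assume ne: "x0 \<noteq> 0"
  fix k :: 'i
  define E :: "real ^ 'i ^ 'i" where "E = (\<chi> i j. if j = k then 1 else 0)"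
  have Ev: "E *v v = (\<chi> i. v $ k)" for v
    by (simp add: E_def matrix_vector_mult_def vec_eq_iff if_distrib[of "\<lambda>x. x * _"] cong: if_cong)
  have det_eq: "det (mat x - A - E) = (x - 1) * p x" if x: "x \<noteq> 0" for x
  proof -
    have "(mat x - A) ** (mat 1 - (1 / x) *\<^sub>R E) = mat x - A - E"
      unfolding matrix_eq matrix_vector_mul_assoc[symmetric]
    proof
      fix v :: "real ^ 'i"
      have E1: "E *v v = (v $ k) *\<^sub>R (\<chi> j. 1)" by (simp add: Ev vec_eq_iff)
      have mx: "mat x *v u = x *\<^sub>R u" for u :: "real ^ 'i" by (rule mat_mult_vec)
      have sE: "((1 / x) *\<^sub>R E) *v v = (v $ k / x) *\<^sub>R (\<chi> j. 1)"
        using E1 by (simp add: scaleR_matrix_vector_assoc[symmetric])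
      show "(mat x - A) *v ((mat 1 - (1 / x) *\<^sub>R E) *v v) = (mat x - A - E) *v v"
        unfolding matrix_vector_mult_diff_rdistrib mx sE E1 matrix_vector_mult_diff_distrib matrix_vector_mult_scaleR one
        using x by (simp add: algebra_simps)
    qed
    then have "det (mat x - A - E) = det (mat x - A) * det (mat 1 - (1 / x) *\<^sub>R E)"
      by (metis det_mul)
    also have "\<dots> = x * p x * (1 - 1 / x)"
      unfolding eig E_def det_mat_minus_column ..
    also have "\<dots> = (x - 1) * p x" using x by (simp add: field_simps)
    finally show ?thesis .
  qed
  have "continuous_on UNIV (\<lambda>x. det (mat x - A - E))"
  proof -
    have c: "continuous_on UNIV (\<lambda>x. (mat x :: real ^ 'i ^ 'i) $ i $ j)" for i j
      by (cases "i = j") (auto simp: mat_def)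
    then show ?thesis
      unfolding det_def vector_minus_component
      by (intro continuous_on_sum continuous_on_mult continuous_on_const continuous_on_prod continuous_on_diff c)
  qed
  then have "((\<lambda>x. det (mat x - A - E)) \<longlongrightarrow> det (mat 0 - A - E)) (at 0)"
    unfolding continuous_on_def by blast
  then have "((\<lambda>x. (x - 1) * p x) \<longlongrightarrow> det (mat 0 - A - E)) (at 0)"
    by (rule Lim_transform_eventually) (auto simp: eventually_at_filter det_eq)
  moreover have "((\<lambda>x. (x - 1) * p x) \<longlongrightarrow> (0 - 1) * p 0) (at 0)"
    using p(1) by (intro tendsto_intros) (simp add: continuous_on_def)
  ultimately have "det (mat 0 - A - E) = (0 - 1) * p 0"
    using tendsto_unique[OF trivial_limit_at] by blast
  then have nz: "det (mat 0 - A - E) \<noteq> 0" using p(2) by simp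
  define y where "y = x0 - (x0 $ k) *\<^sub>R (\<chi> j. 1)"
  have "(mat 0 - A - E) *v y = 0"
  proof -
    have "A *v y = 0" using one x0 by (simp add: y_def matrix_vector_mult_diff_distrib matrix_vector_mult_scaleR)
    moreover have "E *v y = 0" unfolding Ev by (simp add: y_def vec_eq_iff)
    moreover have "mat 0 *v y = 0" by (simp add: vec_eq_iff mat_def matrix_vector_mult_def)
    ultimately show ?thesis by (simp only: matrix_vector_mult_diff_rdistrib diff_self)
  qed
  moreover have "y \<noteq> 0"
  proof
    assume "y = 0"
    then have x0k: "x0 = (x0 $ k) *\<^sub>R (\<chi> j. 1)" by (simp add: y_def)
    then have "x0 $ k * ((\<chi> j. 1) \<bullet> ((\<chi> j. 1) :: real ^ 'i)) = 0" using x0(2) by (metis inner_scaleR_left)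
    then have "x0 $ k = 0" by (simp add: inner_vec_def)
    with x0k ne show False by simp
  qed
  ultimately show False
    using nz det_eq_0_of_kernel by blast
qed

lemma spectral_gap:
  fixes A :: "real ^ 'i ^ 'i::finite"
  assumes sym: "transpose A = A" and one: "A *v (\<chi> j. 1) = 0"
    and eig: "\<And>x. det (mat x - A) = (\<Prod>k<CARD('i). x - lam k)"
    and lam: "lam 0 = 0" "\<And>k. 1 \<le> k \<Longrightarrow> k < CARD('i) \<Longrightarrow> l \<le> lam k" "0 < l"
    and x: "x \<bullet> (\<chi> j. 1) = 0"
  shows "l * (norm x)\<^sup>2 \<le> x \<bullet> (A *v x)"
proof (cases "x = 0")
  case False
  have sym': "x \<bullet> (A *v y) = (A *v x) \<bullet> y" for x y
    using sym by (metis dot_lmul_matrix vector_transpose_matrix)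
  obtain m x0 where x0: "x0 \<noteq> 0" "x0 \<bullet> (\<chi> j. 1) = 0" "A *v x0 = m *\<^sub>R x0"
    "\<And>x. x \<bullet> (\<chi> j. 1) = 0 \<Longrightarrow> m * (norm x)\<^sup>2 \<le> x \<bullet> (A *v x)"
    using rayleigh_minimizer[OF sym' one] False x by blast
  have "(mat m - A) *v x0 = 0"
  proof -
    have "mat m *v x0 = m *\<^sub>R x0" by (rule mat_mult_vec)
    then show ?thesis using x0 by (simp add: matrix_vector_mult_diff_rdistrib)
  qed
  then have "det (mat m - A) = 0"
    by (rule det_eq_0_of_kernel) (rule x0(1))
  then obtain k where k: "k < CARD('i)" "m = lam k"
    unfolding eig by (auto simp: prod_zero_iff)
  have split: "{..<CARD('i)} = insert 0 {1..<CARD('i)}" by auto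
  have "m \<noteq> 0"
  proof
    assume "m = 0"
    have "x0 = 0"
    proof (rule kernel_of_simple_zero[of A "\<lambda>x. \<Prod>k\<in>{1..<CARD('i)}. x - lam k"])
      show "det (mat x - A) = x * (\<Prod>k\<in>{1..<CARD('i)}. x - lam k)" for x
        unfolding eig split using lam(1) by simp
      show "(\<Prod>k\<in>{1..<CARD('i)}. 0 - lam k) \<noteq> 0"
        using lam(2,3) by (force simp: prod_zero_iff)
    qed (use x0 one \<open>m = 0\<close> in \<open>auto intro!: continuous_intros\<close>)
    with x0 show False by simp
  qed
  then have "k \<noteq> 0" using k lam(1) by metis
  then have "l \<le> m" using lam(2)[of k] k by simp
  then have "l * (norm x)\<^sup>2 \<le> m * (norm x)\<^sup>2" by (intro mult_right_mono) auto
  then show ?thesis using x0(4)[OF x] by simp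
qed simp

section \<open>Growth of paths with Brownian fourth moments\<close>

text \<open>
  A weighted sum of the fourth powers of all dyadic increments of \<open>x\<close> over \<open>{0..1}\<close>. With weights
  \<open>1 / r\<^sup>4\<^sup>m\<close>, a finite value bounds the increments on level \<open>m\<close> by a multiple of \<open>r\<^sup>m\<close>, which is
  summable as \<open>r < 1\<close>; and for Brownian motion the level \<open>m\<close> contributes \<open>3 / (2 r\<^sup>4)\<^sup>m\<close> in the mean,
  which is summable as \<open>r\<^sup>4 > 1 / 2\<close>. The value \<open>r = 9 / 10\<close> satisfies both conditions.
\<close>

definition dyadic_sum :: "(real \<Rightarrow> real) \<Rightarrow> ennreal" where
  "dyadic_sum x = (\<Sum>m. \<Sum>k<2 ^ m. ennreal ((x (real (Suc k) / 2 ^ m) - x (real k / 2 ^ m)) ^ 4 / (9/10) ^ (4 * m)))"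

lemma dyadic_increment_bound:
  assumes z: "dyadic_sum x \<le> ennreal (q ^ 4)" and q: "0 \<le> q" and k: "k < 2 ^ m"
  shows "\<bar>x (real (Suc k) / 2 ^ m) - x (real k / 2 ^ m)\<bar> \<le> q * (9/10) ^ m"
proof -
  define d where "d = \<bar>x (real (Suc k) / 2 ^ m) - x (real k / 2 ^ m)\<bar>"
  define f where "f = (\<lambda>m k. ennreal ((x (real (Suc k) / 2 ^ m) - x (real k / 2 ^ m)) ^ 4 / (9/10) ^ (4 * m)))"
  have "ennreal (d ^ 4 / (9/10) ^ (4 * m)) = f m k" by (simp add: d_def f_def)
  also have "\<dots> \<le> (\<Sum>k<2 ^ m. f m k)"
    using k by (intro member_le_sum) auto
  also have "\<dots> \<le> (\<Sum>m. \<Sum>k<2 ^ m. f m k)"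
    using sum_le_suminf[of "\<lambda>m. \<Sum>k<2 ^ m. f m k" "{m}"] by simp
  also have "\<dots> \<le> ennreal (q ^ 4)" using z by (simp add: dyadic_sum_def f_def)
  finally have "d ^ 4 / (9/10) ^ (4 * m) \<le> q ^ 4" using q by simp
  then have "d ^ 4 \<le> (q * (9/10) ^ m) ^ 4"
    by (simp add: power_mult_distrib power_mult[symmetric] mult.commute field_simps)
  then have "d \<le> q * (9/10) ^ m" by (rule power_le_imp_le_base[of _ 3, simplified]) (use q in auto)
  then show ?thesis by (simp add: d_def)
qed

lemma dyadic_grid_bound:
  assumes z: "dyadic_sum x \<le> ennreal (q ^ 4)" and q: "0 \<le> q" and k: "k \<le> 2 ^ M"
  shows "\<bar>x (real k / 2 ^ M) - x 0\<bar> \<le> q * (\<Sum>m\<le>M. (9/10) ^ m)"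
  using k
proof (induction M arbitrary: k)
  case 0
  then consider "k = 0" | "k = 1" by fastforce
  then show ?case
    using dyadic_increment_bound[OF z q, of 0 0] q by cases auto
next
  case (Suc M)
  define l where "l = k div 2"
  have l: "l \<le> 2 ^ M" using Suc.prems by (simp add: l_def)
  have pos: "0 \<le> q * (9/10) ^ Suc M" using q by simp
  have l_eq: "real l / 2 ^ M = real (2 * l) / 2 ^ Suc M" by simp
  have "\<bar>x (real k / 2 ^ Suc M) - x (real l / 2 ^ M)\<bar> \<le> q * (9/10) ^ Suc M"
  proof (cases "even k")
    case True
    then have "k = 2 * l" by (simp add: l_def)
    then show ?thesis using pos l_eq by simp
  next
    case False
    then have k2: "k = Suc (2 * l)" by (simp add: l_def)
    then have "2 * l < 2 ^ Suc M" using Suc.prems by simp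
    from dyadic_increment_bound[OF z q this] show ?thesis unfolding l_eq k2 .
  qed
  moreover have "\<bar>x (real l / 2 ^ M) - x 0\<bar> \<le> q * (\<Sum>m\<le>M. (9/10) ^ m)" by (rule Suc.IH[OF l])
  ultimately show ?case unfolding sum.atMost_Suc distrib_left by linarith
qed

lemma dyadic_sum_bounds_excursion:
  assumes x: "continuous_on {0..1} x" and t: "t \<in> {0..1}"
  shows "ennreal ((x t - x 0) ^ 4) \<le> 10 ^ 4 * dyadic_sum x"
proof (cases "dyadic_sum x")
  case top
  then show ?thesis by (simp add: ennreal_mult_top)
next
  case (real z)
  define q where "q = root 4 z"
  have q: "0 \<le> q" "q ^ 4 = z" using real by (auto simp: q_def)
  have grid: "\<bar>x (real k / 2 ^ M) - x 0\<bar> \<le> 10 * q" if "k \<le> 2 ^ M" for k M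
  proof -
    have "(\<Sum>m\<le>M. (9/10 :: real) ^ m) \<le> 10"
      by (subst sum_gp0) simp
    then have "q * (\<Sum>m\<le>M. (9/10) ^ m) \<le> q * 10" using q by (intro mult_left_mono) auto
    then show ?thesis using dyadic_grid_bound[of x q k M] real q that by simp
  qed
  define s where "s = (\<lambda>M::nat. real (nat \<lfloor>t * 2 ^ M\<rfloor>) / 2 ^ M)"
  have nf: "real (nat \<lfloor>t * 2 ^ M\<rfloor>) = of_int \<lfloor>t * 2 ^ M\<rfloor>" for M using t by simp
  have s_le: "s M \<le> t" "t - 1 / 2 ^ M \<le> s M" for M
  proof -
    show "s M \<le> t" unfolding s_def nf by (simp add: divide_le_eq)
    have "t - 1 / 2 ^ M = (t * 2 ^ M - 1) / 2 ^ M" by (simp add: field_simps)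
    also have "\<dots> \<le> of_int \<lfloor>t * 2 ^ M\<rfloor> / 2 ^ M" by (intro divide_right_mono) (linarith, simp)
    finally show "t - 1 / 2 ^ M \<le> s M" unfolding s_def nf .
  qed
  have "(\<lambda>M. (1/2 :: real) ^ M) \<longlonglongrightarrow> 0" by (rule LIMSEQ_realpow_zero) auto
  from tendsto_diff[OF tendsto_const[of t] this]
  have "(\<lambda>M. t - 1 / 2 ^ M) \<longlonglongrightarrow> t" by (simp add: power_one_over)
  then have st: "s \<longlonglongrightarrow> t"
    using tendsto_sandwich[of "\<lambda>M. t - 1 / 2 ^ M" s sequentially "\<lambda>_. t" t] s_le by simp
  have s01: "s M \<in> {0..1}" for M 
  proof -
    have "0 \<le> s M" by (simp add: s_def)
    then show ?thesis using s_le(1)[of M] t by simp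
  qed
  have sk: "nat \<lfloor>t * 2 ^ M\<rfloor> \<le> 2 ^ M" for M
  proof -
    have "real (nat \<lfloor>t * 2 ^ M\<rfloor>) \<le> 2 ^ M"
      using s01[of M] by (simp add: s_def field_simps)
    then show ?thesis by (metis of_nat_le_iff of_nat_numeral of_nat_power)
  qed
  have "(\<lambda>M. x (s M)) \<longlonglongrightarrow> x t"
    using x t st s01 unfolding continuous_on_sequentially by (auto simp: o_def)
  then have "(\<lambda>M. \<bar>x (s M) - x 0\<bar>) \<longlonglongrightarrow> \<bar>x t - x 0\<bar>" by (intro tendsto_intros)
  then have "\<bar>x t - x 0\<bar> \<le> 10 * q"
    by (rule LIMSEQ_le_const2) (use grid[OF sk] in \<open>auto simp: s_def\<close>)
  then have "\<bar>x t - x 0\<bar> ^ 4 \<le> (10 * q) ^ 4" by (intro power_mono) auto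
  then have "(x t - x 0) ^ 4 \<le> 10 ^ 4 * z" using q by (simp add: power_mult_distrib)
  then have "ennreal ((x t - x 0) ^ 4) \<le> ennreal (10 ^ 4 * z)" by (rule ennreal_leI)
  then show ?thesis using real by (simp add: ennreal_mult)
qed

lemma ennreal_mult_eq:
  "a * b = c * d \<Longrightarrow> 0 \<le> a \<Longrightarrow> 0 \<le> b \<Longrightarrow> 0 \<le> c \<Longrightarrow> 0 \<le> d \<Longrightarrow> ennreal a * ennreal b = ennreal c * ennreal d"
  by (simp flip: ennreal_mult)

lemma AE_tendsto_0_of_summable_integrals:
  fixes f :: "nat \<Rightarrow> 'b \<Rightarrow> ennreal"
  assumes [measurable]: "\<And>n. f n \<in> borel_measurable M"
    and le: "\<And>n. (\<integral>\<^sup>+ x. f n x \<partial>M) \<le> ennreal (c n)" and c: "summable c" "\<And>n. 0 \<le> c n"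
  shows "AE x in M. (\<lambda>n. f n x) \<longlonglongrightarrow> 0"
proof -
  have "(\<integral>\<^sup>+ x. (\<Sum>n. f n x) \<partial>M) = (\<Sum>n. \<integral>\<^sup>+ x. f n x \<partial>M)"
    by (rule nn_integral_suminf) simp
  also have "\<dots> \<le> (\<Sum>n. ennreal (c n))" by (intro suminf_le le) auto
  also have "\<dots> < \<top>" using c by (simp add: suminf_ennreal2)
  finally have "AE x in M. (\<Sum>n. f n x) \<noteq> \<infinity>"
    by (intro nn_integral_PInf_AE) (auto simp: less_top)
  then show ?thesis
  proof eventually_elim
    case (elim x)
    have fin: "f n x \<noteq> \<top>" for n
      using elim sum_le_suminf[of "\<lambda>n. f n x" "{n}"] by (auto simp: top_unique)
    define g where "g = (\<lambda>n. enn2real (f n x))"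
    have fg: "f n x = ennreal (g n)" for n using fin by (simp add: g_def less_top)
    have "(\<Sum>n. ennreal (g n)) \<noteq> \<top>" using elim by (simp add: fg[symmetric])
    then have "summable g" by (intro summable_suminf_not_top) (auto simp: g_def)
    then have "g \<longlonglongrightarrow> 0" by (rule summable_LIMSEQ_zero)
    then have "(\<lambda>n. ennreal (g n)) \<longlonglongrightarrow> ennreal 0" by (rule tendsto_ennrealI)
    then show ?case by (simp add: fg)
  qed
qed

text \<open>
  The only features of Brownian motion that its growth rate requires. They are preserved by time
  reversal.
\<close>

locale brownian_moments = prob_space M for M :: "'b measure" +
  fixes X :: "real \<Rightarrow> 'b \<Rightarrow> real"
  assumes meas[measurable]: "\<And>t. X t \<in> borel_measurable M"
    and moment: "\<And>s t. (\<integral>\<^sup>+ \<omega>. ennreal ((X t \<omega> - X s \<omega>) ^ 4) \<partial>M) \<le> ennreal (3 * (t - s)\<^sup>2)"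
    and cont: "\<And>\<omega>. \<omega> \<in> space M \<Longrightarrow> continuous_on UNIV (\<lambda>t. X t \<omega>)"
    and start: "\<And>\<omega>. \<omega> \<in> space M \<Longrightarrow> X 0 \<omega> = 0"
begin

lemma dyadic_sum_measurable[measurable]: "(\<lambda>\<omega>. dyadic_sum (\<lambda>r. X (\<tau> + r) \<omega>)) \<in> borel_measurable M"
  unfolding dyadic_sum_def by measurable

lemma dyadic_sum_integral: "(\<integral>\<^sup>+ \<omega>. dyadic_sum (\<lambda>r. X (\<tau> + r) \<omega>) \<partial>M) \<le> 13"
proof -
  let ?D = "\<lambda>m k \<omega>. X (\<tau> + real (Suc k) / 2 ^ m) \<omega> - X (\<tau> + real k / 2 ^ m) \<omega>"
  \<comment> \<open>The ratio \<open>1 / (2 r\<^sup>4)\<close> of the geometric series over the levels.\<close>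
  define a where "a = (10000/13122 :: real)"
  have a: "0 \<le> a" "a < 1" by (auto simp: a_def)
  have tm: "(\<integral>\<^sup>+ \<omega>. ennreal ((?D m k \<omega>) ^ 4 / (9/10) ^ (4 * m)) \<partial>M)
      \<le> ennreal (3 / (4 ^ m * (9/10) ^ (4 * m)))" for m k :: nat
  proof -
    have e: "\<tau> + real (Suc k) / 2 ^ m - (\<tau> + real k / 2 ^ m) = 1 / 2 ^ m" by (simp add: field_simps)
    have "(\<integral>\<^sup>+ \<omega>. ennreal ((?D m k \<omega>) ^ 4 / (9/10) ^ (4 * m)) \<partial>M)
      = (\<integral>\<^sup>+ \<omega>. ennreal ((?D m k \<omega>) ^ 4) * ennreal (1 / (9/10) ^ (4 * m)) \<partial>M)"
      by (intro nn_integral_cong) (simp add: ennreal_mult[symmetric])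
    also have "\<dots> = (\<integral>\<^sup>+ \<omega>. ennreal ((?D m k \<omega>) ^ 4) \<partial>M) * ennreal (1 / (9/10) ^ (4 * m))"
      by (rule nn_integral_multc) simp
    also have "\<dots> \<le> ennreal (3 * (1 / 2 ^ m)\<^sup>2) * ennreal (1 / (9/10) ^ (4 * m))"
      using moment[of "\<tau> + real (Suc k) / 2 ^ m" "\<tau> + real k / 2 ^ m"] unfolding e by (intro mult_right_mono) auto
    also have "\<dots> = ennreal (3 / (4 ^ m * (9/10) ^ (4 * m)))"
      by (simp add: ennreal_mult[symmetric] power_divide power_mult[symmetric] mult.commute power2_eq_square flip: power_mult_distrib)
    finally show ?thesis .
  qed
  have "(\<integral>\<^sup>+ \<omega>. dyadic_sum (\<lambda>r. X (\<tau> + r) \<omega>) \<partial>M) =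
    (\<Sum>m. \<Sum>k<2 ^ m. \<integral>\<^sup>+ \<omega>. ennreal ((?D m k \<omega>) ^ 4 / (9/10) ^ (4 * m)) \<partial>M)"
    unfolding dyadic_sum_def by (subst nn_integral_suminf, simp, subst nn_integral_sum) auto
  also have "\<dots> \<le> (\<Sum>m. \<Sum>k<(2::nat) ^ m. ennreal (3 / (4 ^ m * (9/10) ^ (4 * m))))"
    by (intro suminf_le sum_mono tm) auto
  also have "\<dots> = (\<Sum>m. ennreal (3 * a ^ m))"
  proof (rule suminf_cong)
    fix m
    have "(\<Sum>k<(2::nat) ^ m. ennreal (3 / (4 ^ m * (9/10) ^ (4 * m)))) = ennreal (2 ^ m * (3 / (4 ^ m * (9/10) ^ (4 * m))))"
    proof -
      define Y :: real where "Y = 3 / (4 ^ m * (9/10) ^ (4 * m))"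
      have "0 \<le> Y" by (simp add: Y_def)
      then show ?thesis unfolding Y_def[symmetric]
        by (simp add: ennreal_mult ennreal_of_nat_eq_real_of_nat)
    qed
    also have "2 ^ m * (3 / (4 ^ m * (9/10) ^ (4 * m))) = 3 * (2 / (4 * (9/10 :: real) ^ 4)) ^ m"
    proof -
      define Y :: real where "Y = 4 * (9/10) ^ 4"
      have "4 ^ m * (9/10 :: real) ^ (4 * m) = Y ^ m"
        unfolding Y_def power_mult power_mult_distrib ..
      then show ?thesis unfolding Y_def[symmetric] by (simp add: power_divide)
    qed
    also have "2 / (4 * (9/10 :: real) ^ 4) = a" by (simp add: a_def power4_eq_xxxx)
    finally show "(\<Sum>k<(2::nat) ^ m. ennreal (3 / (4 ^ m * (9/10) ^ (4 * m)))) = ennreal (3 * a ^ m)" .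
  qed
  also have "\<dots> = ennreal (3 * (1 / (1 - a)))"
  proof (rule suminf_ennreal_eq)
    show "0 \<le> 3 * a ^ i" for i using a by simp
    show "(\<lambda>i. 3 * a ^ i) sums (3 * (1 / (1 - a)))"
      by (intro sums_mult geometric_sums) (use a in auto)
  qed
  also have "\<dots> \<le> ennreal 13" by (intro ennreal_leI) (simp add: a_def)
  finally show ?thesis by simp
qed

lemma root_abs_power_even: "root 4 (x ^ 4) = \<bar>x\<bar>"
  using real_root_power_cancel[of 4 "\<bar>x\<bar>"] by simp

theorem sublinear_growth: "AE \<omega> in M. ((\<lambda>t. X t \<omega> / t) \<longlongrightarrow> 0) at_top"
proof -
  have s: "summable (\<lambda>n. 13 * (1 / real (Suc n) ^ 2))"
    using summable_Suc_iff[of "\<lambda>n. inverse (real n ^ 2)"] inverse_power_summable[of 2, where 'a = real]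
    by (intro summable_mult) (simp add: inverse_eq_divide)
  have s1: "ennreal (1 / real (Suc n) ^ 2) * ennreal b \<le> ennreal (13 * (1 / real (Suc n) ^ 2))" if "b \<le> 13" "0 \<le> b" for n b
    using that by (auto simp: ennreal_mult[symmetric] field_simps intro!: ennreal_leI)
  have A: "AE \<omega> in M. (\<lambda>n. ennreal ((X (real (Suc n)) \<omega> / real (Suc n)) ^ 4)) \<longlonglongrightarrow> 0"
  proof (rule AE_tendsto_0_of_summable_integrals[OF _ _ s])
    fix n
    have "(\<integral>\<^sup>+ \<omega>. ennreal ((X (real (Suc n)) \<omega> / real (Suc n)) ^ 4) \<partial>M)
      = (\<integral>\<^sup>+ \<omega>. ennreal (1 / real (Suc n) ^ 4) * ennreal ((X (real (Suc n)) \<omega> - X 0 \<omega>) ^ 4) \<partial>M)"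
      by (intro nn_integral_cong) (simp add: start power_divide ennreal_mult[symmetric])
    also have "\<dots> = ennreal (1 / real (Suc n) ^ 4) * (\<integral>\<^sup>+ \<omega>. ennreal ((X (real (Suc n)) \<omega> - X 0 \<omega>) ^ 4) \<partial>M)"
      by (rule nn_integral_cmult) simp
    also have "\<dots> \<le> ennreal (1 / real (Suc n) ^ 4) * ennreal (3 * (real (Suc n) - 0)\<^sup>2)"
      by (intro mult_left_mono moment) auto
    also have "\<dots> = ennreal (1 / real (Suc n) ^ 2) * ennreal 3"
      by (rule ennreal_mult_eq) (auto simp: field_simps power2_eq_square power4_eq_xxxx simp del: of_nat_Suc)
    also have "\<dots> \<le> ennreal (13 * (1 / real (Suc n) ^ 2))" by (rule s1) auto
    finally show "(\<integral>\<^sup>+ \<omega>. ennreal ((X (real (Suc n)) \<omega> / real (Suc n)) ^ 4) \<partial>M) \<le> ennreal (13 * (1 / real (Suc n) ^ 2))" .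
  qed auto
  have B: "AE \<omega> in M. (\<lambda>n. ennreal (1 / real (Suc n) ^ 2) * dyadic_sum (\<lambda>r. X (real (Suc n) + r) \<omega>)) \<longlonglongrightarrow> 0"
  proof (rule AE_tendsto_0_of_summable_integrals[OF _ _ s])
    fix n
    have "(\<integral>\<^sup>+ \<omega>. ennreal (1 / real (Suc n) ^ 2) * dyadic_sum (\<lambda>r. X (real (Suc n) + r) \<omega>) \<partial>M)
      = ennreal (1 / real (Suc n) ^ 2) * (\<integral>\<^sup>+ \<omega>. dyadic_sum (\<lambda>r. X (real (Suc n) + r) \<omega>) \<partial>M)"
      by (rule nn_integral_cmult) simp
    also have "\<dots> \<le> ennreal (1 / real (Suc n) ^ 2) * ennreal 13"
      using dyadic_sum_integral by (intro mult_left_mono) auto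
    also have "\<dots> \<le> ennreal (13 * (1 / real (Suc n) ^ 2))" by (rule s1) auto
    finally show "(\<integral>\<^sup>+ \<omega>. ennreal (1 / real (Suc n) ^ 2) * dyadic_sum (\<lambda>r. X (real (Suc n) + r) \<omega>) \<partial>M) \<le> ennreal (13 * (1 / real (Suc n) ^ 2))" .
  qed auto
  from A B AE_space show ?thesis
  proof eventually_elim
    case (elim \<omega>)
    define a where "a = (\<lambda>n. ennreal ((X (real (Suc n)) \<omega> / real (Suc n)) ^ 4))"
    define b where "b = (\<lambda>n. ennreal (1 / real (Suc n) ^ 2) * dyadic_sum (\<lambda>r. X (real (Suc n) + r) \<omega>))"
    have "(\<lambda>n. 8 * (a n + 10 ^ 4 * b n)) \<longlonglongrightarrow> 8 * (0 + 10 ^ 4 * 0)"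
      unfolding a_def b_def by (intro tendsto_add ennreal_tendsto_cmult elim) (auto simp: ennreal_power[symmetric] less_top power_less_top_ennreal)
    then have lim: "(\<lambda>n. 8 * (a n + 10 ^ 4 * b n)) \<longlonglongrightarrow> 0" by simp
    define n where "n = (\<lambda>t::real. nat \<lfloor>t\<rfloor> - 1)"
    have "filterlim (\<lambda>t::real. nat \<lfloor>t\<rfloor>) sequentially at_top"
      by (rule filterlim_compose[OF filterlim_nat_sequentially filterlim_floor_sequentially])
    then have nlim: "filterlim n sequentially at_top"
      unfolding n_def by (rule filterlim_compose[OF filterlim_minus_const_nat_at_top])
    have le: "ennreal ((X t \<omega> / t) ^ 4) \<le> 8 * (a (n t) + 10 ^ 4 * b (n t))" if t: "1 \<le> t" for t
    proof -
      define k where "k = Suc (n t)"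
      have "\<lfloor>t\<rfloor> \<ge> 1" using t by simp
      then have k: "real k \<le> t" "t \<le> real k + 1" "1 \<le> real k" "real k = of_int \<lfloor>t\<rfloor>"
        by (auto simp: k_def n_def Suc_diff_Suc)
      define p d where "p = X (real k) \<omega>" and "d = X t \<omega> - X (real k) \<omega>"
      have "(X t \<omega> / t) ^ 4 \<le> (X t \<omega> / real k) ^ 4"
      proof -
        have "0 < real k" using k(3) by linarith
        moreover from this have "real k ^ 4 \<le> t ^ 4" using k(1) by (intro power_mono) auto
        ultimately have "real k ^ 4 \<le> t ^ 4" "0 < real k ^ 4" by auto
        then show ?thesis unfolding power_divide by (intro frac_le) auto
      qed
      also have "\<dots> = (p / real k + d / real k) ^ 4" by (simp add: p_def d_def add_divide_distrib[symmetric])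
      also have "\<dots> \<le> 8 * ((p / real k) ^ 4 + (d / real k) ^ 4)"
      proof -
        have sq: "(u + v)\<^sup>2 \<le> 2 * (u\<^sup>2 + v\<^sup>2)" for u v :: real
          using sum_squares_bound[of u v] by (simp add: power2_sum)
        have "(u + v) ^ 4 \<le> 8 * (u ^ 4 + v ^ 4)" for u v :: real
        proof -
          have "(u + v) ^ 4 = ((u + v)\<^sup>2)\<^sup>2" by (simp flip: power_mult)
          also have "\<dots> \<le> (2 * (u\<^sup>2 + v\<^sup>2))\<^sup>2" by (intro power_mono sq) auto
          also have "\<dots> = 4 * (u\<^sup>2 + v\<^sup>2)\<^sup>2" unfolding power_mult_distrib by simp
          also have "\<dots> \<le> 4 * (2 * ((u\<^sup>2)\<^sup>2 + (v\<^sup>2)\<^sup>2))" by (intro mult_left_mono sq) auto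
          also have "\<dots> = 8 * (u ^ 4 + v ^ 4)" by (simp flip: power_mult)
          finally show ?thesis .
        qed
        then show ?thesis by blast
      qed
      also have "(d / real k) ^ 4 = d ^ 4 * (1 / real k ^ 4)" by (simp add: power_divide)
      also have "\<dots> \<le> d ^ 4 * (1 / real k ^ 2)"
        using k(3) by (intro mult_left_mono divide_left_mono power_increasing) auto
      finally have "ennreal ((X t \<omega> / t) ^ 4) \<le> ennreal (8 * ((p / real k) ^ 4 + d ^ 4 * (1 / real k ^ 2)))"
        by (intro ennreal_leI) simp
      also have "\<dots> = 8 * (a (n t) + ennreal (1 / real k ^ 2) * ennreal (d ^ 4))"
      proof -
        have *: "ennreal (8 * (u + v * q)) = 8 * (ennreal u + ennreal q * ennreal v)" if "0 \<le> u" "0 \<le> v" "0 \<le> q" for u v q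
          using that by (simp add: ennreal_mult ennreal_plus mult.commute)
        have a_eq: "a (n t) = ennreal ((p / real k) ^ 4)" by (simp only: a_def p_def k_def)
        show ?thesis unfolding a_eq using k(3) by (intro *) auto
      qed
      finally have le1: "ennreal ((X t \<omega> / t) ^ 4) \<le> 8 * (a (n t) + ennreal (1 / real k ^ 2) * ennreal (d ^ 4))" .
      have le2: "ennreal (d ^ 4) \<le> 10 ^ 4 * dyadic_sum (\<lambda>r. X (real k + r) \<omega>)"
      proof -
        have "continuous_on {0..1} (\<lambda>r. X (real k + r) \<omega>)"
          by (rule continuous_on_compose2[OF cont[OF elim(3)]]) (auto intro!: continuous_intros)
        from dyadic_sum_bounds_excursion[OF this, of "t - real k"] k
        show ?thesis by (simp add: d_def)
      qed
      note le1
      also have "8 * (a (n t) + ennreal (1 / real k ^ 2) * ennreal (d ^ 4))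
          \<le> 8 * (a (n t) + ennreal (1 / real k ^ 2) * (10 ^ 4 * dyadic_sum (\<lambda>r. X (real k + r) \<omega>)))"
        by (intro mult_left_mono add_left_mono le2) auto
      also have "\<dots> = 8 * (a (n t) + 10 ^ 4 * b (n t))"
        by (simp only: b_def k_def mult_ac)
      finally show ?thesis .
    qed
    have "((\<lambda>t. 8 * (a (n t) + 10 ^ 4 * b (n t))) \<longlongrightarrow> 0) at_top"
      by (rule filterlim_compose[OF lim nlim])
    moreover have "eventually (\<lambda>t. ennreal ((X t \<omega> / t) ^ 4) \<le> 8 * (a (n t) + 10 ^ 4 * b (n t))) at_top"
      using eventually_ge_at_top[of 1] by (rule eventually_mono) (rule le)
    ultimately have "((\<lambda>t. ennreal ((X t \<omega> / t) ^ 4)) \<longlongrightarrow> 0) at_top"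
      using tendsto_sandwich[of "\<lambda>_. 0" "\<lambda>t. ennreal ((X t \<omega> / t) ^ 4)" at_top "\<lambda>t. 8 * (a (n t) + 10 ^ 4 * b (n t))" 0]
      by simp
    then have "((\<lambda>t. (X t \<omega> / t) ^ 4) \<longlongrightarrow> 0) at_top"
      by (subst (asm) ennreal_0[symmetric], subst (asm) tendsto_ennreal_iff) auto
    then have "((\<lambda>t. root 4 ((X t \<omega> / t) ^ 4)) \<longlongrightarrow> root 4 0) at_top"
      by (intro tendsto_intros)
    then have "((\<lambda>t. \<bar>X t \<omega> / t\<bar>) \<longlongrightarrow> 0) at_top"
      by (simp add: root_abs_power_even)
    then show ?case by (rule tendsto_rabs_zero_cancel)
  qed
qed

end

section \<open>Wiener space\<close>

lemma two_sided_wienerD: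
  assumes "two_sided_wiener M"
  shows "prob_space M" "\<And>w. w \<in> space M \<Longrightarrow> continuous_on UNIV w" "\<And>w. w \<in> space M \<Longrightarrow> w 0 = 0"
    "\<And>s t. s < t \<Longrightarrow> distributed M lborel (\<lambda>w. w t - w s) (\<lambda>x. ennreal (normal_density 0 (sqrt (t - s)) x))"
    "\<And>n t. (\<And>i. i < n \<Longrightarrow> t i < t (Suc i)) \<Longrightarrow>
       prob_space.indep_vars M (\<lambda>_. borel) (\<lambda>i w. w (t (Suc i)) - w (t i)) {..<n}"
proof -
  have W: "prob_space M" "space M = path_space"
    "\<forall>s t. s < t \<longrightarrow> distributed M lborel (\<lambda>w. w t - w s) (\<lambda>x. ennreal (normal_density 0 (sqrt (t - s)) x))"
    "\<forall>n (t :: nat \<Rightarrow> real). (\<forall>i<n. t i < t (Suc i)) \<longrightarrow>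
        prob_space.indep_vars M (\<lambda>_. borel) (\<lambda>i w. w (t (Suc i)) - w (t i)) {..<n}"
    using assms unfolding two_sided_wiener_def by blast+
  show "prob_space M" by (rule W(1))
  show "continuous_on UNIV w" "w 0 = 0" if "w \<in> space M" for w
    using that unfolding W(2) path_space_def by auto
  show "distributed M lborel (\<lambda>w. w t - w s) (\<lambda>x. ennreal (normal_density 0 (sqrt (t - s)) x))" if "s < t" for s t
    using W(3) that by blast
  show "prob_space.indep_vars M (\<lambda>_. borel) (\<lambda>i w. w (t (Suc i)) - w (t i)) {..<n}"
    if "\<And>i. i < n \<Longrightarrow> t i < t (Suc i)" for n t
    using W(4) that by blast
qed

lemma wiener_coordinate_measurable:
  assumes W: "two_sided_wiener M"
  shows "(\<lambda>w. w t) \<in> borel_measurable M"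
proof (rule linorder_cases[of t 0])
  note D = two_sided_wienerD[OF W]
  have m: "(\<lambda>w. w b - w a) \<in> borel_measurable M" if "a < b" for a b
    using D(4)[OF that] by (auto simp: distributed_def)
  show ?thesis if "t < 0"
  proof -
    have "(\<lambda>w. - (w 0 - w t)) \<in> borel_measurable M" using m[OF that] by measurable
    then show ?thesis by (rule measurable_cong[THEN iffD1, rotated]) (simp add: D(3))
  qed
  show ?thesis if "t = 0"
    using that by (subst measurable_cong[where g = "\<lambda>_. 0"]) (auto simp: D(3))
  show ?thesis if "0 < t"
    using m[OF that] by (rule measurable_cong[THEN iffD1, rotated]) (simp add: D(3))
qed

lemma wiener_fourth_moment:
  assumes W: "two_sided_wiener M"
  shows "(\<integral>\<^sup>+ w. ennreal ((w t - w s) ^ 4) \<partial>M) = ennreal (3 * (t - s)\<^sup>2)"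
proof -
  have *: "(\<integral>\<^sup>+ w. ennreal ((w t - w s) ^ 4) \<partial>M) = ennreal (3 * (t - s)\<^sup>2)" if st: "s < t" for s t
  proof -
    define \<sigma> where "\<sigma> = sqrt (t - s)"
    have \<sigma>: "\<sigma> > 0" "\<sigma>\<^sup>2 = t - s" using st by (auto simp: \<sigma>_def)
    have m: "has_bochner_integral lborel (\<lambda>x. normal_density 0 \<sigma> x * x ^ 4) (3 * (t - s)\<^sup>2)"
      using normal_moment_even[OF \<sigma>(1), of 0 2] \<sigma> by (simp add: fact_numeral power_divide)
    have "(\<integral>\<^sup>+ w. ennreal ((w t - w s) ^ 4) \<partial>M) = (\<integral>\<^sup>+ x. ennreal (normal_density 0 \<sigma> x) * ennreal (x ^ 4) \<partial>lborel)"
      unfolding \<sigma>_def by (rule distributed_nn_integral[OF two_sided_wienerD(4)[OF W st], symmetric]) simp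
    also have "\<dots> = (\<integral>\<^sup>+ x. ennreal (normal_density 0 \<sigma> x * x ^ 4) \<partial>lborel)"
      by (intro nn_integral_cong) (simp add: ennreal_mult normal_density_nonneg)
    also have "\<dots> = ennreal (3 * (t - s)\<^sup>2)"
      using m by (subst nn_integral_eq_integral) (auto simp: has_bochner_integral_iff normal_density_nonneg)
    finally show ?thesis .
  qed
  have flip: "(a - b) ^ 4 = (b - a) ^ 4" "3 * (a - b)\<^sup>2 = 3 * (b - a)\<^sup>2" for a b :: real
    by (auto simp: power2_commute power4_eq_xxxx algebra_simps)
  show ?thesis
    using *[of s t] *[of t s] by (cases s t rule: linorder_cases) (simp_all add: flip[of s t] flip[of "_ s" "_ t"])
qed

lemma nn_integral_component:
  assumes M: "prob_space M" and f: "f \<in> borel_measurable M"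
  shows "(\<integral>\<^sup>+ \<omega>. f (\<omega> j) \<partial>noise_space M) = (\<integral>\<^sup>+ w. f w \<partial>M)"
proof -
  have "(\<integral>\<^sup>+ w. f w \<partial>M) = (\<integral>\<^sup>+ w. f w \<partial>distr (noise_space M) M (\<lambda>\<omega>. \<omega> j))"
    unfolding noise_space_def using M by (subst distr_PiM_component) auto
  also have "\<dots> = (\<integral>\<^sup>+ \<omega>. f (\<omega> j) \<partial>noise_space M)"
    using f by (intro nn_integral_distr) (auto simp: noise_space_def)
  finally show ?thesis ..
qed

lemma prob_space_noise: "prob_space M \<Longrightarrow> prob_space (noise_space M)"
  unfolding noise_space_def by (intro prob_space_PiM) auto

lemma space_noise: "\<omega> \<in> space (noise_space M) \<Longrightarrow> \<omega> j \<in> space M"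
  by (auto simp: noise_space_def space_PiM PiE_iff)

lemma noise_coordinate_measurable:
  assumes W: "two_sided_wiener M"
  shows "(\<lambda>\<omega>. \<omega> j t) \<in> borel_measurable (noise_space M)"
  unfolding noise_space_def
  by (rule measurable_compose[of "\<lambda>\<omega>. \<omega> j" _ M, OF _ wiener_coordinate_measurable[OF W]]) simp

lemma noise_brownian_moments:
  fixes j :: "'i::finite"
  assumes W: "two_sided_wiener M" and r: "\<bar>r\<bar> = 1"
  shows "brownian_moments (noise_space M) (\<lambda>t \<omega>. \<omega> j (r * t))"
proof -
  note D = two_sided_wienerD[OF W]
  have r2: "r\<^sup>2 = 1" using r by (metis power2_abs power_one)
  show ?thesis
  proof (intro brownian_moments.intro brownian_moments_axioms.intro prob_space_noise D(1))
    show "(\<lambda>\<omega>. \<omega> j (r * t)) \<in> borel_measurable (noise_space M)" for t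
      by (rule noise_coordinate_measurable[OF W])
    note [measurable] = wiener_coordinate_measurable[OF W]
    fix s t
    have "(\<integral>\<^sup>+ \<omega>. ennreal ((\<omega> j (r * t) - \<omega> j (r * s)) ^ 4) \<partial>noise_space M) = ennreal (3 * (r * t - r * s)\<^sup>2)"
      using nn_integral_component[OF D(1), of "\<lambda>w. ennreal ((w (r * t) - w (r * s)) ^ 4)" j]
        wiener_fourth_moment[OF W, of "r * t" "r * s"] by simp
    also have "(r * t - r * s)\<^sup>2 = (t - s)\<^sup>2"
      using r2 by (simp add: power_mult_distrib flip: right_diff_distrib)
    finally show "(\<integral>\<^sup>+ \<omega>. ennreal ((\<omega> j (r * t) - \<omega> j (r * s)) ^ 4) \<partial>noise_space M) \<le> ennreal (3 * (t - s)\<^sup>2)"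
      by simp
  next
    fix \<omega> assume "\<omega> \<in> space (noise_space M :: ('i \<Rightarrow> real \<Rightarrow> real) measure)"
    note D(2,3)[OF space_noise[OF this, of j]]
    then show "continuous_on UNIV (\<lambda>t. \<omega> j (r * t))" "\<omega> j (r * 0) = 0"
      using continuous_on_compose2[of UNIV "\<omega> j" UNIV "\<lambda>t. r * t"] by (auto intro!: continuous_intros)
  qed
qed

text \<open>
  Independence over disjoint time steps holds by hypothesis and over sites by the product structure;
  both are combined for pairs of a time step and a site.
\<close>

lemma noise_increments_indep:
  fixes t :: "nat \<Rightarrow> real" and M :: "(real \<Rightarrow> real) measure"
  defines "X \<equiv> \<lambda>p (\<omega> :: 'i::finite \<Rightarrow> real \<Rightarrow> real). \<omega> (snd p) (t (Suc (fst p))) - \<omega> (snd p) (t (fst p))"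
  assumes W: "two_sided_wiener M" and t: "\<And>i. i < n \<Longrightarrow> t i < t (Suc i)" and n: "0 < n"
  shows "prob_space.indep_vars (noise_space M) (\<lambda>_. borel) X ({..<n} \<times> UNIV)"
proof -
  note D = two_sided_wienerD[OF W]
  note [measurable] = noise_coordinate_measurable[OF W] wiener_coordinate_measurable[OF W]
  interpret M: prob_space M by (rule D)
  interpret N: prob_space "noise_space M :: ('i \<Rightarrow> real \<Rightarrow> real) measure" by (intro prob_space_noise D)
  interpret P: finite_product_prob_space "\<lambda>_::'i. M" UNIV by standard auto
  let ?N = "noise_space M :: ('i \<Rightarrow> real \<Rightarrow> real) measure"
  have X_meas: "X p \<in> borel_measurable ?N" for p unfolding X_def by measurable
  have spN: "space ?N = Pi\<^sub>E UNIV (\<lambda>_. space M)" by (simp add: noise_space_def space_PiM)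
  show ?thesis
    unfolding N.indep_vars_def2
  proof (intro conjI ballI X_meas)
    have ne: "{..<n} \<times> (UNIV :: 'i set) \<noteq> {}" using n by auto
    show "N.indep_sets (\<lambda>p. {X p -` A \<inter> space ?N |A. A \<in> sets borel}) ({..<n} \<times> UNIV)"
    proof (subst N.indep_sets_finite[OF ne])
      show "\<forall>A\<in>Pi ({..<n} \<times> UNIV) (\<lambda>p. {X p -` A \<inter> space ?N |A. A \<in> sets borel}).
          N.prob (\<Inter>j\<in>{..<n} \<times> UNIV. A j) = (\<Prod>j\<in>{..<n} \<times> UNIV. N.prob (A j))"
      proof
        fix A assume "A \<in> Pi ({..<n} \<times> (UNIV :: 'i set)) (\<lambda>p. {X p -` A \<inter> space ?N |A. A \<in> sets borel})"
        then have "\<forall>p\<in>{..<n} \<times> UNIV. \<exists>S. A p = X p -` S \<inter> space ?N \<and> S \<in> sets borel" by auto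
        then obtain S where S: "\<And>i j. i < n \<Longrightarrow> A (i, j) = X (i, j) -` S (i, j) \<inter> space ?N"
          "\<And>i j. i < n \<Longrightarrow> S (i, j) \<in> sets borel" by (metis SigmaI UNIV_I lessThan_iff)
        define Y where "Y = (\<lambda>i (w :: real \<Rightarrow> real). w (t (Suc i)) - w (t i))"
        define C where "C = (\<lambda>i j. Y i -` S (i, j) \<inter> space M)"
        have Y_meas: "Y i \<in> borel_measurable M" for i unfolding Y_def by measurable
        have C: "C i j \<in> sets M" if "i < n" for i j
          unfolding C_def by (rule measurable_sets[OF Y_meas S(2)[OF that]])
        have single: "N.prob (A (i, j)) = M.prob (C i j)" if i: "i < n" for i j
        proof -
          have "A (i, j) = Pi\<^sub>E UNIV (\<lambda>j'. if j' = j then C i j else space M)"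
            using S(1)[OF i] by (fastforce simp: spN C_def Y_def X_def PiE_iff split: if_splits)
          then have "N.prob (A (i, j)) = (\<Prod>j'\<in>UNIV. M.prob (if j' = j then C i j else space M))"
            unfolding noise_space_def using C[OF i] by (simp only:) (rule P.finite_measure_PiM_emb, auto)
          also have "\<dots> = M.prob (C i j)"
            by (simp add: if_distrib[of M.prob] M.prob_space prod.delta cong: if_cong)
          finally show ?thesis .
        qed
        have A_iff: "\<omega> \<in> A (i, j) \<longleftrightarrow> (\<forall>j. \<omega> j \<in> space M) \<and> \<omega> j \<in> C i j" if "i < n" for i j \<omega>
          by (auto simp: S(1)[OF that] spN C_def Y_def X_def PiE_iff)
        have C_space: "w \<in> space M" if "w \<in> C i j" for w i j using that by (simp add: C_def)
        have "(\<Inter>p\<in>{..<n} \<times> UNIV. A p) = Pi\<^sub>E UNIV (\<lambda>j. \<Inter>i<n. C i j)"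
        proof (rule set_eqI)
          fix \<omega>
          have "\<omega> \<in> (\<Inter>p\<in>{..<n} \<times> UNIV. A p) \<longleftrightarrow> (\<forall>i<n. \<forall>j. \<omega> \<in> A (i, j))" by auto
          also have "\<dots> \<longleftrightarrow> (\<forall>i<n. \<forall>j. \<omega> j \<in> C i j)" using A_iff C_space n by metis
          also have "\<dots> \<longleftrightarrow> \<omega> \<in> Pi\<^sub>E UNIV (\<lambda>j. \<Inter>i<n. C i j)" by (auto simp: PiE_iff)
          finally show "\<omega> \<in> (\<Inter>p\<in>{..<n} \<times> UNIV. A p) \<longleftrightarrow> \<omega> \<in> Pi\<^sub>E UNIV (\<lambda>j. \<Inter>i<n. C i j)" .
        qed
        then have "N.prob (\<Inter>p\<in>{..<n} \<times> UNIV. A p) = (\<Prod>j\<in>UNIV. M.prob (\<Inter>i<n. C i j))"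
          unfolding noise_space_def using C n by (simp only:) (rule P.finite_measure_PiM_emb, auto intro!: sets.finite_INT)
        also have "\<dots> = (\<Prod>j\<in>UNIV. \<Prod>i<n. M.prob (C i j))"
        proof (intro prod.cong refl)
          fix j
          have "M.indep_vars (\<lambda>_. borel) Y {..<n}" unfolding Y_def by (rule D(5)) (rule t)
          then have "M.indep_sets (\<lambda>i. {Y i -` A \<inter> space M |A. A \<in> sets borel}) {..<n}"
            unfolding M.indep_vars_def2 by simp
          then show "M.prob (\<Inter>i<n. C i j) = (\<Prod>i<n. M.prob (C i j))"
            by (rule M.indep_setsD) (use n S(2) in \<open>auto simp: C_def\<close>)
        qed
        also have "\<dots> = (\<Prod>i<n. \<Prod>j\<in>UNIV. N.prob (A (i, j)))"
          by (subst prod.swap) (simp add: single)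
        also have "\<dots> = (\<Prod>p\<in>{..<n} \<times> UNIV. N.prob (A p))"
          by (simp add: prod.cartesian_product)
        finally show "N.prob (\<Inter>p\<in>{..<n} \<times> UNIV. A p) = (\<Prod>p\<in>{..<n} \<times> UNIV. N.prob (A p))" .
      qed
      show "{X p -` A \<inter> space ?N |A. A \<in> sets borel} \<subseteq> N.events" for p
        using measurable_sets[OF X_meas] by blast
      show "space ?N \<in> {X p -` A \<inter> space ?N |A. A \<in> sets borel}" for p
        by (auto intro!: exI[of _ UNIV])
    qed auto
  qed
qed

lemma noise_increment_distr:
  assumes W: "two_sided_wiener M" and h: "0 < h"
  shows "distr (noise_space M) borel (\<lambda>\<omega>. \<omega> j (r + h) - \<omega> j r) = density lborel (\<lambda>x. ennreal (normal_density 0 (sqrt h) x))"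
proof -
  note D = two_sided_wienerD[OF W]
  note [measurable] = wiener_coordinate_measurable[OF W]
  have "distr (noise_space M) borel (\<lambda>\<omega>. \<omega> j (r + h) - \<omega> j r)
      = distr (distr (noise_space M) M (\<lambda>\<omega>. \<omega> j)) borel (\<lambda>w. w (r + h) - w r)"
    by (subst distr_distr) (auto simp: noise_space_def o_def)
  also have "distr (noise_space M) M (\<lambda>\<omega>. \<omega> j) = M"
    unfolding noise_space_def using D(1) by (intro distr_PiM_component) auto
  also have "distr M borel (\<lambda>w. w (r + h) - w r) = distr M lborel (\<lambda>w. w (r + h) - w r)"
    by (intro distr_cong) auto
  also have "\<dots> = density lborel (\<lambda>x. ennreal (normal_density 0 (sqrt h) x))"
    using D(4)[of r "r + h"] h by (simp add: distributed_def)
  finally show ?thesis .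
qed

text \<open>The increments over the \<open>k\<close>-th block of \<open>m\<close> steps of the grid of mesh \<open>h\<close>.\<close>

definition block :: "real \<Rightarrow> nat \<Rightarrow> nat \<Rightarrow> ('i \<Rightarrow> real \<Rightarrow> real) \<Rightarrow> nat \<times> 'i \<Rightarrow> real" where
  "block h m k \<omega> = (\<lambda>p\<in>{..<m} \<times> UNIV. \<omega> (snd p) (real (k * m + Suc (fst p)) * h) - \<omega> (snd p) (real (k * m + fst p) * h))"

text \<open>
  The law of the increments in a block does not depend on the index \<open>k\<close> of the block.
\<close>

lemma block_distr:
  assumes W: "two_sided_wiener M" and h: "0 < h" and m: "0 < m"
  shows "distr (noise_space M) (PiM ({..<m} \<times> (UNIV :: 'i::finite set)) (\<lambda>_. borel)) (block h m k)
    = PiM ({..<m} \<times> UNIV) (\<lambda>_. density lborel (\<lambda>x. ennreal (normal_density 0 (sqrt h) x)))"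
proof -
  note [measurable] = noise_coordinate_measurable[OF W]
  interpret N: prob_space "noise_space M :: ('i \<Rightarrow> real \<Rightarrow> real) measure"
    by (intro prob_space_noise two_sided_wienerD[OF W])
  define X where "X = (\<lambda>p (\<omega> :: 'i \<Rightarrow> real \<Rightarrow> real). \<omega> (snd p) (real (k * m + Suc (fst p)) * h) - \<omega> (snd p) (real (k * m + fst p) * h))"
  have "N.indep_vars (\<lambda>_. borel) X ({..<m} \<times> UNIV)"
    using noise_increments_indep[OF W, of m "\<lambda>i. real (k * m + i) * h"] h m by (simp add: X_def)
  moreover have "{..<m} \<times> (UNIV :: 'i set) \<noteq> {}" using m by auto
  moreover have "X p \<in> borel_measurable (noise_space M)" for p unfolding X_def by measurable
  ultimately have "distr (noise_space M) (PiM ({..<m} \<times> UNIV) (\<lambda>_. borel)) (\<lambda>x. \<lambda>p\<in>{..<m} \<times> UNIV. X p x)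
      = PiM ({..<m} \<times> UNIV) (\<lambda>p. distr (noise_space M) borel (X p))"
    by (subst (asm) N.indep_vars_iff_distr_eq_PiM) auto
  moreover have "distr (noise_space M) borel (X p) = density lborel (\<lambda>x. ennreal (normal_density 0 (sqrt h) x))" for p
    using noise_increment_distr[OF W h, of "snd p" "real (k * m + fst p) * h"]
    by (simp add: X_def algebra_simps)
  ultimately show ?thesis by (simp add: X_def block_def[abs_def])
qed

lemma block_measurable:
  assumes W: "two_sided_wiener M"
  shows "block h m k \<in> measurable (noise_space M) (PiM ({..<m} \<times> (UNIV :: 'i::finite set)) (\<lambda>_. borel))"
proof -
  note [measurable] = noise_coordinate_measurable[OF W]
  show ?thesis unfolding block_def[abs_def] by (intro measurable_restrict) measurable
qed

lemma block_indep:
  fixes M :: "(real \<Rightarrow> real) measure"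
  assumes W: "two_sided_wiener M" and h: "0 < h" and m: "0 < m" and kl: "k < l"
  shows "prob_space.indep_var (noise_space M)
    (PiM ({..<m} \<times> (UNIV :: 'i::finite set)) (\<lambda>_. borel)) (block h m k)
    (PiM ({..<m} \<times> (UNIV :: 'i set)) (\<lambda>_. borel)) (block h m l)"
proof -
  interpret N: prob_space "noise_space M :: ('i \<Rightarrow> real \<Rightarrow> real) measure"
    by (intro prob_space_noise two_sided_wienerD[OF W])
  define X where "X = (\<lambda>p (\<omega> :: 'i \<Rightarrow> real \<Rightarrow> real). \<omega> (snd p) (real (Suc (fst p)) * h) - \<omega> (snd p) (real (fst p) * h))"
  define A where "A = (\<lambda>k. {k * m..<k * m + m} \<times> (UNIV :: 'i set))"
  define re where "re = (\<lambda>k (d :: nat \<times> 'i \<Rightarrow> real). \<lambda>p\<in>{..<m} \<times> (UNIV :: 'i set). d (k * m + fst p, snd p))"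
  have ind: "N.indep_vars (\<lambda>_. borel) X ({..<Suc l * m} \<times> UNIV)"
    using noise_increments_indep[OF W, of "Suc l * m" "\<lambda>i. real i * h"] h m by (simp add: X_def)
  have "k * m + m \<le> l * m" using kl by (metis Suc_leI add.commute mult_Suc mult_le_mono1)
  then have AB: "A k \<inter> A l = {}" "A k \<subseteq> {..<Suc l * m} \<times> UNIV" "A l \<subseteq> {..<Suc l * m} \<times> UNIV"
    by (auto simp: A_def)
  have re: "re k \<in> measurable (PiM (A k) (\<lambda>_. borel)) (PiM ({..<m} \<times> UNIV) (\<lambda>_. borel))" for k
    unfolding re_def by (intro measurable_restrict measurable_component_singleton) (auto simp: A_def)
  have bl: "re k \<circ> (\<lambda>\<omega>. restrict (\<lambda>p. X p \<omega>) (A k)) = block h m k" for k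
    unfolding re_def X_def block_def A_def o_def by (intro ext restrict_ext) auto
  from N.indep_var_compose[OF N.indep_var_restrict[OF ind AB] re re]
  show ?thesis unfolding bl .
qed

section \<open>The law of large numbers for the displacement\<close>

text \<open>
  The driving path is now \<open>noise \<omega> = (\<epsilon>\<^sub>j \<omega>\<^sub>j)\<^sub>j\<close> for a point \<open>\<omega>\<close> of the product of Wiener spaces.
\<close>

locale noisy_system = damped_system L N e \<alpha> \<Lambda> M c \<kappa>
  for L N :: "real ^ 'i::finite \<Rightarrow> real ^ 'i" and e \<alpha> \<Lambda> M c \<kappa> +
  fixes W :: "(real \<Rightarrow> real) measure" and \<epsilon> :: "real ^ 'i"
  assumes W: "two_sided_wiener W"
begin

abbreviation \<Omega> :: "('i \<Rightarrow> real \<Rightarrow> real) measure" where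
  "\<Omega> \<equiv> noise_space W"

sublocale prob_space \<Omega>
  by (intro prob_space_noise two_sided_wienerD[OF W])

definition noise :: "('i \<Rightarrow> real \<Rightarrow> real) \<Rightarrow> real \<Rightarrow> real ^ 'i" where
  "noise \<omega> t = (\<chi> j. \<epsilon> $ j * \<omega> j t)"

lemma noise_continuous:
  assumes "\<omega> \<in> space \<Omega>"
  shows "continuous_on UNIV (noise \<omega>)"
proof -
  have "continuous_on UNIV (\<omega> j)" for j
    by (rule two_sided_wienerD(2)[OF W space_noise[OF assms]])
  then show ?thesis unfolding noise_def[abs_def]
    by (intro continuous_on_vec_lambda continuous_on_mult continuous_on_const) (simp add: eta_contract_eq)
qed

lemma noise_0: "\<omega> \<in> space \<Omega> \<Longrightarrow> noise \<omega> 0 = 0"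
  using two_sided_wienerD(3)[OF W space_noise, of \<omega>] by (simp add: noise_def vec_eq_iff)

text \<open>
  A Lipschitz constant of \<open>\<Theta>\<close> along solutions.
\<close>

definition rate :: real where
  "rate = c / (norm e * \<alpha>)"

lemma rate_nonneg: "0 \<le> rate"
  using c_nonneg \<alpha> by (simp add: rate_def)

text \<open>The Euler scheme as a function of the driving values at the grid points.\<close>

fun euler_grid :: "(nat \<Rightarrow> real ^ 'i) \<Rightarrow> real \<Rightarrow> nat \<Rightarrow> (real ^ 'i) \<times> (real ^ 'i)" where
  "euler_grid p h 0 = 0"
| "euler_grid p h (Suc i) = euler_grid p h i + h *\<^sub>R vf (\<lambda>_. p i) 0 (euler_grid p h i)"

lemma euler_eq_euler_grid: "euler (vf w) h 0 i = euler_grid (\<lambda>i. w (real i * h)) h i"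
  by (induction i) (auto simp: vf_def)

lemma euler_grid_cong: "(\<And>j. j < i \<Longrightarrow> p j = q j) \<Longrightarrow> euler_grid p h i = euler_grid q h i"
  by (induction i) (auto simp: vf_def)

lemma \<Theta>_euler_grid_bound: "0 \<le> h \<Longrightarrow> \<bar>\<Theta> (euler_grid p h i)\<bar> \<le> real i * h * rate"
proof (induction i)
  case 0
  then show ?case by (simp add: \<Theta>_simps)
next
  case (Suc i)
  define x where "x = euler_grid p h i"
  have "\<Theta> (euler_grid p h (Suc i)) = \<Theta> x + h * (avg (N (fst x)) / \<alpha>)"
    using \<alpha> by (simp add: x_def \<Theta>_def vf_def avg_simps avg_L split_beta field_simps)
  moreover have "\<bar>avg (N (fst x)) / \<alpha>\<bar> \<le> rate"
  proof -
    have "norm e * \<bar>avg (N (fst x))\<bar> \<le> c" using avg_norm_le N_bound order_trans by blast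
    then show ?thesis using \<alpha> e by (simp add: rate_def field_simps)
  qed
  then have "\<bar>h * (avg (N (fst x)) / \<alpha>)\<bar> \<le> h * rate"
    using Suc.prems by (simp only: abs_mult) (intro mult_mono, auto)
  ultimately have "\<bar>\<Theta> (euler_grid p h (Suc i))\<bar> \<le> real i * h * rate + h * rate"
    using Suc.IH[OF Suc.prems] abs_triangle_ineq[of "\<Theta> x" "h * (avg (N (fst x)) / \<alpha>)"]
    unfolding x_def[symmetric] by simp
  then show ?case by (simp add: distrib_right)
qed

text \<open>The driving path at the \<open>i\<close>-th grid point, recovered from its increments.\<close>

definition grid_path :: "(nat \<times> 'i \<Rightarrow> real) \<Rightarrow> nat \<Rightarrow> real ^ 'i" where
  "grid_path d i = (\<chi> j. \<epsilon> $ j * (\<Sum>l<i. d (l, j)))"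

text \<open>
  The Euler approximation of the displacement at time \<open>m h\<close> as a function of the increments of
  \<open>\<omega>\<close>, indexed by time steps and sites.
\<close>

definition euler_functional :: "real \<Rightarrow> nat \<Rightarrow> (nat \<times> 'i \<Rightarrow> real) \<Rightarrow> real" where
  "euler_functional h m d = \<Theta> (euler_grid (grid_path d) h m)"

lemma continuous_vf: "continuous_on UNIV (\<lambda>q. vf (\<lambda>_. fst q) 0 (snd q))"
  unfolding vf_def
  by (intro continuous_intros continuous_on_compose2[OF N_continuous[of UNIV]]
      continuous_on_compose2[OF linear_continuous_on[OF bounded_linear_L, of UNIV]]) auto

lemma continuous_\<Theta>: "continuous_on UNIV \<Theta>"
proof -
  have "\<Theta> = (\<lambda>x. avg (fst x) + avg (snd x) / \<alpha>)" by (auto simp: \<Theta>_def)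
  then show ?thesis
    using \<alpha> by (auto intro!: continuous_intros continuous_on_compose2[OF linear_continuous_on[OF bounded_linear_avg, of UNIV]])
qed

lemma euler_functional_measurable:
  "euler_functional h m \<in> borel_measurable (PiM ({..<m} \<times> UNIV) (\<lambda>_. borel))"
proof -
  let ?P = "PiM ({..<m} \<times> UNIV) (\<lambda>_. borel) :: (nat \<times> 'i \<Rightarrow> real) measure"
  have p: "(\<lambda>d. grid_path d i) \<in> borel_measurable ?P" if "i \<le> m" for i
  proof (rule borel_measurable_euclidean_space[THEN iffD2], rule ballI)
    fix b :: "real ^ 'i" assume "b \<in> Basis"
    then obtain j where b: "b = axis j 1" by (auto simp: Basis_vec_def)
    have "(\<lambda>d. d (l, j)) \<in> borel_measurable ?P" if "l < i" for l
      using that \<open>i \<le> m\<close> by (intro measurable_component_singleton) auto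
    then have "(\<lambda>d. \<epsilon> $ j * (\<Sum>l<i. d (l, j))) \<in> borel_measurable ?P"
      by (intro borel_measurable_times borel_measurable_sum) auto
    then show "(\<lambda>d. grid_path d i \<bullet> b) \<in> borel_measurable ?P"
      by (simp add: grid_path_def b inner_axis)
  qed
  have "(\<lambda>d. euler_grid (grid_path d) h i) \<in> borel_measurable ?P" if "i \<le> m" for i
    using that
  proof (induction i)
    case (Suc i)
    then have IH: "(\<lambda>d. euler_grid (grid_path d) h i) \<in> borel_measurable ?P" by simp
    have "(\<lambda>d. vf (\<lambda>_. grid_path d i) 0 (euler_grid (grid_path d) h i)) \<in> borel_measurable ?P"
      using Suc.prems by (intro borel_measurable_continuous_Pair[where H = "\<lambda>q x. vf (\<lambda>_. q) 0 x"] p IH continuous_vf) auto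
    then show ?case using IH by simp
  qed simp
  then show ?thesis
    unfolding euler_functional_def[abs_def]
    using borel_measurable_continuous_on[OF continuous_\<Theta>] by blast
qed

lemma euler_functional_block:
  "euler_functional h m (block h m k \<omega>) = \<Theta> (euler (vf (incr (real k * (real m * h)) (noise \<omega>))) h 0 m)"
  unfolding euler_functional_def euler_eq_euler_grid
proof (rule arg_cong[where f = \<Theta>], rule euler_grid_cong)
  fix i assume i: "i < m"
  have "(\<Sum>l<i. block h m k \<omega> (l, j)) = \<omega> j (real k * (real m * h) + real i * h) - \<omega> j (real k * (real m * h))" for j
  proof -
    have "(\<Sum>l<i. block h m k \<omega> (l, j)) = (\<Sum>l<i. \<omega> j (real (k * m + Suc l) * h) - \<omega> j (real (k * m + l) * h))"
      using i by (intro sum.cong) (auto simp: block_def)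
    also have "\<dots> = \<omega> j (real (k * m + i) * h) - \<omega> j (real (k * m + 0) * h)"
      by (rule sum_lessThan_telescope)
    finally show ?thesis by (simp add: algebra_simps)
  qed
  then show "grid_path (block h m k \<omega>) i = incr (real k * (real m * h)) (noise \<omega>) (real i * h)"
    by (simp add: grid_path_def incr_def noise_def vec_eq_iff right_diff_distrib)
qed

text \<open>
  \<open>Y T k\<close> is the displacement from rest over the \<open>k\<close>-th block of length \<open>T\<close>.
\<close>

definition Y :: "real \<Rightarrow> nat \<Rightarrow> ('i \<Rightarrow> real \<Rightarrow> real) \<Rightarrow> real" where
  "Y T k \<omega> = disp (incr (real k * T) (noise \<omega>)) T"

lemma Y_limit:
  assumes T: "0 < T" and \<omega>: "\<omega> \<in> space \<Omega>"
  shows "(\<lambda>m. euler_functional (T / real (Suc m)) (Suc m) (block (T / real (Suc m)) (Suc m) k \<omega>)) \<longlonglongrightarrow> Y T k \<omega>"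
proof -
  have "(\<lambda>m. \<Theta> (euler (vf (incr (real k * T) (noise \<omega>))) (T / real m) 0 m)) \<longlonglongrightarrow> Y T k \<omega>"
    unfolding Y_def by (rule disp_euler[OF incr_continuous[OF noise_continuous[OF \<omega>]] T])
  then have "(\<lambda>m. \<Theta> (euler (vf (incr (real k * T) (noise \<omega>))) (T / real (Suc m)) 0 (Suc m))) \<longlonglongrightarrow> Y T k \<omega>"
    by (rule LIMSEQ_Suc)
  moreover have "real k * (real (Suc m) * (T / real (Suc m))) = real k * T" for m by simp
  ultimately show ?thesis by (simp only: euler_functional_block)
qed

lemma euler_functional_bound:
  "0 < T \<Longrightarrow> \<bar>euler_functional (T / real (Suc m)) (Suc m) d\<bar> \<le> T * rate"
  unfolding euler_functional_def
  using \<Theta>_euler_grid_bound[of "T / real (Suc m)" _ "Suc m"] by (simp del: of_nat_Suc)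

lemma Y_measurable: "0 < T \<Longrightarrow> Y T k \<in> borel_measurable \<Omega>"
  by (rule borel_measurable_LIMSEQ_real[OF Y_limit])
    (auto intro!: measurable_compose[OF block_measurable[OF W] euler_functional_measurable])

lemma Y_bound:
  assumes T: "0 < T" and \<omega>: "\<omega> \<in> space \<Omega>"
  shows "\<bar>Y T k \<omega>\<bar> \<le> T * rate"
proof -
  have c: "continuous_on UNIV (incr (real k * T) (noise \<omega>))" by (rule incr_continuous[OF noise_continuous[OF \<omega>]])
  show ?thesis
    using disp_lipschitz[OF c order_refl less_imp_le[OF T]]
    unfolding disp_0[OF c] rate_def[symmetric] Y_def by (simp add: mult.commute[of rate])
qed

definition \<mu> :: "real \<Rightarrow> real" where
  "\<mu> T = expectation (Y T 0)"

lemma Y_integrable: "0 < T \<Longrightarrow> integrable \<Omega> (Y T k)"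
  by (rule integrable_const_bound[of _ "T * rate"]) (auto simp: Y_measurable intro!: AE_I2 Y_bound)

text \<open>
  Equal means and vanishing correlations pass to the limit from the Euler schemes, which depend on
  the increments in disjoint blocks only.
\<close>

lemma Y_expectations:
  assumes T: "0 < T"
  shows "expectation (Y T k) = \<mu> T"
    and "k \<noteq> l \<Longrightarrow> expectation (\<lambda>\<omega>. Y T k \<omega> * Y T l \<omega>) = (\<mu> T)\<^sup>2"
proof -
  define F where "F = (\<lambda>m k \<omega>. euler_functional (T / real (Suc m)) (Suc m) (block (T / real (Suc m)) (Suc m) k \<omega>))"
  let ?P = "\<lambda>m. PiM ({..<Suc m} \<times> UNIV) (\<lambda>_. borel) :: (nat \<times> 'i \<Rightarrow> real) measure"
  have F_meas: "F m k \<in> borel_measurable \<Omega>" for m k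
    unfolding F_def by (rule measurable_compose[OF block_measurable[OF W] euler_functional_measurable])
  have F_bound: "\<bar>F m k \<omega>\<bar> \<le> T * rate" for m k \<omega>
    unfolding F_def by (rule euler_functional_bound[OF T])
  have F_lim: "(\<lambda>m. F m k \<omega>) \<longlonglongrightarrow> Y T k \<omega>" if "\<omega> \<in> space \<Omega>" for k \<omega>
    unfolding F_def by (rule Y_limit[OF T that])
  have F_int: "integrable \<Omega> (F m k)" for m k
    by (rule integrable_const_bound[of _ "T * rate"]) (auto simp: F_meas intro!: AE_I2 F_bound)
  have lim1: "(\<lambda>m. expectation (F m k)) \<longlonglongrightarrow> expectation (Y T k)" for k
    by (rule integral_dominated_convergence[where w = "\<lambda>_. T * rate"])
      (auto simp: F_meas Y_measurable[OF T] intro!: AE_I2 F_bound F_lim)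
  have same: "expectation (F m k) = expectation (F m 0)" for m k
  proof -
    have *: "expectation (F m k) = integral\<^sup>L (PiM ({..<Suc m} \<times> (UNIV :: 'i set)) (\<lambda>_. density lborel (\<lambda>x. ennreal (normal_density 0 (sqrt (T / real (Suc m))) x)))) (euler_functional (T / real (Suc m)) (Suc m))" for k
      unfolding F_def using T
      by (subst block_distr[OF W, symmetric, where k = k]) (auto simp: integral_distr block_measurable[OF W] euler_functional_measurable simp del: of_nat_Suc)
    show ?thesis unfolding * ..
  qed
  show mean: "expectation (Y T k) = \<mu> T" for k
    unfolding \<mu>_def by (rule LIMSEQ_unique[OF lim1]) (use lim1[of 0] in \<open>simp add: same[of _ k]\<close>)
  assume kl: "k \<noteq> l"
  have prod: "expectation (\<lambda>\<omega>. F m k \<omega> * F m l \<omega>) = expectation (F m k) * expectation (F m l)" for m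
  proof -
    have *: "indep_var borel (F m a) borel (F m b)" if "a < b" for a b
      using indep_var_compose[OF block_indep[OF W _ _ that, of "T / real (Suc m)" "Suc m"] euler_functional_measurable euler_functional_measurable] T
      unfolding F_def o_def by simp
    show ?thesis
    proof (cases "k < l")
      case True
      from indep_var_lebesgue_integral[OF *[OF True] F_int F_int] show ?thesis .
    next
      case False
      then have "l < k" using kl by simp
      from indep_var_lebesgue_integral[OF *[OF this] F_int F_int] show ?thesis by (simp add: mult.commute)
    qed
  qed
  have "(\<lambda>m. expectation (\<lambda>\<omega>. F m k \<omega> * F m l \<omega>)) \<longlonglongrightarrow> expectation (\<lambda>\<omega>. Y T k \<omega> * Y T l \<omega>)"
  proof (rule integral_dominated_convergence[where w = "\<lambda>_. (T * rate) * (T * rate)"])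
    show "AE \<omega> in \<Omega>. norm (F m k \<omega> * F m l \<omega>) \<le> (T * rate) * (T * rate)" for m
      using F_bound rate_nonneg T by (auto simp: abs_mult intro!: mult_mono AE_I2)
  qed (auto simp: F_meas Y_measurable[OF T] intro!: borel_measurable_times tendsto_mult F_lim)
  moreover have "(\<lambda>m. expectation (F m k) * expectation (F m l)) \<longlonglongrightarrow> \<mu> T * \<mu> T"
    using lim1[of k] lim1[of l] unfolding mean by (intro tendsto_mult)
  ultimately show "expectation (\<lambda>\<omega>. Y T k \<omega> * Y T l \<omega>) = (\<mu> T)\<^sup>2"
    unfolding prod power2_eq_square by (rule LIMSEQ_unique)
qed

lemma variance_sum:
  assumes T: "0 < T"
  shows "expectation (\<lambda>\<omega>. (\<Sum>k<n. Y T k \<omega> - \<mu> T)\<^sup>2) \<le> real n * (T * rate)\<^sup>2"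
    and "integrable \<Omega> (\<lambda>\<omega>. (\<Sum>k<n. Y T k \<omega> - \<mu> T)\<^sup>2)"
proof -
  note [measurable] = Y_measurable[OF T]
  have YY: "integrable \<Omega> (\<lambda>\<omega>. Y T k \<omega> * Y T l \<omega>)" for k l
  proof (rule integrable_const_bound[of _ "(T * rate) * (T * rate)"])
    show "AE \<omega> in \<Omega>. norm (Y T k \<omega> * Y T l \<omega>) \<le> (T * rate) * (T * rate)"
      using Y_bound[OF T] rate_nonneg T by (auto simp: abs_mult intro!: mult_mono AE_I2)
  qed measurable
  have cov_eq: "(Y T k \<omega> - \<mu> T) * (Y T l \<omega> - \<mu> T) = Y T k \<omega> * Y T l \<omega> - \<mu> T * Y T k \<omega> - \<mu> T * Y T l \<omega> + \<mu> T * \<mu> T" for k l \<omega>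
    by (simp add: algebra_simps)
  have cov_int: "integrable \<Omega> (\<lambda>\<omega>. (Y T k \<omega> - \<mu> T) * (Y T l \<omega> - \<mu> T))" for k l
    unfolding cov_eq by (intro Bochner_Integration.integrable_add Bochner_Integration.integrable_diff YY integrable_mult_right Y_integrable[OF T]) auto
  have cov: "expectation (\<lambda>\<omega>. (Y T k \<omega> - \<mu> T) * (Y T l \<omega> - \<mu> T)) = expectation (\<lambda>\<omega>. Y T k \<omega> * Y T l \<omega>) - \<mu> T * \<mu> T" for k l
    unfolding cov_eq
    by (simp add: YY Y_integrable[OF T] Y_expectations(1)[OF T] prob_space)
  have cov_le: "expectation (\<lambda>\<omega>. (Y T k \<omega> - \<mu> T) * (Y T l \<omega> - \<mu> T)) \<le> (if k = l then (T * rate)\<^sup>2 else 0)" for k l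
  proof (cases "k = l")
    case True
    have "expectation (\<lambda>\<omega>. Y T l \<omega> * Y T l \<omega>) \<le> (T * rate)\<^sup>2"
    proof (rule integral_le_const[OF YY], rule AE_I2)
      fix \<omega> assume "\<omega> \<in> space \<Omega>"
      from Y_bound[OF T this, of l] show "Y T l \<omega> * Y T l \<omega> \<le> (T * rate)\<^sup>2"
        using abs_le_square_iff[of "Y T l \<omega>" "T * rate"] T rate_nonneg by (simp add: power2_eq_square)
    qed
    then have "expectation (\<lambda>\<omega>. Y T l \<omega> * Y T l \<omega>) - \<mu> T * \<mu> T \<le> (T * rate)\<^sup>2"
      using zero_le_square[of "\<mu> T"] by linarith
    then show ?thesis using True unfolding cov by simp
  next
    case False
    then show ?thesis unfolding cov Y_expectations(2)[OF T False] by (simp add: power2_eq_square)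
  qed
  have sq: "(\<Sum>k<n. Y T k \<omega> - \<mu> T)\<^sup>2 = (\<Sum>k<n. \<Sum>l<n. (Y T k \<omega> - \<mu> T) * (Y T l \<omega> - \<mu> T))" for \<omega>
    by (simp add: power2_eq_square sum_product)
  show "integrable \<Omega> (\<lambda>\<omega>. (\<Sum>k<n. Y T k \<omega> - \<mu> T)\<^sup>2)"
    unfolding sq by (intro Bochner_Integration.integrable_sum cov_int)
  have "expectation (\<lambda>\<omega>. (\<Sum>k<n. Y T k \<omega> - \<mu> T)\<^sup>2) = (\<Sum>k<n. \<Sum>l<n. expectation (\<lambda>\<omega>. (Y T k \<omega> - \<mu> T) * (Y T l \<omega> - \<mu> T)))"
    unfolding sq by (simp add: cov_int)
  also have "\<dots> \<le> (\<Sum>k<n. \<Sum>l<n. if k = l then (T * rate)\<^sup>2 else 0)"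
    by (intro sum_mono cov_le)
  also have "\<dots> = real n * (T * rate)\<^sup>2" by simp
  finally show "expectation (\<lambda>\<omega>. (\<Sum>k<n. Y T k \<omega> - \<mu> T)\<^sup>2) \<le> real n * (T * rate)\<^sup>2" .
qed

end

context noisy_system
begin

lemma dyadic_sum_noise:
  "(\<lambda>\<omega>. dyadic_sum (\<lambda>r. \<omega> i (\<tau> + r))) \<in> borel_measurable \<Omega>"
  "(\<integral>\<^sup>+ \<omega>. dyadic_sum (\<lambda>r. \<omega> i (\<tau> + r)) \<partial>\<Omega>) \<le> 13"
proof -
  interpret brownian_moments \<Omega> "\<lambda>t \<omega>. \<omega> i (1 * t)" by (rule noise_brownian_moments[OF W]) simp
  show "(\<lambda>\<omega>. dyadic_sum (\<lambda>r. \<omega> i (\<tau> + r))) \<in> borel_measurable \<Omega>"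
    using dyadic_sum_measurable[of \<tau>] by simp
  show "(\<integral>\<^sup>+ \<omega>. dyadic_sum (\<lambda>r. \<omega> i (\<tau> + r)) \<partial>\<Omega>) \<le> 13"
    using dyadic_sum_integral[of \<tau>] by simp
qed

text \<open>
  A majorant of the squared excursion of the driving path over the unit interval after \<open>\<tau>\<close>; unlike
  the supremum, it is visibly measurable.
\<close>

definition excursion :: "real \<Rightarrow> ('i \<Rightarrow> real \<Rightarrow> real) \<Rightarrow> ennreal" where
  "excursion \<tau> \<omega> = (\<Sum>i\<in>UNIV. ennreal ((\<epsilon> $ i)\<^sup>2) * (1 + 10 ^ 4 * dyadic_sum (\<lambda>r. \<omega> i (\<tau> + r))))"

lemma excursion_measurable[measurable]: "excursion \<tau> \<in> borel_measurable \<Omega>"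
proof -
  note [measurable] = dyadic_sum_noise(1)
  show ?thesis unfolding excursion_def[abs_def] by measurable
qed

lemma excursion_integral: "\<exists>K\<ge>0. \<forall>\<tau>. (\<integral>\<^sup>+ \<omega>. excursion \<tau> \<omega> \<partial>\<Omega>) \<le> ennreal K"
proof (intro exI conjI allI)
  fix \<tau>
  note [measurable] = dyadic_sum_noise(1)
  have "(\<integral>\<^sup>+ \<omega>. excursion \<tau> \<omega> \<partial>\<Omega>) = (\<Sum>i\<in>UNIV. ennreal ((\<epsilon> $ i)\<^sup>2) * (1 + 10 ^ 4 * (\<integral>\<^sup>+ \<omega>. dyadic_sum (\<lambda>r. \<omega> i (\<tau> + r)) \<partial>\<Omega>)))"
    unfolding excursion_def
    by (simp add: nn_integral_sum nn_integral_cmult nn_integral_add emeasure_space_1)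
  also have "\<dots> \<le> (\<Sum>i\<in>UNIV. ennreal ((\<epsilon> $ i)\<^sup>2) * (1 + 10 ^ 4 * 13))"
    by (intro sum_mono mult_left_mono add_left_mono dyadic_sum_noise(2)) auto
  also have "\<dots> = (\<Sum>i\<in>UNIV. ennreal ((\<epsilon> $ i)\<^sup>2 * 130001))"
    by (intro sum.cong refl) (simp add: ennreal_mult)
  also have "\<dots> = ennreal (\<Sum>i\<in>UNIV. (\<epsilon> $ i)\<^sup>2 * 130001)"
    by (rule sum_ennreal) simp
  finally show "(\<integral>\<^sup>+ \<omega>. excursion \<tau> \<omega> \<partial>\<Omega>) \<le> ennreal (\<Sum>i\<in>UNIV. (\<epsilon> $ i)\<^sup>2 * 130001)" .
qed (auto intro!: sum_nonneg)

lemma excursion_bound: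
  assumes \<omega>: "\<omega> \<in> space \<Omega>" and t: "t \<in> {0..1}"
  shows "ennreal ((norm (noise \<omega> (\<tau> + t) - noise \<omega> \<tau>))\<^sup>2) \<le> excursion \<tau> \<omega>"
proof -
  define d where "d = (\<lambda>i. \<omega> i (\<tau> + t) - \<omega> i \<tau>)"
  have "(norm (noise \<omega> (\<tau> + t) - noise \<omega> \<tau>))\<^sup>2 = (\<Sum>i\<in>UNIV. (\<epsilon> $ i)\<^sup>2 * (d i)\<^sup>2)"
    unfolding power2_norm_eq_inner inner_vec_def
    by (intro sum.cong refl) (simp add: noise_def d_def power2_eq_square algebra_simps)
  also have "ennreal \<dots> = (\<Sum>i\<in>UNIV. ennreal ((\<epsilon> $ i)\<^sup>2 * (d i)\<^sup>2))"
    by (rule sum_ennreal[symmetric]) simp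
  also have "\<dots> \<le> excursion \<tau> \<omega>"
    unfolding excursion_def
  proof (rule sum_mono)
    fix i
    have "continuous_on {0..1} (\<lambda>r. \<omega> i (\<tau> + r))"
      by (rule continuous_on_compose2[OF two_sided_wienerD(2)[OF W space_noise[OF \<omega>]]]) (auto intro!: continuous_intros)
    from dyadic_sum_bounds_excursion[OF this t]
    have d4: "ennreal (d i ^ 4) \<le> 10 ^ 4 * dyadic_sum (\<lambda>r. \<omega> i (\<tau> + r))" by (simp add: d_def)
    have "(d i)\<^sup>2 \<le> 1 + d i ^ 4"
    proof -
      have "0 \<le> ((d i)\<^sup>2 - 1)\<^sup>2" by simp
      then have "2 * (d i)\<^sup>2 \<le> 1 + d i ^ 4" by (simp add: power2_diff flip: power_mult)
      then show ?thesis using zero_le_power2[of "d i"] by linarith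
    qed
    then have "ennreal ((d i)\<^sup>2) \<le> ennreal (1 + d i ^ 4)" by (rule ennreal_leI)
    also have "\<dots> = 1 + ennreal (d i ^ 4)" by (simp add: ennreal_plus)
    also have "\<dots> \<le> 1 + 10 ^ 4 * dyadic_sum (\<lambda>r. \<omega> i (\<tau> + r))" by (intro add_left_mono d4)
    finally show "ennreal ((\<epsilon> $ i)\<^sup>2 * (d i)\<^sup>2) \<le> ennreal ((\<epsilon> $ i)\<^sup>2) * (1 + 10 ^ 4 * dyadic_sum (\<lambda>r. \<omega> i (\<tau> + r)))"
      by (simp add: ennreal_mult mult_left_mono)
  qed
  finally show ?thesis .
qed

text \<open>
  The transverse energy at integer times has bounded expectation. It is estimated through a
  measurable majorant obeying the recursion of the dissipation estimate.
\<close>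

lemma energy_majorant:
  "\<exists>v K. 0 \<le> K \<and> (\<forall>j. v j \<in> borel_measurable \<Omega>) \<and> (\<forall>j. (\<integral>\<^sup>+ \<omega>. v j \<omega> \<partial>\<Omega>) \<le> ennreal K) \<and>
     (\<forall>j. \<forall>\<omega>\<in>space \<Omega>. ennreal (V (phys (noise \<omega>) (real j))) \<le> v j \<omega>)"
proof -
  obtain \<gamma> C where \<gamma>: "0 \<le> \<gamma>" "\<gamma> < 1" "0 < C" and step:
    "\<And>w \<tau> S. continuous_on UNIV w \<Longrightarrow> 0 \<le> \<tau> \<Longrightarrow> (\<forall>t\<in>{0..1}. norm (w (\<tau> + t) - w \<tau>) \<le> S) \<Longrightarrow>
        V (phys w (\<tau> + 1)) \<le> \<gamma> * V (phys w \<tau>) + C * (1 + S\<^sup>2)"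
    using phys_dissipation by metis
  obtain K0 where K0: "K0 \<ge> 0" "\<And>\<tau>. (\<integral>\<^sup>+ \<omega>. excursion \<tau> \<omega> \<partial>\<Omega>) \<le> ennreal K0" using excursion_integral by blast
  define v where "v = rec_nat (\<lambda>_. 0) (\<lambda>j vj \<omega>. ennreal \<gamma> * vj \<omega> + ennreal C * (1 + excursion (real j) \<omega>))"
  have v0: "v 0 \<omega> = 0" and vS: "v (Suc j) \<omega> = ennreal \<gamma> * v j \<omega> + ennreal C * (1 + excursion (real j) \<omega>)" for j \<omega>
    by (auto simp: v_def)
  have vm: "v j \<in> borel_measurable \<Omega>" for j
  proof (induction j)
    case 0
    have "v 0 = (\<lambda>_. 0)" using v0 by auto
    then show ?case by simp
  next
    case (Suc j)
    note [measurable] = Suc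
    have "v (Suc j) = (\<lambda>\<omega>. ennreal \<gamma> * v j \<omega> + ennreal C * (1 + excursion (real j) \<omega>))" using vS by auto
    then show ?case by simp
  qed
  define K where "K = C * (1 + K0) / (1 - \<gamma>)"
  have K: "0 \<le> K" "\<gamma> * K + C * (1 + K0) = K"
    using \<gamma> K0 by (auto simp: K_def field_simps)
  have vi: "(\<integral>\<^sup>+ \<omega>. v j \<omega> \<partial>\<Omega>) \<le> ennreal K" for j
  proof (induction j)
    case (Suc j)
    note [measurable] = vm
    have "(\<integral>\<^sup>+ \<omega>. v (Suc j) \<omega> \<partial>\<Omega>) = ennreal \<gamma> * (\<integral>\<^sup>+ \<omega>. v j \<omega> \<partial>\<Omega>) + ennreal C * (1 + (\<integral>\<^sup>+ \<omega>. excursion (real j) \<omega> \<partial>\<Omega>))"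
      unfolding vS by (simp add: nn_integral_add nn_integral_cmult emeasure_space_1)
    also have "\<dots> \<le> ennreal \<gamma> * ennreal K + ennreal C * (1 + ennreal K0)"
      by (intro add_mono mult_left_mono order_refl Suc K0) auto
    also have "\<dots> = ennreal (\<gamma> * K + C * (1 + K0))"
      using \<gamma>(1,3) K(1) K0(1) by (simp add: ennreal_plus ennreal_mult)
    finally show ?case unfolding K .
  qed (simp add: v0)
  have "ennreal (V (phys (noise \<omega>) (real j))) \<le> v j \<omega>" if \<omega>: "\<omega> \<in> space \<Omega>" for j \<omega>
  proof (induction j)
    case 0
    then show ?case by (simp add: phys_0 noise_continuous noise_0 \<omega> V_0)
  next
    case (Suc j)
    show ?case
    proof (cases "excursion (real j) \<omega>")
      case top
      then show ?thesis using \<gamma> by (simp add: vS ennreal_mult_top)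
    next
      case (real z)
      have "\<forall>t\<in>{0..1}. norm (noise \<omega> (real j + t) - noise \<omega> (real j)) \<le> sqrt z"
      proof
        fix t :: real assume "t \<in> {0..1}"
        from excursion_bound[OF \<omega> this, of "real j"] real
        show "norm (noise \<omega> (real j + t) - noise \<omega> (real j)) \<le> sqrt z"
          by (intro real_le_rsqrt) simp
      qed
      from step[OF noise_continuous[OF \<omega>] _ this] real
      have "ennreal (V (phys (noise \<omega>) (real j + 1))) \<le> ennreal (\<gamma> * V (phys (noise \<omega>) (real j)) + C * (1 + z))"
        by (intro ennreal_leI) simp
      also have "\<dots> = ennreal \<gamma> * ennreal (V (phys (noise \<omega>) (real j))) + ennreal C * (1 + ennreal z)"
        using \<gamma> V_nonneg real by (simp add: ennreal_plus ennreal_mult)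
      also have "\<dots> \<le> v (Suc j) \<omega>"
        unfolding vS real(2) by (intro add_right_mono mult_left_mono Suc) auto
      finally show ?thesis by (simp add: add.commute)
    qed
  qed
  with K vm vi show ?thesis by blast
qed

text \<open>
  The displacement from time \<open>0\<close> is that over the block with index \<open>0\<close>.
\<close>

lemma disp_noise_eq_Y: "\<omega> \<in> space \<Omega> \<Longrightarrow> disp (noise \<omega>) t = Y t 0 \<omega>"
  by (simp add: Y_def incr_def[abs_def] noise_0)

text \<open>The failure of the displacement from rest to be additive over \<open>n\<close> blocks of length \<open>T\<close>.\<close>

definition defect :: "nat \<Rightarrow> real \<Rightarrow> ('i \<Rightarrow> real \<Rightarrow> real) \<Rightarrow> real" where
  "defect n T \<omega> = Y (real n * T) 0 \<omega> - (\<Sum>k<n. Y T k \<omega>)"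

text \<open>
  The displacement over \<open>n\<close> blocks differs from the sum of the block displacements by order \<open>n\<close> in
  quadratic mean, with a constant that does not depend on the length \<open>T\<close> of the blocks.
\<close>

lemma defect_bound:
  "\<exists>K\<ge>0. \<forall>n T. 0 < T \<longrightarrow>
     (\<integral>\<^sup>+ \<omega>. ennreal ((defect n (real T) \<omega>)\<^sup>2) \<partial>\<Omega>) \<le> ennreal ((real n)\<^sup>2 * K)"
proof -
  obtain v K0 where v: "0 \<le> K0" "\<And>j. v j \<in> borel_measurable \<Omega>" "\<And>j. (\<integral>\<^sup>+ \<omega>. v j \<omega> \<partial>\<Omega>) \<le> ennreal K0"
     "\<And>j \<omega>. \<omega> \<in> space \<Omega> \<Longrightarrow> ennreal (V (phys (noise \<omega>) (real j))) \<le> v j \<omega>"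
    using energy_majorant by metis
  define a where "a = 2 / (\<Lambda> * (e \<bullet> e))"
  have a: "0 \<le> a" using \<Lambda> ee by (simp add: a_def)
  define K where "K = a * K0 + 8 * \<kappa>\<^sup>2"
  have "(\<integral>\<^sup>+ \<omega>. ennreal ((defect n (real T) \<omega>)\<^sup>2) \<partial>\<Omega>) \<le> ennreal ((real n)\<^sup>2 * K)"
    if T: "0 < T" for n T :: nat
  proof -
    have pw: "ennreal ((defect n (real T) \<omega>)\<^sup>2)
        \<le> ennreal (real n) * (\<Sum>k<n. ennreal a * v (k * T) \<omega> + ennreal (8 * \<kappa>\<^sup>2))" if \<omega>: "\<omega> \<in> space \<Omega>" for \<omega>
    proof -
      define q where "q = (\<lambda>k. sqrt (V (phys (noise \<omega>) (real (k * T))) / (\<Lambda> * (e \<bullet> e))) + 2 * \<kappa>)"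
      have q0: "0 \<le> q k" for k using \<kappa> \<Lambda> ee V_nonneg by (simp add: q_def)
      have "\<bar>defect n (real T) \<omega>\<bar> \<le> (\<Sum>k<n. q k)"
        using disp_blocks[OF noise_continuous[OF \<omega>], of "real T" n]
        unfolding disp_noise_eq_Y[OF \<omega>] by (simp add: defect_def Y_def q_def)
      then have "(defect n (real T) \<omega>)\<^sup>2 \<le> (\<Sum>k<n. q k)\<^sup>2"
        by (simp add: abs_le_square_iff[symmetric] sum_nonneg q0)
      also have "\<dots> \<le> real n * (\<Sum>k<n. (q k)\<^sup>2)"
        using Cauchy_Schwarz_ineq_sum[of "\<lambda>_. 1" q "{..<n}"] by simp
      also have "\<dots> \<le> real n * (\<Sum>k<n. a * V (phys (noise \<omega>) (real (k * T))) + 8 * \<kappa>\<^sup>2)"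
      proof (intro mult_left_mono sum_mono)
        fix k
        define z where "z = V (phys (noise \<omega>) (real (k * T))) / (\<Lambda> * (e \<bullet> e))"
        have z: "0 \<le> z" using V_nonneg \<Lambda> ee by (simp add: z_def)
        have "(q k)\<^sup>2 \<le> 2 * (sqrt z)\<^sup>2 + 2 * (2 * \<kappa>)\<^sup>2"
          using sum_squares_bound[of "sqrt z" "2 * \<kappa>"] unfolding q_def z_def[symmetric] power2_sum by linarith
        also have "\<dots> = a * V (phys (noise \<omega>) (real (k * T))) + 8 * \<kappa>\<^sup>2"
          using z by (simp add: z_def a_def)
        finally show "(q k)\<^sup>2 \<le> a * V (phys (noise \<omega>) (real (k * T))) + 8 * \<kappa>\<^sup>2" .
      qed simp
      finally have "ennreal ((defect n (real T) \<omega>)\<^sup>2)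
          \<le> ennreal (real n * (\<Sum>k<n. a * V (phys (noise \<omega>) (real (k * T))) + 8 * \<kappa>\<^sup>2))"
        by (rule ennreal_leI)
      also have "\<dots> = ennreal (real n) * (\<Sum>k<n. ennreal a * ennreal (V (phys (noise \<omega>) (real (k * T)))) + ennreal (8 * \<kappa>\<^sup>2))"
        using a V_nonneg by (simp add: ennreal_mult sum_nonneg ennreal_plus flip: sum_ennreal)
      also have "\<dots> \<le> ennreal (real n) * (\<Sum>k<n. ennreal a * v (k * T) \<omega> + ennreal (8 * \<kappa>\<^sup>2))"
        by (intro mult_left_mono sum_mono add_right_mono v(4)[OF \<omega>]) auto
      finally show ?thesis .
    qed
    have "(\<integral>\<^sup>+ \<omega>. ennreal ((defect n (real T) \<omega>)\<^sup>2) \<partial>\<Omega>)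
        \<le> (\<integral>\<^sup>+ \<omega>. ennreal (real n) * (\<Sum>k<n. ennreal a * v (k * T) \<omega> + ennreal (8 * \<kappa>\<^sup>2)) \<partial>\<Omega>)"
      by (rule nn_integral_mono) (rule pw)
    also have "\<dots> = ennreal (real n) * (\<Sum>k<n. ennreal a * (\<integral>\<^sup>+ \<omega>. v (k * T) \<omega> \<partial>\<Omega>) + ennreal (8 * \<kappa>\<^sup>2))"
      using v(2) by (simp add: nn_integral_cmult nn_integral_sum nn_integral_add emeasure_space_1)
    also have "\<dots> \<le> ennreal (real n) * (\<Sum>k<n. ennreal a * ennreal K0 + ennreal (8 * \<kappa>\<^sup>2))"
      by (intro mult_left_mono sum_mono add_right_mono v(3)) auto
    also have "ennreal a * ennreal K0 + ennreal (8 * \<kappa>\<^sup>2) = ennreal K"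
      using a v(1) by (simp add: K_def ennreal_plus ennreal_mult)
    also have "ennreal (real n) * (\<Sum>k<n. ennreal K) = ennreal ((real n)\<^sup>2 * K)"
      using a v(1) by (simp add: K_def ennreal_mult' ennreal_of_nat_eq_real_of_nat power2_eq_square mult.assoc)
    finally show ?thesis .
  qed
  moreover have "0 \<le> K" using a v(1) by (simp add: K_def)
  ultimately show ?thesis by blast
qed

text \<open>
  \<open>\<mu>\<close> is almost additive: \<open>\<mu> (n T) / (n T)\<close> and \<open>\<mu> T / T\<close> differ by a multiple of \<open>1 / T\<close>, and any two
  times have a common multiple.
\<close>

lemma mean_rate_converges: "\<exists>\<rho>. (\<lambda>n. \<mu> (real (Suc n)) / real (Suc n)) \<longlonglongrightarrow> \<rho>"
proof -
  obtain K where K: "0 \<le> K" "\<And>n T. 0 < T \<Longrightarrow>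
     (\<integral>\<^sup>+ \<omega>. ennreal ((defect n (real T) \<omega>)\<^sup>2) \<partial>\<Omega>) \<le> ennreal ((real n)\<^sup>2 * K)"
    using defect_bound by blast
  have close: "\<bar>\<mu> (real n * real T) / (real n * real T) - \<mu> (real T) / real T\<bar> \<le> (1 + K) / real T"
    if n: "0 < n" and T: "0 < T" for n T :: nat
  proof -
    define D where "D = defect n (real T)"
    have pos: "0 < real n * real T" "0 < real T" using n T by auto
    have Dint: "integrable \<Omega> D"
      unfolding D_def defect_def[abs_def] by (intro Bochner_Integration.integrable_diff Bochner_Integration.integrable_sum Y_integrable pos)
    have ED: "expectation D = \<mu> (real n * real T) - real n * \<mu> (real T)"
      unfolding D_def defect_def[abs_def] using pos
      by (simp add: Y_integrable Y_expectations(1))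
    have Dm[measurable]: "D \<in> borel_measurable \<Omega>" using Dint by simp
    have D2: "integrable \<Omega> (\<lambda>\<omega>. (D \<omega>)\<^sup>2)" "expectation (\<lambda>\<omega>. (D \<omega>)\<^sup>2) \<le> (real n)\<^sup>2 * K"
    proof -
      have fin: "(\<integral>\<^sup>+ \<omega>. ennreal ((D \<omega>)\<^sup>2) \<partial>\<Omega>) \<le> ennreal ((real n)\<^sup>2 * K)"
        unfolding D_def by (rule K(2)[OF T])
      show i: "integrable \<Omega> (\<lambda>\<omega>. (D \<omega>)\<^sup>2)"
        by (rule integrableI_bounded) (auto intro: le_less_trans[OF fin])
      show "expectation (\<lambda>\<omega>. (D \<omega>)\<^sup>2) \<le> (real n)\<^sup>2 * K"
        using fin K(1) by (subst (asm) nn_integral_eq_integral[OF i]) auto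
    qed
    have "\<bar>expectation D\<bar> \<le> expectation (\<lambda>\<omega>. \<bar>D \<omega>\<bar>)"
      by (rule integral_abs_bound)
    also have "\<dots> \<le> expectation (\<lambda>\<omega>. real n + (D \<omega>)\<^sup>2 / real n)"
    proof (rule integral_mono)
      fix \<omega>
      have "2 * (real n * \<bar>D \<omega>\<bar>) \<le> (real n)\<^sup>2 + \<bar>D \<omega>\<bar>\<^sup>2"
        using sum_squares_bound[of "real n" "\<bar>D \<omega>\<bar>"] by simp
      then have "real n * \<bar>D \<omega>\<bar> \<le> (real n)\<^sup>2 + (D \<omega>)\<^sup>2"
        using mult_nonneg_nonneg[OF of_nat_0_le_iff abs_ge_zero, of n "D \<omega>"] unfolding power2_abs by linarith
      then show "\<bar>D \<omega>\<bar> \<le> real n + (D \<omega>)\<^sup>2 / real n"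
        using n by (simp add: field_simps power2_eq_square)
    qed (use Dint D2 in auto)
    also have "\<dots> = real n + expectation (\<lambda>\<omega>. (D \<omega>)\<^sup>2) / real n"
      using D2(1) by (simp add: prob_space)
    also have "\<dots> \<le> real n + (real n)\<^sup>2 * K / real n"
      using D2(2) by (intro add_left_mono divide_right_mono) auto
    also have "\<dots> = real n * (1 + K)" using n by (simp add: power2_eq_square algebra_simps)
    finally have "\<bar>\<mu> (real n * real T) - real n * \<mu> (real T)\<bar> \<le> real n * (1 + K)" unfolding ED .
    then have "\<bar>\<mu> (real n * real T) - real n * \<mu> (real T)\<bar> / (real n * real T) \<le> real n * (1 + K) / (real n * real T)"
      using pos by (intro divide_right_mono) auto
    also have "\<dots> = (1 + K) / real T" using n by simp
    also have "\<bar>\<mu> (real n * real T) - real n * \<mu> (real T)\<bar> / (real n * real T)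
        = \<bar>(\<mu> (real n * real T) - real n * \<mu> (real T)) / (real n * real T)\<bar>"
      using pos by (simp add: abs_mult)
    also have "(\<mu> (real n * real T) - real n * \<mu> (real T)) / (real n * real T) = \<mu> (real n * real T) / (real n * real T) - \<mu> (real T) / real T"
      using n by (simp add: diff_divide_distrib)
    finally show ?thesis .
  qed
  define x where "x = (\<lambda>n. \<mu> (real (Suc n)) / real (Suc n))"
  have x: "\<bar>x m - x n\<bar> \<le> (1 + K) / real (Suc m) + (1 + K) / real (Suc n)" for m n
  proof -
    have "\<bar>\<mu> (real (Suc n) * real (Suc m)) / (real (Suc n) * real (Suc m)) - x m\<bar> \<le> (1 + K) / real (Suc m)"
      "\<bar>\<mu> (real (Suc m) * real (Suc n)) / (real (Suc m) * real (Suc n)) - x n\<bar> \<le> (1 + K) / real (Suc n)"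
      unfolding x_def by (rule close; simp)+
    then show ?thesis unfolding mult.commute[of "real (Suc m)" "real (Suc n)"] by linarith
  qed
  have "Cauchy x"
  proof (rule metric_CauchyI)
    fix r :: real assume r: "0 < r"
    obtain k where k: "2 * (1 + K) / r < real k" using reals_Archimedean2 by blast
    show "\<exists>k. \<forall>m\<ge>k. \<forall>n\<ge>k. dist (x m) (x n) < r"
    proof (intro exI allI impI)
      fix m n assume mn: "k \<le> m" "k \<le> n"
      have "(1 + K) / real (Suc p) < r / 2" if "k \<le> p" for p
      proof -
        have "2 * (1 + K) < real k * r" using k r by (simp add: pos_divide_less_eq)
        also have "\<dots> \<le> real (Suc p) * r" using that r by (intro mult_right_mono) auto
        finally show ?thesis by (simp add: pos_divide_less_eq mult.commute del: of_nat_Suc)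
      qed
      from this[OF mn(1)] this[OF mn(2)] x[of m n] show "dist (x m) (x n) < r"
        unfolding dist_real_def by linarith
    qed
  qed
  then show ?thesis unfolding x_def using real_Cauchy_convergent convergent_def by blast
qed


text \<open>A Lipschitz function is asymptotically linear as soon as it is so along the cubes.\<close>

lemma limit_of_limit_along_cubes:
  fixes x :: "real \<Rightarrow> real"
  assumes lip: "\<And>r t. 0 \<le> r \<Longrightarrow> r \<le> t \<Longrightarrow> \<bar>x t - x r\<bar> \<le> b * (t - r)" and x0: "x 0 = 0" and b: "0 \<le> b"
    and cubes: "(\<lambda>j. x (real (Suc j) ^ 3) / real (Suc j) ^ 3) \<longlonglongrightarrow> \<rho>"
  shows "((\<lambda>t. x t / t) \<longlongrightarrow> \<rho>) at_top"
proof -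
  define n where "n = (\<lambda>t::real. nat \<lfloor>root 3 t\<rfloor> - 1)"
  have "filterlim (\<lambda>t::real. root 3 t) at_top at_top"
    unfolding filterlim_at_top
  proof
    fix Z :: real
    show "eventually (\<lambda>t. Z \<le> root 3 t) at_top"
      using eventually_ge_at_top[of "Z ^ 3"]
    proof eventually_elim
      case (elim t)
      then have "root 3 (Z ^ 3) \<le> root 3 t" by simp
      then show ?case by (simp add: odd_real_root_power_cancel)
    qed
  qed
  from filterlim_compose[OF filterlim_compose[OF filterlim_nat_sequentially filterlim_floor_sequentially] this]
  have nlim: "filterlim n sequentially at_top"
    unfolding n_def by (rule filterlim_compose[OF filterlim_minus_const_nat_at_top])
  define y where "y = (\<lambda>j. x (real (Suc j) ^ 3) / real (Suc j) ^ 3)"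
  have close: "\<bar>x t / t - y (n t)\<bar> \<le> 14 * b / real (Suc (n t))" if t: "1 \<le> t" for t
  proof -
    define k where "k = real (Suc (n t))"
    have r1: "1 \<le> root 3 t" using t by simp
    then have "1 \<le> \<lfloor>root 3 t\<rfloor>" by simp
    then have "k = of_int \<lfloor>root 3 t\<rfloor>" by (simp add: k_def n_def)
    then have k: "k \<le> root 3 t" "root 3 t \<le> k + 1" "1 \<le> k"
      using \<open>1 \<le> \<lfloor>root 3 t\<rfloor>\<close> by linarith+
    have rt: "root 3 t ^ 3 = t" using t by simp
    have "k ^ 3 \<le> root 3 t ^ 3" "root 3 t ^ 3 \<le> (k + 1) ^ 3"
      by (rule power_mono; use k r1 in linarith)+
    then have kt: "k ^ 3 \<le> t" "t \<le> (k + 1) ^ 3" unfolding rt .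
    have k3: "0 < k ^ 3" using k by simp
    have gap: "t - k ^ 3 \<le> 7 * k\<^sup>2"
    proof -
      have "k * 1 \<le> k * k" by (rule mult_left_mono; use k(3) in linarith)
      with k(3) have "k \<le> k\<^sup>2" "1 \<le> k\<^sup>2" unfolding power2_eq_square by linarith+
      moreover have "(k + 1) ^ 3 = k ^ 3 + 3 * k\<^sup>2 + 3 * k + 1" by (simp add: power3_eq_cube power2_eq_square algebra_simps)
      ultimately show ?thesis using kt by linarith
    qed
    have b1: "\<bar>x t - x (k ^ 3)\<bar> \<le> b * (t - k ^ 3)" using kt k3 by (intro lip) auto
    have b2: "\<bar>x (k ^ 3)\<bar> \<le> b * k ^ 3" using lip[of 0 "k ^ 3"] k3 by (simp add: x0)
    have "x t / t - x (k ^ 3) / k ^ 3 = (x t - x (k ^ 3)) / t - x (k ^ 3) * ((t - k ^ 3) / (t * k ^ 3))"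
      using k3 t by (simp add: field_simps)
    then have "\<bar>x t / t - x (k ^ 3) / k ^ 3\<bar> \<le> \<bar>(x t - x (k ^ 3)) / t\<bar> + \<bar>x (k ^ 3) * ((t - k ^ 3) / (t * k ^ 3))\<bar>"
      by linarith
    also have "\<dots> = \<bar>x t - x (k ^ 3)\<bar> / t + \<bar>x (k ^ 3)\<bar> * ((t - k ^ 3) / (t * k ^ 3))"
      using kt k3 t by (simp add: abs_mult)
    also have "\<dots> \<le> b * (t - k ^ 3) / t + (b * k ^ 3) * ((t - k ^ 3) / (t * k ^ 3))"
      using b1 b2 kt k3 t by (intro add_mono divide_right_mono mult_right_mono) auto
    also have "\<dots> = 2 * b * (t - k ^ 3) / t" using k3 t by (simp add: field_simps)
    also have "\<dots> \<le> 2 * b * (7 * k\<^sup>2) / k ^ 3"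
      using gap kt k3 b t by (intro frac_le mult_left_mono) auto
    also have "\<dots> = 14 * b / k" using k by (simp add: power3_eq_cube power2_eq_square)
    finally show ?thesis by (simp only: y_def k_def)
  qed
  have "((\<lambda>t. y (n t)) \<longlongrightarrow> \<rho>) at_top"
    using filterlim_compose[OF cubes nlim] by (simp add: y_def)
  moreover have "((\<lambda>t. x t / t - y (n t)) \<longlongrightarrow> 0) at_top"
  proof (rule Lim_null_comparison)
    show "eventually (\<lambda>t. norm (x t / t - y (n t)) \<le> 14 * b / real (Suc (n t))) at_top"
      using eventually_ge_at_top[of 1] by eventually_elim (simp add: close del: of_nat_Suc)
    have "(\<lambda>j. 14 * b / real (Suc j)) \<longlonglongrightarrow> 0"
      by (rule LIMSEQ_Suc[OF lim_const_over_n])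
    from filterlim_compose[OF this nlim] show "((\<lambda>t. 14 * b / real (Suc (n t))) \<longlongrightarrow> 0) at_top" .
  qed
  ultimately have "((\<lambda>t. y (n t) + (x t / t - y (n t))) \<longlongrightarrow> \<rho> + 0) at_top" by (rule tendsto_add)
  then show ?thesis by simp
qed

text \<open>
  At time \<open>j\<^sup>3\<close> the displacement is compared with the \<open>j\<^sup>2\<close> block displacements for \<open>T = j\<close>. After division
  by \<open>j\<^sup>3\<close>, the defect \<open>D\<close> and the fluctuation \<open>S\<close> of the sum over the blocks both have second moments
  of order \<open>1 / j\<^sup>2\<close>.
\<close>

theorem displacement_rate: "\<exists>\<rho>. AE \<omega> in \<Omega>. ((\<lambda>t. disp (noise \<omega>) t / t) \<longlongrightarrow> \<rho>) at_top"
proof -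
  obtain \<rho> where \<rho>: "(\<lambda>n. \<mu> (real (Suc n)) / real (Suc n)) \<longlonglongrightarrow> \<rho>" using mean_rate_converges by blast
  obtain K where K: "0 \<le> K" "\<And>n T. 0 < T \<Longrightarrow>
     (\<integral>\<^sup>+ \<omega>. ennreal ((defect n (real T) \<omega>)\<^sup>2) \<partial>\<Omega>) \<le> ennreal ((real n)\<^sup>2 * K)"
    using defect_bound by blast
  define C where "C = 2 * K + 2 * rate\<^sup>2"
  have C: "0 \<le> C" using K(1) by (simp add: C_def)
  have "AE \<omega> in \<Omega>. (\<lambda>j. ennreal ((Y (real (Suc j) ^ 3) 0 \<omega> / real (Suc j) ^ 3 - \<mu> (real (Suc j)) / real (Suc j))\<^sup>2)) \<longlonglongrightarrow> 0"
  proof (rule AE_tendsto_0_of_summable_integrals[where c = "\<lambda>j. C * (1 / real (Suc j) ^ 2)"])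
    show "summable (\<lambda>j. C * (1 / real (Suc j) ^ 2))"
      using summable_Suc_iff[of "\<lambda>n. inverse (real n ^ 2)"] inverse_power_summable[of 2, where 'a = real]
      by (intro summable_mult) (simp add: inverse_eq_divide)
    show "0 \<le> C * (1 / real (Suc j) ^ 2)" for j using C by simp
    note [measurable] = Y_measurable
    fix j
    define T where "T = real (Suc j)"
    define n where "n = (Suc j)\<^sup>2"
    have T: "0 < T" by (simp add: T_def)
    have nT: "real n = T\<^sup>2" by (simp add: n_def T_def del: of_nat_Suc)
    have T3: "real n * T = T ^ 3" unfolding nT by (simp add: power3_eq_cube power2_eq_square)
    have [measurable]: "Y (T ^ 3) 0 \<in> borel_measurable \<Omega>" "Y T k \<in> borel_measurable \<Omega>" for k using T by auto
    show "(\<lambda>\<omega>. ennreal ((Y (real (Suc j) ^ 3) 0 \<omega> / real (Suc j) ^ 3 - \<mu> (real (Suc j)) / real (Suc j))\<^sup>2)) \<in> borel_measurable \<Omega>"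
      unfolding T_def[symmetric] by measurable
    define D where "D = defect n T"
    define S where "S = (\<lambda>\<omega>. \<Sum>k<n. Y T k \<omega> - \<mu> T)"
    have D_eq: "D \<omega> = Y (T ^ 3) 0 \<omega> - (\<Sum>k<n. Y T k \<omega>)" for \<omega> by (simp only: D_def defect_def T3)
    have [measurable]: "D \<in> borel_measurable \<Omega>" "S \<in> borel_measurable \<Omega>" unfolding D_eq[abs_def] S_def by measurable
    have pw: "(Y (T ^ 3) 0 \<omega> / T ^ 3 - \<mu> T / T)\<^sup>2 \<le> 2 / T ^ 6 * (D \<omega>)\<^sup>2 + 2 / T ^ 6 * (S \<omega>)\<^sup>2" for \<omega>
    proof -
      have "Y (T ^ 3) 0 \<omega> / T ^ 3 - \<mu> T / T = (Y (T ^ 3) 0 \<omega> - T\<^sup>2 * \<mu> T) / T ^ 3"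
        using T by (simp add: field_simps power3_eq_cube power2_eq_square)
      also have "Y (T ^ 3) 0 \<omega> - T\<^sup>2 * \<mu> T = D \<omega> + S \<omega>"
        by (simp add: D_eq S_def sum_subtractf nT)
      also have "((D \<omega> + S \<omega>) / T ^ 3)\<^sup>2 = (D \<omega> + S \<omega>)\<^sup>2 / T ^ 6"
        by (simp add: power_divide flip: power_mult)
      also have "\<dots> \<le> (2 * (D \<omega>)\<^sup>2 + 2 * (S \<omega>)\<^sup>2) / T ^ 6"
        using sum_squares_bound[of "D \<omega>" "S \<omega>"] T by (intro divide_right_mono) (auto simp: power2_sum)
      finally show ?thesis by (simp add: add_divide_distrib)
    qed
    have c6: "0 \<le> 2 / T ^ 6" using T by simp
    have "(\<integral>\<^sup>+ \<omega>. ennreal ((Y (T ^ 3) 0 \<omega> / T ^ 3 - \<mu> T / T)\<^sup>2) \<partial>\<Omega>)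
        \<le> (\<integral>\<^sup>+ \<omega>. ennreal (2 / T ^ 6) * ennreal ((D \<omega>)\<^sup>2) + ennreal (2 / T ^ 6) * ennreal ((S \<omega>)\<^sup>2) \<partial>\<Omega>)"
    proof (rule nn_integral_mono)
      fix \<omega>
      show "ennreal ((Y (T ^ 3) 0 \<omega> / T ^ 3 - \<mu> T / T)\<^sup>2) \<le> ennreal (2 / T ^ 6) * ennreal ((D \<omega>)\<^sup>2) + ennreal (2 / T ^ 6) * ennreal ((S \<omega>)\<^sup>2)"
        using ennreal_leI[OF pw[of \<omega>]] c6 by (simp only: ennreal_mult[OF c6 zero_le_power2, symmetric] ennreal_plus[symmetric] mult_nonneg_nonneg zero_le_power2)
    qed
    also have "\<dots> = ennreal (2 / T ^ 6) * (\<integral>\<^sup>+ \<omega>. ennreal ((D \<omega>)\<^sup>2) \<partial>\<Omega>) + ennreal (2 / T ^ 6) * (\<integral>\<^sup>+ \<omega>. ennreal ((S \<omega>)\<^sup>2) \<partial>\<Omega>)"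
      by (simp add: nn_integral_add nn_integral_cmult)
    also have "\<dots> \<le> ennreal (2 / T ^ 6) * ennreal ((real n)\<^sup>2 * K) + ennreal (2 / T ^ 6) * ennreal (real n * (T * rate)\<^sup>2)"
    proof (intro add_mono mult_left_mono)
      show "(\<integral>\<^sup>+ \<omega>. ennreal ((D \<omega>)\<^sup>2) \<partial>\<Omega>) \<le> ennreal ((real n)\<^sup>2 * K)"
        using K(2)[of "Suc j" n] unfolding D_def by (simp add: T_def)
      show "(\<integral>\<^sup>+ \<omega>. ennreal ((S \<omega>)\<^sup>2) \<partial>\<Omega>) \<le> ennreal (real n * (T * rate)\<^sup>2)"
        unfolding S_def using variance_sum[OF T, of n]
        by (subst nn_integral_eq_integral) (auto intro!: ennreal_leI)
    qed auto
    also have "\<dots> = ennreal (2 / T ^ 6 * ((real n)\<^sup>2 * K) + 2 / T ^ 6 * (real n * (T * rate)\<^sup>2))"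
      using c6 K(1) by (simp add: ennreal_mult[symmetric] ennreal_plus[symmetric] del: ennreal_plus)
    also have "2 / T ^ 6 * ((real n)\<^sup>2 * K) + 2 / T ^ 6 * (real n * (T * rate)\<^sup>2) = C * (1 / T\<^sup>2)"
    proof -
      have "T ^ 6 = (T\<^sup>2 * T\<^sup>2) * T\<^sup>2" by (simp flip: power_add)
      then show ?thesis
        using T by (simp add: nT C_def power_mult_distrib power2_eq_square[of "T\<^sup>2"] field_simps)
    qed
    finally show "(\<integral>\<^sup>+ \<omega>. ennreal ((Y (real (Suc j) ^ 3) 0 \<omega> / real (Suc j) ^ 3 - \<mu> (real (Suc j)) / real (Suc j))\<^sup>2) \<partial>\<Omega>)
        \<le> ennreal (C * (1 / real (Suc j) ^ 2))" by (simp only: T_def)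
  qed
  from this AE_space have "AE \<omega> in \<Omega>. ((\<lambda>t. disp (noise \<omega>) t / t) \<longlongrightarrow> \<rho>) at_top"
  proof eventually_elim
    case (elim \<omega>)
    define z where "z = (\<lambda>j. Y (real (Suc j) ^ 3) 0 \<omega> / real (Suc j) ^ 3 - \<mu> (real (Suc j)) / real (Suc j))"
    have "(\<lambda>j. ennreal ((z j)\<^sup>2)) \<longlonglongrightarrow> ennreal 0" using elim(1) unfolding z_def ennreal_0 .
    then have "(\<lambda>j. (z j)\<^sup>2) \<longlonglongrightarrow> 0" by (subst (asm) tendsto_ennreal_iff) auto
    then have "(\<lambda>j. sqrt ((z j)\<^sup>2)) \<longlonglongrightarrow> sqrt 0" by (rule tendsto_real_sqrt)
    then have "z \<longlonglongrightarrow> 0" by (simp add: tendsto_rabs_zero_iff)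
    from tendsto_add[OF this \<rho>]
    have "(\<lambda>j. disp (noise \<omega>) (real (Suc j) ^ 3) / real (Suc j) ^ 3) \<longlonglongrightarrow> \<rho>"
      by (simp add: z_def disp_noise_eq_Y[OF elim(2)])
    then show ?case
      using disp_lipschitz[OF noise_continuous[OF elim(2)]] rate_nonneg
      by (intro limit_of_limit_along_cubes[where b = rate]) (auto simp: rate_def disp_0[OF noise_continuous[OF elim(2)]])
  qed
  then show ?thesis by blast
qed

end

section \<open>The stationary Ornstein-Uhlenbeck path\<close>

text \<open>
  Sublinear growth at \<open>- \<infinity>\<close> makes the integral defining the stationary process converge absolutely.
\<close>

lemma exp_weighted_integrable:
  fixes x :: "real \<Rightarrow> real"
  assumes c: "continuous_on UNIV x" and lim: "((\<lambda>t. x (- t) / t) \<longlongrightarrow> 0) at_top"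
  shows "set_integrable lborel {..b} (\<lambda>s. exp s * x s)"
proof -
  have "eventually (\<lambda>t. norm (x (- t) / t) < 1) at_top"
    using tendstoD[OF lim, of 1] by (simp add: dist_norm)
  then obtain T where T: "\<And>t. T \<le> t \<Longrightarrow> norm (x (- t) / t) < 1"
    unfolding eventually_at_top_linorder by blast
  define T' where "T' = max T 1"
  have big: "\<bar>x s\<bar> \<le> 1 - s" if "s \<le> - T'" for s
  proof -
    have s: "0 < - s" "T \<le> - s" using that by (auto simp: T'_def)
    from T[OF s(2)] have "\<bar>x s\<bar> / (- s) < 1" using s(1) by (simp add: abs_divide)
    then show ?thesis using s(1) by (simp only: pos_divide_less_eq)
  qed
  have bd: "bounded (x ` {- T'..0})"
    by (intro compact_imp_bounded compact_continuous_image continuous_on_subset[OF c]) auto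
  then obtain C where C: "\<And>s. s \<in> {- T'..0} \<Longrightarrow> \<bar>x s\<bar> \<le> C" unfolding bounded_iff real_norm_def by blast
  define D where "D = max C 1"
  have bound: "\<bar>x s\<bar> \<le> D * (1 - s)" if s: "s \<le> 0" for s
  proof (cases "s \<le> - T'")
    case True
    have "1 * (1 - s) \<le> D * (1 - s)" using s by (intro mult_right_mono) (auto simp: D_def)
    then show ?thesis using big[OF True] by simp
  next
    case False
    then have "\<bar>x s\<bar> \<le> D" using C[of s] s by (auto simp: D_def)
    also have "D * 1 \<le> D * (1 - s)" using s by (intro mult_left_mono) (auto simp: D_def)
    then have "D \<le> D * (1 - s)" by simp
    finally show ?thesis .
  qed
  have xm: "x \<in> borel_measurable borel" using c by (rule borel_measurable_continuous_onI)
  define h where "h = (\<lambda>t::real. D * (t ^ 0 * exp (- t) * indicator {0..} t + t ^ 1 * exp (- t) * indicator {0..} t))"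
  have "integrable lborel h"
    unfolding h_def using has_bochner_integral_I0i_power_exp_m'[of 0] has_bochner_integral_I0i_power_exp_m'[of 1]
    by (intro integrable_mult_right Bochner_Integration.integrable_add) (auto simp: has_bochner_integral_iff)
  from lborel_integrable_real_affine[OF this, of "- 1" 0]
  have "integrable lborel (\<lambda>s. h (- s))" by simp
  then have "integrable lborel (\<lambda>s. indicator {..0} s *\<^sub>R (exp s * x s))"
  proof (rule Bochner_Integration.integrable_bound)
    show "(\<lambda>s. indicator {..0} s *\<^sub>R (exp s * x s)) \<in> borel_measurable lborel" using xm by measurable
    show "AE s in lborel. norm (indicator {..0} s *\<^sub>R (exp s * x s)) \<le> norm (h (- s))"
    proof (rule AE_I2)
      fix s :: real
      show "norm (indicator {..0} s *\<^sub>R (exp s * x s)) \<le> norm (h (- s))"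
      proof (cases "s \<le> 0")
        case True
        have "exp s * \<bar>x s\<bar> \<le> exp s * (D * (1 - s))" using bound[OF True] by (intro mult_left_mono) auto
        also have "\<dots> = h (- s)" using True by (simp add: h_def algebra_simps)
        finally show ?thesis using True by (simp add: abs_mult)
      qed simp
    qed
  qed
  then have i0: "set_integrable lborel {..0} (\<lambda>s. exp s * x s)" by (simp add: set_integrable_def)
  have "set_integrable lborel {0..b} (\<lambda>s. exp s * x s)"
    by (intro borel_integrable_atLeastAtMost' continuous_intros continuous_on_subset[OF c]) auto
  from set_integrable_Un[OF i0 this] have "set_integrable lborel ({..0} \<union> {0..b}) (\<lambda>s. exp s * x s)" by simp
  then show ?thesis by (rule set_integrable_subset) auto
qed

lemma exp_integral_lower: "(LINT s:{..0}|lborel. exp s) = (1 :: real)" "set_integrable lborel {..0} (\<lambda>s::real. exp s)"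
proof -
  have e: "has_bochner_integral lborel (\<lambda>t. exp (- t) * indicator {0..} t :: real) 1"
    using has_bochner_integral_I0i_power_exp_m'[of 0] by simp
  have eq: "indicator {..0} s *\<^sub>R exp s = exp (- (0 + - 1 * s)) * indicator {0..} (0 + - 1 * s)" for s :: real
    by (auto simp: indicator_def)
  show "set_integrable lborel {..0} (\<lambda>s::real. exp s)"
    unfolding set_integrable_def eq using e by (intro lborel_integrable_real_affine) (auto simp: has_bochner_integral_iff)
  have "(LINT s:{..0}|lborel. exp s) = (\<integral>t. exp (- t) * indicator {0..} t \<partial>lborel :: real)"
    unfolding set_lebesgue_integral_def eq
    using lborel_integral_real_affine[of "- 1" "\<lambda>t. exp (- t) * indicator {0..} t :: real" 0] by simp
  then show "(LINT s:{..0}|lborel. exp s) = (1 :: real)" using e by (simp add: has_bochner_integral_iff)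
qed

lemma ou_path_formula:
  fixes x :: "real \<Rightarrow> real"
  assumes c: "continuous_on UNIV x" and lim: "((\<lambda>t. x (- t) / t) \<longlongrightarrow> 0) at_top" and t: "0 \<le> t"
  shows "(LINT s:{..0}|lborel. exp s * (x (s + t) - x t))
    = exp (- t) * ((LINT s:{..0}|lborel. exp s * x s) + integral {0..t} (\<lambda>s. exp s * x s)) - x t"
proof -
  note int = exp_weighted_integrable[OF c lim]
  have i0t: "set_integrable lborel {0..t} (\<lambda>s. exp s * x s)"
    by (rule set_integrable_subset[OF int[of t]]) auto
  have "(LINT s:{..t}|lborel. exp s * x s) = (LINT s:{..0} \<union> {0..t}|lborel. exp s * x s)"
    using t by (intro arg_cong[where f = "\<lambda>A. set_lebesgue_integral lborel A _"]) auto
  also have "\<dots> = (LINT s:{..0}|lborel. exp s * x s) + (LINT s:{0..t}|lborel. exp s * x s)"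
  proof (rule set_integral_Un_AE[OF _ _ _ int i0t])
    show "AE s in lborel. \<not> (s \<in> {..0} \<and> s \<in> {0..t})"
      using AE_lborel_singleton[of "0::real"] by eventually_elim auto
  qed auto
  also have "(LINT s:{0..t}|lborel. exp s * x s) = integral {0..t} (\<lambda>s. exp s * x s)"
    by (rule set_borel_integral_eq_integral(2)[OF i0t])
  finally have split: "(LINT s:{..t}|lborel. exp s * x s) = (LINT s:{..0}|lborel. exp s * x s) + integral {0..t} (\<lambda>s. exp s * x s)" .
  have eq: "exp (- t) * (indicator {..t} (t + 1 * s) *\<^sub>R (exp (t + 1 * s) * x (t + 1 * s))) = indicator {..0} s *\<^sub>R (exp s * x (s + t))" for s
    by (auto simp: indicator_def exp_add exp_minus field_simps)
  have i1: "set_integrable lborel {..0} (\<lambda>s. exp s * x (s + t))"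
    unfolding set_integrable_def eq[symmetric]
    by (intro integrable_mult_right lborel_integrable_real_affine[OF int[unfolded set_integrable_def]]) simp
  have "(LINT s:{..0}|lborel. exp s * x (s + t)) = exp (- t) * (LINT s:{..t}|lborel. exp s * x s)"
    unfolding set_lebesgue_integral_def eq[symmetric]
    using lborel_integral_real_affine[of 1 "\<lambda>s. indicator {..t} s *\<^sub>R (exp s * x s)" t] by simp
  moreover have "(LINT s:{..0}|lborel. exp s * (x (s + t) - x t)) = (LINT s:{..0}|lborel. exp s * x (s + t)) - (LINT s:{..0}|lborel. exp s * x t)"
    unfolding right_diff_distrib using exp_integral_lower(2) by (intro set_integral_diff i1) auto
  moreover have "(LINT s:{..0}|lborel. exp s * x t) = x t"
    using exp_integral_lower(1) by simp
  ultimately show ?thesis unfolding split by simp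
qed

text \<open>
  \<open>ou_drift \<omega>\<close> is the stationary process minus the driving noise; unlike the stationary process
  it is differentiable in time.
\<close>

definition ou_drift :: "real ^ 'i \<Rightarrow> ('i::finite \<Rightarrow> real \<Rightarrow> real) \<Rightarrow> real \<Rightarrow> real ^ 'i" where
  "ou_drift \<epsilon> \<omega> t = (\<chi> j. - (\<epsilon> $ j) * (exp (- t) * ((LINT s:{..0}|lborel. exp s * \<omega> j s) + integral {0..t} (\<lambda>s. exp s * \<omega> j s))))"

text \<open>
  Continuity and sublinear growth in both time directions, at every site.
\<close>

definition tame :: "('i \<Rightarrow> real \<Rightarrow> real) \<Rightarrow> bool" where
  "tame \<omega> \<longleftrightarrow> (\<forall>j. continuous_on UNIV (\<omega> j) \<and> ((\<lambda>t. \<omega> j t / t) \<longlongrightarrow> 0) at_top \<and> ((\<lambda>t. \<omega> j (- t) / t) \<longlongrightarrow> 0) at_top)"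

lemma ou_stationary_eq:
  assumes "tame \<omega>" "0 \<le> t"
  shows "ou_stationary \<epsilon> (shift t \<omega>) = ou_drift \<epsilon> \<omega> t + (\<chi> j. \<epsilon> $ j * \<omega> j t)"
proof -
  have "(LINT s:{..0}|lborel. exp s * (\<omega> j (s + t) - \<omega> j t))
    = exp (- t) * ((LINT s:{..0}|lborel. exp s * \<omega> j s) + integral {0..t} (\<lambda>s. exp s * \<omega> j s)) - \<omega> j t" for j
    using assms by (intro ou_path_formula) (auto simp: tame_def)
  then show ?thesis
    unfolding ou_stationary_def ou_drift_def shift_def by (simp only: vec_eq_iff) (simp add: right_diff_distrib[of "_ $ _"])
qed

lemma vec_lambda_sum: "(\<chi> j. f j) = (\<Sum>j\<in>UNIV. f j *\<^sub>R axis j (1 :: real))"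
  by (simp add: vec_eq_iff axis_def if_distrib[of "\<lambda>x. _ * x"] cong: if_cong)

lemma ou_drift_deriv:
  assumes \<omega>: "tame \<omega>" and t: "0 \<le> t"
  shows "(ou_drift \<epsilon> \<omega> has_vector_derivative - ou_stationary \<epsilon> (shift t \<omega>)) (at t within {0..})"
proof -
  define I where "I = (\<lambda>j. LINT s:{..0}|lborel. exp s * \<omega> j s)"
  define q where "q = (\<lambda>j t. - (\<epsilon> $ j) * (exp (- t) * (I j + integral {0..t} (\<lambda>s. exp s * \<omega> j s))))"
  have c: "continuous_on UNIV (\<omega> j)" for j using \<omega> by (simp add: tame_def)
  have "(q j has_real_derivative - (q j t + \<epsilon> $ j * \<omega> j t)) (at t within {0..})" for j
  proof -
    have "((\<lambda>t. integral {0..t} (\<lambda>s. exp s * \<omega> j s)) has_real_derivative exp t * \<omega> j t) (at t within {0..})"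
      unfolding has_real_derivative_iff_has_vector_derivative
      by (rule antiderivative_from_0[OF _ t]) (intro continuous_intros c)
    then show ?thesis
      unfolding q_def by (auto intro!: derivative_eq_intros simp: algebra_simps exp_minus)
  qed
  then have "((\<lambda>t. q j t *\<^sub>R axis j (1 :: real)) has_vector_derivative - (q j t + \<epsilon> $ j * \<omega> j t) *\<^sub>R axis j 1) (at t within {0..})" for j
    using has_vector_derivative_scaleR[OF _ has_vector_derivative_const[of "axis j (1 :: real)"], of "q j" "- (q j t + \<epsilon> $ j * \<omega> j t)" t "{0..}"] by simp
  then have "((\<lambda>t. \<Sum>j\<in>UNIV. q j t *\<^sub>R axis j (1 :: real)) has_vector_derivative (\<Sum>j\<in>UNIV. - (q j t + \<epsilon> $ j * \<omega> j t) *\<^sub>R axis j 1)) (at t within {0..})"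
    by (intro has_vector_derivative_sum)
  moreover have "(\<Sum>j\<in>UNIV. - (q j t + \<epsilon> $ j * \<omega> j t) *\<^sub>R axis j (1 :: real)) = - ou_stationary \<epsilon> (shift t \<omega>)"
    unfolding ou_stationary_eq[OF \<omega> t] vec_lambda_sum[symmetric]
    by (simp add: vec_eq_iff ou_drift_def q_def I_def)
  moreover have "(\<lambda>t. \<Sum>j\<in>UNIV. q j t *\<^sub>R axis j (1 :: real)) = ou_drift \<epsilon> \<omega>"
    unfolding vec_lambda_sum[symmetric] by (simp add: fun_eq_iff ou_drift_def q_def I_def)
  ultimately show ?thesis by simp
qed

lemma exp_average_sublinear:
  fixes x :: "real \<Rightarrow> real"
  assumes c: "continuous_on UNIV x" and lim: "((\<lambda>t. x t / t) \<longlongrightarrow> 0) at_top"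
  shows "((\<lambda>t. exp (- t) * (I + integral {0..t} (\<lambda>s. exp s * x s)) / t) \<longlongrightarrow> 0) at_top"
proof -
  have d: "((\<lambda>t. I + integral {0..t} (\<lambda>s. exp s * x s)) has_real_derivative exp t * x t) (at t)" if "0 < t" for t
  proof -
    have "((\<lambda>t. integral {0..t} (\<lambda>s. exp s * x s)) has_vector_derivative exp t * x t) (at t within {0..})"
      by (rule antiderivative_from_0) (use that in \<open>auto intro!: continuous_intros c\<close>)
    then have "((\<lambda>t. integral {0..t} (\<lambda>s. exp s * x s)) has_real_derivative exp t * x t) (at t)"
      using that at_within_interior[of t "{0..}"] by (simp add: has_real_derivative_iff_has_vector_derivative interior_Ici[of "-1"])
    then show ?thesis by (auto intro!: derivative_eq_intros)
  qed
  have "((\<lambda>t. (I + integral {0..t} (\<lambda>s. exp s * x s)) / (exp t * t)) \<longlongrightarrow> 0) at_top"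
  proof (rule lhospital_at_top_at_top[where f' = "\<lambda>t. exp t * x t" and g' = "\<lambda>t. exp t * t + exp t"])
    show "LIM t at_top. exp t * t :> (at_top :: real filter)"
      by (rule filterlim_at_top_mult_at_top[OF exp_at_top filterlim_ident])
    show "eventually (\<lambda>t::real. exp t * t + exp t \<noteq> 0) at_top"
      using eventually_gt_at_top[of 0]
    proof eventually_elim
      case (elim t)
      then have "0 < exp t * t + exp t" by (intro add_nonneg_pos) auto
      then show ?case by simp
    qed
    show "eventually (\<lambda>t. ((\<lambda>t. I + integral {0..t} (\<lambda>s. exp s * x s)) has_real_derivative exp t * x t) (at t)) at_top"
      using eventually_gt_at_top[of 0] by eventually_elim (rule d)
    show "eventually (\<lambda>t. ((\<lambda>t. exp t * t) has_real_derivative exp t * t + exp (t :: real)) (at t)) at_top"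
      by (intro always_eventually allI) (auto intro!: derivative_eq_intros)
    show "((\<lambda>t. exp t * x t / (exp t * t + exp t)) \<longlongrightarrow> 0) at_top"
    proof (rule Lim_null_comparison)
      show "((\<lambda>t. \<bar>x t / t\<bar>) \<longlongrightarrow> 0) at_top" using lim by (rule tendsto_rabs_zero)
      show "eventually (\<lambda>t. norm (exp t * x t / (exp t * t + exp t)) \<le> \<bar>x t / t\<bar>) at_top"
        using eventually_gt_at_top[of 0]
      proof eventually_elim
        case (elim t)
        have "exp t * x t / (exp t * t + exp t) = exp t * x t / (exp t * (t + 1))" by (simp add: algebra_simps)
        also have "\<dots> = x t / (t + 1)" by (rule mult_divide_mult_cancel_left) simp
        also have "norm \<dots> \<le> \<bar>x t / t\<bar>" using elim by (simp add: abs_divide divide_left_mono)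
        finally show ?case .
      qed
    qed
  qed
  then show ?thesis by (simp add: exp_minus field_simps)
qed

lemma ou_drift_sublinear:
  assumes "tame \<omega>"
  shows "((\<lambda>t. ou_drift \<epsilon> \<omega> t /\<^sub>R t) \<longlongrightarrow> 0) at_top"
proof (rule vec_tendstoI)
  fix j
  have "((\<lambda>t. - (\<epsilon> $ j) * (exp (- t) * ((LINT s:{..0}|lborel. exp s * \<omega> j s) + integral {0..t} (\<lambda>s. exp s * \<omega> j s)) / t)) \<longlongrightarrow> - (\<epsilon> $ j) * 0) at_top"
    using assms by (intro tendsto_mult tendsto_const exp_average_sublinear) (auto simp: tame_def)
  then show "((\<lambda>t. (ou_drift \<epsilon> \<omega> t /\<^sub>R t) $ j) \<longlongrightarrow> 0 $ j) at_top"
    by (simp add: ou_drift_def divide_inverse mult_ac)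
qed

lemma AE_tame:
  assumes W: "two_sided_wiener W"
  shows "AE \<omega> in (noise_space W :: ('i::finite \<Rightarrow> real \<Rightarrow> real) measure). tame \<omega>"
proof -
  have 1: "AE \<omega> in (noise_space W :: ('i \<Rightarrow> real \<Rightarrow> real) measure). ((\<lambda>t. \<omega> j (r * t) / t) \<longlongrightarrow> 0) at_top" if "\<bar>r\<bar> = 1" for j r
  proof -
    interpret brownian_moments "noise_space W :: ('i \<Rightarrow> real \<Rightarrow> real) measure" "\<lambda>t \<omega>. \<omega> j (r * t)"
      by (rule noise_brownian_moments[OF W that])
    show ?thesis by (rule sublinear_growth)
  qed
  have "AE \<omega> in (noise_space W :: ('i \<Rightarrow> real \<Rightarrow> real) measure). \<forall>j\<in>UNIV. ((\<lambda>t. \<omega> j (1 * t) / t) \<longlongrightarrow> 0) at_top"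
    by (rule AE_finite_allI) (use 1[of 1] in simp_all)
  moreover have "AE \<omega> in (noise_space W :: ('i \<Rightarrow> real \<Rightarrow> real) measure). \<forall>j\<in>UNIV. ((\<lambda>t. \<omega> j (- 1 * t) / t) \<longlongrightarrow> 0) at_top"
    by (rule AE_finite_allI) (use 1[of "- 1"] in simp_all)
  ultimately show ?thesis using AE_space
  proof eventually_elim
    case (elim \<omega>)
    then show ?case using two_sided_wienerD(2)[OF W space_noise[OF elim(3)]] by (auto simp: tame_def)
  qed
qed

section \<open>The projection onto the direction of drift\<close>

text \<open>
  In coordinates, \<open>E\<^sub>2\<close> consists of the pairs \<open>(u, v)\<close> with \<open>\<alpha> avg u + avg v = 0\<close>.
\<close>

lemma projE1_eq:
  fixes y :: "(real ^ 'i::finite) \<times> (real ^ 'i)"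
  assumes \<alpha>: "\<alpha> \<noteq> 0"
  defines "e \<equiv> (\<chi> j. 1) :: real ^ 'i"
  shows "projE1 \<alpha> y = (fst y \<bullet> e / (e \<bullet> e) + (snd y \<bullet> e / (e \<bullet> e)) / \<alpha>) *\<^sub>R eta0"
proof -
  have ee: "e \<bullet> e > 0" by (simp add: e_def inner_vec_def)
  have eta: "eta0 = (e, 0)" "eta_m1 \<alpha> = (e, - \<alpha> *\<^sub>R e)"
    by (auto simp: eta0_def eta_m1_def e_def vec_eq_iff)
  have E1: "x \<in> E1 \<longleftrightarrow> (\<exists>r. x = r *\<^sub>R eta0)" for x :: "(real ^ 'i) \<times> (real ^ 'i)"
    by (auto simp: E1_def span_singleton)
  have E11: "x \<in> E11 \<alpha> \<longleftrightarrow> (\<exists>r q. x = r *\<^sub>R eta0 + q *\<^sub>R eta_m1 \<alpha>)" for x :: "(real ^ 'i) \<times> (real ^ 'i)"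
    unfolding E11_def E1_def E_m1_def span_singleton by blast
  have E22: "x \<in> E22 \<alpha> \<longleftrightarrow> x \<bullet> eta0 = 0 \<and> x \<bullet> eta_m1 \<alpha> = 0" for x :: "(real ^ 'i) \<times> (real ^ 'i)"
  proof
    assume x: "x \<in> E22 \<alpha>"
    have "(eta0 :: (real ^ 'i) \<times> (real ^ 'i)) \<in> E11 \<alpha>"
      by (subst E11) (rule exI[of _ 1], rule exI[of _ 0], simp)
    moreover have "(eta_m1 \<alpha> :: (real ^ 'i) \<times> (real ^ 'i)) \<in> E11 \<alpha>"
      by (subst E11) (rule exI[of _ 0], rule exI[of _ 1], simp)
    ultimately show "x \<bullet> eta0 = 0 \<and> x \<bullet> eta_m1 \<alpha> = 0"
      using x by (simp add: E22_def orthogonal_comp_def orthogonal_def inner_commute[of x])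
  next
    assume "x \<bullet> eta0 = 0 \<and> x \<bullet> eta_m1 \<alpha> = 0"
    then show "x \<in> E22 \<alpha>"
      by (auto simp: E22_def orthogonal_comp_def orthogonal_def E11 inner_simps inner_commute)
  qed
  have E2: "x \<in> E2 \<alpha> \<longleftrightarrow> (\<exists>q. x - q *\<^sub>R eta_m1 \<alpha> \<in> E22 \<alpha>)" for x :: "(real ^ 'i) \<times> (real ^ 'i)"
  proof
    assume "x \<in> E2 \<alpha>"
    then obtain q z where "x = q *\<^sub>R eta_m1 \<alpha> + z" "z \<in> E22 \<alpha>"
      unfolding E2_def E_m1_def span_singleton by blast
    then show "\<exists>q. x - q *\<^sub>R eta_m1 \<alpha> \<in> E22 \<alpha>" by (metis add_diff_cancel_left')
  next
    assume "\<exists>q. x - q *\<^sub>R eta_m1 \<alpha> \<in> E22 \<alpha>"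
    then obtain q where "x - q *\<^sub>R eta_m1 \<alpha> \<in> E22 \<alpha>" ..
    moreover have "x = q *\<^sub>R eta_m1 \<alpha> + (x - q *\<^sub>R eta_m1 \<alpha>)" by simp
    ultimately show "x \<in> E2 \<alpha>" unfolding E2_def E_m1_def span_singleton by blast
  qed
  obtain u v where y: "y = (u, v)" by (cases y)
  define c where "c = u \<bullet> e / (e \<bullet> e) + (v \<bullet> e / (e \<bullet> e)) / \<alpha>"
  have iff: "y - r *\<^sub>R eta0 \<in> E2 \<alpha> \<longleftrightarrow> r = c" for r
  proof -
    have "y - r *\<^sub>R eta0 \<in> E2 \<alpha> \<longleftrightarrow> (\<exists>q. u \<bullet> e = (r + q) * (e \<bullet> e) \<and> v \<bullet> e = - \<alpha> * q * (e \<bullet> e))"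
    proof -
      have "y - r *\<^sub>R eta0 - q *\<^sub>R eta_m1 \<alpha> \<in> E22 \<alpha> \<longleftrightarrow> u \<bullet> e = (r + q) * (e \<bullet> e) \<and> v \<bullet> e = - \<alpha> * q * (e \<bullet> e)" for q
      proof -
        have "y - r *\<^sub>R eta0 - q *\<^sub>R eta_m1 \<alpha> = (u - (r + q) *\<^sub>R e, v + (\<alpha> * q) *\<^sub>R e)"
          by (simp add: y eta algebra_simps)
        then have "y - r *\<^sub>R eta0 - q *\<^sub>R eta_m1 \<alpha> \<in> E22 \<alpha> \<longleftrightarrow>
            u \<bullet> e - (r + q) * (e \<bullet> e) = 0 \<and>
            u \<bullet> e - (r + q) * (e \<bullet> e) - \<alpha> * (v \<bullet> e + \<alpha> * q * (e \<bullet> e)) = 0"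
          unfolding E22 eta by (simp add: inner_simps algebra_simps)
        also have "\<dots> \<longleftrightarrow> u \<bullet> e - (r + q) * (e \<bullet> e) = 0 \<and> v \<bullet> e + \<alpha> * q * (e \<bullet> e) = 0"
          using \<alpha> by auto
        also have "\<dots> \<longleftrightarrow> u \<bullet> e = (r + q) * (e \<bullet> e) \<and> v \<bullet> e = - \<alpha> * q * (e \<bullet> e)"
          by (auto simp: algebra_simps eq_neg_iff_add_eq_0)
        finally show ?thesis .
      qed
      then show ?thesis unfolding E2 by blast
    qed
    also have "\<dots> \<longleftrightarrow> r = c"
    proof
      assume "\<exists>q. u \<bullet> e = (r + q) * (e \<bullet> e) \<and> v \<bullet> e = - \<alpha> * q * (e \<bullet> e)"
      then obtain q where "u \<bullet> e = (r + q) * (e \<bullet> e)" "v \<bullet> e = - \<alpha> * q * (e \<bullet> e)" by blast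
      then show "r = c" using ee \<alpha> by (simp add: c_def)
    next
      assume r: "r = c"
      have "u \<bullet> e = (r + - (v \<bullet> e / (e \<bullet> e)) / \<alpha>) * (e \<bullet> e)" "v \<bullet> e = - \<alpha> * (- (v \<bullet> e / (e \<bullet> e)) / \<alpha>) * (e \<bullet> e)"
        using ee \<alpha> by (auto simp: r c_def)
      then show "\<exists>q. u \<bullet> e = (r + q) * (e \<bullet> e) \<and> v \<bullet> e = - \<alpha> * q * (e \<bullet> e)" by blast
    qed
    finally show ?thesis .
  qed
  have "projE1 \<alpha> y = c *\<^sub>R eta0"
    unfolding projE1_def
  proof (rule the_equality)
    show "c *\<^sub>R eta0 \<in> E1 \<and> y - c *\<^sub>R eta0 \<in> E2 \<alpha>"
    proof
      show "c *\<^sub>R eta0 \<in> E1" unfolding E1_def by (intro span_scale span_base) simp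
      show "y - c *\<^sub>R eta0 \<in> E2 \<alpha>" using iff by simp
    qed
    show "x = c *\<^sub>R eta0" if "x \<in> E1 \<and> y - x \<in> E2 \<alpha>" for x using that iff E1[of x] by auto
  qed
  then show ?thesis by (simp add: c_def y)
qed

section \<open>The rotation number\<close>

theorem theorem6p3:
  fixes \<alpha> \<beta> K \<delta> c1 c2 \<kappa> a L\<^sub>F :: real
    and f \<epsilon> :: "real ^ ('n::finite ^ 'd::finite)"
    and A :: "real ^ ('n ^ 'd) ^ ('n ^ 'd)"
    and lam :: "nat \<Rightarrow> real"
    and g :: "real \<Rightarrow> real"
    and W :: "(real \<Rightarrow> real) measure"
  assumes N: "CARD('n) \<ge> 2"
    and params: "\<alpha> > 0" "K > 0" "0 < \<delta>" "\<delta> \<le> 1"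
    and A_sym: "transpose A = A"
    and A_nonneg: "\<forall>x. x \<bullet> (A *v x) \<ge> 0"
    and A_eig: "eigenvalue_list A lam"
    and lam: "lam 0 = 0" "lam 0 < lam 1"
      "\<forall>i j. 1 \<le> i \<and> i \<le> j \<and> j < CARD('n) ^ CARD('d) \<longrightarrow> lam i \<le> lam j"
    and A_ones: "A *v (\<chi> j. 1) = lam 0 *\<^sub>R (\<chi> j. 1)"
    and g_C1: "\<forall>x. g differentiable (at x)" "continuous_on UNIV (deriv g)"
    and g_period: "smallest_period g \<kappa>"
    and c_pos: "c1 > 0" "c2 > 0"
    and g_bounds: "\<forall>x. \<bar>g x\<bar> \<le> c1" "\<forall>x. \<bar>deriv g x\<bar> \<le> c2"
    and W: "two_sided_wiener W"
    and a: "a = \<alpha> / 2 - \<bar>\<alpha> / 2 - \<delta> * K * lam 1 / \<alpha>\<bar>"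
    and L\<^sub>F: "L\<^sub>F = 2 * c2 * \<bar>\<beta>\<bar> / \<alpha>"
    and gap: "a > 4 * L\<^sub>F"
  shows "\<exists>\<rho> :: real. AE \<omega> in noise_space W.
           \<forall>Y\<^sub>0 :: (real ^ ('n ^ 'd)) \<times> (real ^ ('n ^ 'd)).
             ((\<lambda>t. projE1 \<alpha> (solution \<alpha> \<beta> K A f g \<epsilon> t \<omega> Y\<^sub>0) /\<^sub>R t) \<longlongrightarrow> \<rho> *\<^sub>R eta0) at_top"
proof -
  define e where "e = ((\<chi> j. 1) :: real ^ ('n ^ 'd))"
  define L where "L = (\<lambda>u. K *\<^sub>R (A *v u))"
  define \<Phi> where "\<Phi> = (\<lambda>u :: real ^ ('n ^ 'd). \<beta> *\<^sub>R (\<chi> j. g (u $ j)) :: real ^ ('n ^ 'd))"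
  \<comment> \<open>Since \<open>\<delta> \<le> 1\<close>, this is a lower bound for the gap \<open>K * lam 1\<close> of \<open>K A\<close>.\<close>
  define \<Lambda> where "\<Lambda> = \<delta> * K * lam 1"
  define M where "M = c2 * \<bar>\<beta>\<bar>"
  have A1: "A *v e = 0" using A_ones lam(1) by (simp add: e_def)
  have lam1: "0 < lam 1" using lam by simp
  have \<Lambda>0: "0 < \<Lambda>" using params lam1 by (simp add: \<Lambda>_def)
  have gapA: "lam 1 * (norm x)\<^sup>2 \<le> x \<bullet> (A *v x)" if "x \<bullet> e = 0" for x
  proof (rule spectral_gap[of A lam])
    show "lam 1 \<le> lam k" if "1 \<le> k" "k < CARD('n ^ 'd)" for k
      using lam(3) that by auto
  qed (use A_sym A1 A_eig lam lam1 that in \<open>auto simp: eigenvalue_list_def e_def\<close>)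
  have g_lip: "\<bar>g x - g y\<bar> \<le> c2 * \<bar>x - y\<bar>" for x y
  proof -
    have "norm (g x - g y) \<le> c2 * norm (x - y)"
    proof (rule field_differentiable_bound[of UNIV g "deriv g"])
      fix z
      have "g field_differentiable (at z)"
        using g_C1(1) by (simp add: real_differentiable_def field_differentiable_def)
      then show "(g has_field_derivative deriv g z) (at z within UNIV)"
        by (simp add: field_differentiable_derivI)
      show "norm (deriv g z) \<le> c2" using g_bounds by simp
    qed auto
    then show ?thesis by simp
  qed
  have \<Phi>_lip: "norm (\<Phi> x - \<Phi> y) \<le> M * norm (x - y)" for x y
  proof -
    have "norm (\<Phi> x - \<Phi> y) = \<bar>\<beta>\<bar> * norm ((\<chi> j. g (x $ j) - g (y $ j)) :: real ^ ('n ^ 'd))"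
    proof -
      have "\<Phi> x - \<Phi> y = \<beta> *\<^sub>R (\<chi> j. g (x $ j) - g (y $ j))"
        by (simp add: \<Phi>_def vec_eq_iff algebra_simps)
      then show ?thesis by simp
    qed
    also have "\<dots> \<le> \<bar>\<beta>\<bar> * norm (c2 *\<^sub>R (x - y))"
      by (intro mult_left_mono norm_le_componentwise_cart) (use g_lip c_pos in \<open>auto simp: abs_mult\<close>)
    also have "\<dots> = M * norm (x - y)" using c_pos by (simp add: M_def)
    finally show ?thesis .
  qed
  obtain c where \<Phi>_bound: "norm (f - \<Phi> x) \<le> c" for x
  proof
    fix x
    have "norm (f - \<Phi> x) \<le> norm f + norm (\<Phi> x)" by (rule norm_triangle_ineq4)
    also have "norm (\<Phi> x) \<le> \<bar>\<beta>\<bar> * norm ((\<chi> j. c1) :: real ^ ('n ^ 'd))"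
      unfolding \<Phi>_def norm_scaleR
      by (intro mult_left_mono norm_le_componentwise_cart) (use g_bounds c_pos in auto)
    finally show "norm (f - \<Phi> x) \<le> norm f + \<bar>\<beta>\<bar> * norm ((\<chi> j. c1) :: real ^ ('n ^ 'd))" by simp
  qed
  have a_le: "a \<le> \<Lambda> / \<alpha>" "a \<le> \<alpha> - \<Lambda> / \<alpha>"
    unfolding a \<Lambda>_def[symmetric] by linarith+
  have "8 * M / \<alpha> = 4 * L\<^sub>F" by (simp add: L\<^sub>F M_def)
  with gap a_le have gaps: "8 * M / \<alpha> < \<Lambda> / \<alpha>" "8 * M / \<alpha> < \<alpha> - \<Lambda> / \<alpha>" by auto
  have M0: "0 \<le> M" using c_pos by (simp add: M_def)
  have M8: "8 * M \<le> \<Lambda>" using gaps(1) params by (simp add: divide_less_cancel)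
  have \<Lambda>\<alpha>: "\<Lambda> \<le> \<alpha>\<^sup>2"
  proof -
    have "0 \<le> 8 * M / \<alpha>" using M0 params by simp
    then have "\<Lambda> / \<alpha> \<le> \<alpha>" using gaps(2) by linarith
    then show ?thesis using params by (simp add: pos_divide_le_eq power2_eq_square)
  qed
  interpret noisy_system L "\<lambda>u. f - \<Phi> u" e \<alpha> \<Lambda> M c \<kappa> W \<epsilon>
  proof (intro noisy_system.intro damped_system.intro noisy_system_axioms.intro)
    show "linear L"
      unfolding L_def by (intro linearI) (auto simp: matrix_vector_right_distrib matrix_vector_mult_scaleR algebra_simps)
    show "x \<bullet> L y = L x \<bullet> y" for x y
      using A_sym by (simp add: L_def) (metis dot_lmul_matrix vector_transpose_matrix)
    show "L e = 0" by (simp add: L_def A1)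
    show "e \<noteq> 0" by (simp add: e_def vec_eq_iff)
    show "\<Lambda> * (norm x)\<^sup>2 \<le> x \<bullet> L x" if "x \<bullet> e = 0" for x
    proof -
      have "\<delta> * (K * (lam 1 * (norm x)\<^sup>2)) \<le> 1 * (K * (lam 1 * (norm x)\<^sup>2))"
        using params lam1 by (intro mult_right_mono) auto
      also have "\<dots> \<le> K * (x \<bullet> (A *v x))" using gapA[OF that] params by simp
      finally show ?thesis by (simp add: \<Lambda>_def L_def mult.assoc)
    qed
    show "norm ((f - \<Phi> x) - (f - \<Phi> y)) \<le> M * norm (x - y)" for x y
      using \<Phi>_lip[of y x] by (simp add: norm_minus_commute)
    show "f - \<Phi> (x + \<kappa> *\<^sub>R e) = f - \<Phi> x" for x
      using g_period by (simp add: \<Phi>_def e_def smallest_period_def)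
    show "0 < \<kappa>" using g_period by (simp add: smallest_period_def)
  qed (use params \<Lambda>0 \<Lambda>\<alpha> M0 M8 \<Phi>_bound W in auto)
  obtain \<rho> where \<rho>: "AE \<omega> in noise_space W. ((\<lambda>t. disp (noise \<omega>) t / t) \<longlongrightarrow> \<rho>) at_top"
    using displacement_rate by blast
  have "AE \<omega> in noise_space W.
           \<forall>Y\<^sub>0 :: (real ^ ('n ^ 'd)) \<times> (real ^ ('n ^ 'd)).
             ((\<lambda>t. projE1 \<alpha> (solution \<alpha> \<beta> K A f g \<epsilon> t \<omega> Y\<^sub>0) /\<^sub>R t) \<longlongrightarrow> \<rho> *\<^sub>R eta0) at_top"
    using \<rho> AE_tame[OF W] AE_space
  proof (eventually_elim, intro allI)
    fix \<omega> and Y\<^sub>0 :: "(real ^ ('n ^ 'd)) \<times> (real ^ ('n ^ 'd))"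
    assume lim: "((\<lambda>t. disp (noise \<omega>) t / t) \<longlongrightarrow> \<rho>) at_top" and tame: "tame \<omega>" and \<omega>: "\<omega> \<in> space (noise_space W)"
    define q where "q = ou_drift \<epsilon> \<omega>"
    define w where "w = noise \<omega>"
    have w: "continuous_on UNIV w" unfolding w_def by (rule noise_continuous[OF \<omega>])
    have z: "ou_stationary \<epsilon> (shift t \<omega>) = q t + w t" if "0 \<le> t" for t
      unfolding q_def w_def noise_def by (rule ou_stationary_eq[OF tame that])
    have dq: "(q has_vector_derivative - (q t + w t)) (at t within {0..})" if "0 \<le> t" for t
      using ou_drift_deriv[OF tame that, of \<epsilon>] by (simp add: z[OF that] q_def)
    define x0 where "x0 = (fst Y\<^sub>0, snd Y\<^sub>0 + q 0)"
    \<comment> \<open>The substitution \<open>y = v + q\<close> turns the random system into the one driven by \<open>w\<close>.\<close>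
    have rhs: "rhs \<alpha> \<beta> K A f g (q t + w t) (u, v) = vf w t (u, v + q t) + (0, q t + w t)" for t u v
      unfolding rhs_def vf_def by (simp add: L_def \<Phi>_def algebra_simps)
    have to_vf: "solves_ode (vf w) x0 (\<lambda>t. Y t + (0, q t))" if Y: "is_solution \<alpha> \<beta> K A f g \<epsilon> \<omega> Y\<^sub>0 Y" for Y
      unfolding solves_ode_def
    proof (intro conjI allI impI)
      show "Y 0 + (0, q 0) = x0" using Y by (simp add: is_solution_def x0_def prod_eq_iff)
      fix t :: real assume t: "0 \<le> t"
      have "(Y has_vector_derivative rhs \<alpha> \<beta> K A f g (q t + w t) (Y t)) (at t within {0..})"
        using Y t by (simp add: is_solution_def z)
      from has_vector_derivative_add[OF this has_vector_derivative_Pair[OF has_vector_derivative_const[of 0] dq[OF t]]]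
      show "((\<lambda>t. Y t + (0, q t)) has_vector_derivative vf w t (Y t + (0, q t))) (at t within {0..})"
        using rhs[of t "fst (Y t)" "snd (Y t)"] by (simp add: plus_prod_def)
    qed
    define x where "x = sol w x0"
    have x: "solves_ode (vf w) x0 x" unfolding x_def by (rule sol_solves[OF w])
    have ex: "is_solution \<alpha> \<beta> K A f g \<epsilon> \<omega> Y\<^sub>0 (\<lambda>t. x t - (0, q t))"
      unfolding is_solution_def
    proof (intro conjI allI impI)
      show "x 0 - (0, q 0) = Y\<^sub>0" using x by (simp add: solves_ode_def x0_def prod_eq_iff)
      fix t :: real assume t: "0 \<le> t"
      have "(x has_vector_derivative vf w t (x t)) (at t within {0..})" using x t by (simp add: solves_ode_def)
      from has_vector_derivative_diff[OF this has_vector_derivative_Pair[OF has_vector_derivative_const[of 0] dq[OF t]]]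
      show "((\<lambda>t. x t - (0, q t)) has_vector_derivative rhs \<alpha> \<beta> K A f g (ou_stationary \<epsilon> (shift t \<omega>)) (x t - (0, q t))) (at t within {0..})"
        unfolding z[OF t] using rhs[of t "fst (x t)" "snd (x t) - q t"]
        by (simp add: minus_prod_def plus_prod_def del: minus_add_distrib)
    qed
    have solution: "solution \<alpha> \<beta> K A f g \<epsilon> t \<omega> Y\<^sub>0 = x t - (0, q t)" if t: "0 \<le> t" for t
      unfolding solution_def
    proof (rule the_equality)
      show "\<exists>Y. is_solution \<alpha> \<beta> K A f g \<epsilon> \<omega> Y\<^sub>0 Y \<and> Y t = x t - (0, q t)" using ex by blast
      fix y assume "\<exists>Y. is_solution \<alpha> \<beta> K A f g \<epsilon> \<omega> Y\<^sub>0 Y \<and> Y t = y"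
      then obtain Y where Y: "is_solution \<alpha> \<beta> K A f g \<epsilon> \<omega> Y\<^sub>0 Y" "Y t = y" by blast
      have "Y t + (0, q t) = x t" by (rule vf_unique[OF to_vf[OF Y(1)] x t])
      then show "y = x t - (0, q t)" using Y(2) by (simp add: eq_diff_eq)
    qed
    have proj: "projE1 \<alpha> (solution \<alpha> \<beta> K A f g \<epsilon> t \<omega> Y\<^sub>0) /\<^sub>R t = ((\<Theta> (x t) - avg (q t) / \<alpha>) / t) *\<^sub>R eta0" if t: "0 < t" for t
    proof -
      have "projE1 \<alpha> (solution \<alpha> \<beta> K A f g \<epsilon> t \<omega> Y\<^sub>0) = \<Theta> (x t - (0, q t)) *\<^sub>R eta0"
        using t params projE1_eq[of \<alpha> "x t - (0, q t)", folded e_def]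
        by (simp add: solution \<Theta>_def avg_def split_beta)
      moreover have "\<Theta> (x t - (0, q t)) = \<Theta> (x t) - avg (q t) / \<alpha>"
        by (simp add: \<Theta>_simps(2)) (simp add: \<Theta>_def avg_simps)
      ultimately show ?thesis by (simp add: divide_inverse mult.commute)
    qed
    define b where "b = sqrt (V x0 / (\<Lambda> * (e \<bullet> e))) + 2 * \<kappa>"
    have over_t: "((\<lambda>t. r / t) \<longlongrightarrow> 0) at_top" for r :: real
      by (rule tendsto_divide_0[OF tendsto_const filterlim_at_top_imp_at_infinity[OF filterlim_ident]])
    have "((\<lambda>t. (\<Theta> (x t) - \<Theta> x0 - disp w t) / t) \<longlongrightarrow> 0) at_top"
    proof (rule Lim_null_comparison[OF _ over_t[of b]])
      show "eventually (\<lambda>t. norm ((\<Theta> (x t) - \<Theta> x0 - disp w t) / t) \<le> b / t) at_top"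
        using eventually_gt_at_top[of 0]
      proof eventually_elim
        case (elim t)
        then have "\<bar>\<Theta> (x t) - \<Theta> x0 - disp w t\<bar> \<le> b" unfolding b_def by (intro disp_compare[OF w x]) simp
        then show ?case using elim by (simp add: abs_divide divide_right_mono)
      qed
    qed
    from tendsto_add[OF tendsto_add[OF this over_t[of "\<Theta> x0"]] lim]
    have "((\<lambda>t. \<Theta> (x t) / t) \<longlongrightarrow> \<rho>) at_top" by (simp add: w_def add_divide_distrib[symmetric])
    moreover have "((\<lambda>t. avg (q t /\<^sub>R t)) \<longlongrightarrow> avg 0) at_top"
      unfolding q_def by (rule bounded_linear.tendsto[OF bounded_linear_avg ou_drift_sublinear[OF tame]])
    then have "((\<lambda>t. avg (q t /\<^sub>R t) / \<alpha>) \<longlongrightarrow> 0 / \<alpha>) at_top"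
      using params by (intro tendsto_divide) (auto simp: avg_simps)
    ultimately have "((\<lambda>t. \<Theta> (x t) / t - avg (q t /\<^sub>R t) / \<alpha>) \<longlongrightarrow> \<rho> - 0 / \<alpha>) at_top" by (rule tendsto_diff)
    then have "((\<lambda>t. (\<Theta> (x t) / t - avg (q t /\<^sub>R t) / \<alpha>) *\<^sub>R eta0) \<longlongrightarrow> \<rho> *\<^sub>R (eta0 :: (real ^ ('n ^ 'd)) \<times> _)) at_top"
      by (intro tendsto_scaleR tendsto_const) simp
    then show "((\<lambda>t. projE1 \<alpha> (solution \<alpha> \<beta> K A f g \<epsilon> t \<omega> Y\<^sub>0) /\<^sub>R t) \<longlongrightarrow> \<rho> *\<^sub>R eta0) at_top"
    proof (rule Lim_transform_eventually)
      show "eventually (\<lambda>t. (\<Theta> (x t) / t - avg (q t /\<^sub>R t) / \<alpha>) *\<^sub>R eta0 = projE1 \<alpha> (solution \<alpha> \<beta> K A f g \<epsilon> t \<omega> Y\<^sub>0) /\<^sub>R t) at_top"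
        using eventually_gt_at_top[of 0]
      proof eventually_elim
        case (elim t)
        then show ?case unfolding proj[OF elim] by (simp add: avg_simps(3) diff_divide_distrib divide_inverse algebra_simps)
      qed
    qed
  qed
  then show ?thesis by blast
qed

end
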